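(* Let $\mathfrak{g}$ be a semisimple complex Lie algebra with Cartan subalgebra $\mathfrak{h}$ and Weyl group $W$. To every $\lambda\in\mathfrak{h}^*_{\mathrm{reg}}$ there is associated a canonical filtration on every irreducible representation $\chi$ of $W$ whose associated graded vector space has Hilbert series $K_{\mathfrak{g},\chi}(y^{-2})$.
   Context: $\mathfrak{h}^*_{\mathrm{reg}}\subseteq\mathfrak{h}^*$ is the set of regular elements (trivial stabilizer in $W$). $\mathcal{B}$ is the flag variety of $\mathfrak{g}$, dimensions are complex, and $H^*(\mathcal{B},\mathbf{C})$ carries the $W$-action for which $H^*(\mathcal{B},\mathbf{C})\cong\mathrm{Sym}\,\mathfrak{h}/((\mathrm{Sym}\,\mathfrak{h})^W_+)$ as a graded $W$-module, $\mathfrak{h}$ in degree two, where $((\mathrm{Sym}\,\mathfrak{h})^W_+)$ is the ideal generated by positive-degree invariants. The generalized Kostka polynomial is $K_{\mathfrak{g},\chi}(t):=\sum_{i\ge0}t^i\dim\mathrm{Hom}_W(\chi,H^{2\dim\mathcal{B}-2i}(\mathcal{B},\mathbf{C}))$. The canonical filtration in question: give $\mathcal{O}(\mathfrak{h}^* )=\mathrm{Sym}\,\mathfrak{h}$ the grading with $\mathfrak{h}$ in degree two. The graded $\mathcal{O}(\mathfrak{h}^* )^W$-module $(\chi\otimes\mathcal{O}(\mathfrak{h}^* ))^W$ of $W$-equivariant polynomial maps $\mathfrak{h}^*\to\chi$ has, for $\lambda\in\mathfrak{h}^*_{\mathrm{reg}}$ with image $\bar\lambda\in\mathfrak{h}^*/W$,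 fiber at $\bar\lambda$ identified with $\chi$ via evaluation $f\mapsto f(\lambda)$. The filtration is increasing, with $F^{\le m}\chi:=\{f(\lambda)\mid f\in(\chi\otimes\mathcal{O}(\mathfrak{h}^* ))^W\text{ of degree at most }m+2\dim\mathcal{B}\}$ for $m\in\mathbf{Z}$. The Hilbert series of the associated graded space is $\sum_m y^m\dim(F^{\le m}\chi/F^{\le m-1}\chi)$. *)

theory Defs
  imports
    Complex_Main
    "HOL-Library.Function_Algebras"
    "HOL-Computational_Algebra.Formal_Laurent_Series"
begin

section \<open>Complex vector spaces\<close>

class scaleC =
  fixes scaleC :: "complex \<Rightarrow> 'a \<Rightarrow> 'a" (infixr "*\<^sub>C" 75)

class complex_vector = ab_group_add + scaleC +
  assumes scaleC_add_right: "a *\<^sub>C (x + y) = a *\<^sub>C x + a *\<^sub>C y"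
    and scaleC_add_left: "(a + b) *\<^sub>C x = a *\<^sub>C x + b *\<^sub>C x"
    and scaleC_scaleC: "a *\<^sub>C (b *\<^sub>C x) = (a * b) *\<^sub>C x"
    and scaleC_one: "1 *\<^sub>C x = x"

interpretation complex_vector:
  vector_space "scaleC :: complex \<Rightarrow> 'a \<Rightarrow> 'a::complex_vector"
  by standard (simp_all add: scaleC_add_right scaleC_add_left scaleC_scaleC scaleC_one)

interpretation complex_vector:
  vector_space_pair "scaleC :: complex \<Rightarrow> 'a \<Rightarrow> 'a::complex_vector"
    "scaleC :: complex \<Rightarrow> 'b \<Rightarrow> 'b::complex_vector" ..

abbreviation clinear :: "('a::complex_vector \<Rightarrow> 'b::complex_vector) \<Rightarrow> bool"
  where "clinear \<equiv> Vector_Spaces.linear scaleC scaleC"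

instantiation complex :: complex_vector
begin

definition scaleC_complex :: "complex \<Rightarrow> complex \<Rightarrow> complex"
  where "scaleC_complex a x = a * x"

instance
  by standard (simp_all add: scaleC_complex_def algebra_simps)

end

instantiation "fun" :: (type, complex_vector) complex_vector
begin

definition scaleC_fun :: "complex \<Rightarrow> ('a \<Rightarrow> 'b) \<Rightarrow> 'a \<Rightarrow> 'b"
  where "scaleC_fun a f = (\<lambda>x. a *\<^sub>C f x)"

instance
  by standard
    (simp_all add: scaleC_fun_def plus_fun_def scaleC_add_right scaleC_add_left
      scaleC_scaleC scaleC_one)

end

text \<open>
  A linear choice of coset representatives modulo a subspace \<open>B\<close>. Its kernel is \<open>B\<close>, so for
  a subspace \<open>A \<supseteq> B\<close> the image of \<open>A\<close> is a model of the quotient vector space \<open>A / B\<close>, with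
  \<open>coset_rep B\<close> as quotient map. No construction below depends, up to canonical isomorphism,
  on the choice that is made.
\<close>

definition coset_rep :: "'a::complex_vector set \<Rightarrow> 'a \<Rightarrow> 'a"
  where "coset_rep B = (SOME q. clinear q \<and> (\<forall>x\<in>B. q x = 0) \<and> (\<forall>x. x - q x \<in> B))"

definition quotient_space :: "'a::complex_vector set \<Rightarrow> 'a set \<Rightarrow> 'a set"
  where "quotient_space A B = coset_rep B ` A"

lemma coset_rep:
  fixes B :: "'a::complex_vector set"
  assumes "complex_vector.subspace B"
  shows "clinear (coset_rep B)" and "x \<in> B \<Longrightarrow> coset_rep B x = 0" and "x - coset_rep B x \<in> B"
proof -
  have "clinear (id :: 'a \<Rightarrow> 'a)"
    by (rule complex_vector.linear_id)
  from complex_vector.linear_exists_left_inverse_on[OF this assms]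
  obtain g :: "'a \<Rightarrow> 'a" where g: "range g \<subseteq> B" "clinear g" "\<forall>v\<in>B. g v = v"
    by auto
  have "clinear (\<lambda>x. x - g x)"
    using complex_vector.linear_compose_sub[OF complex_vector.linear_ident g(2)] by simp
  then have "\<exists>q. clinear q \<and> (\<forall>x\<in>B. q x = 0) \<and> (\<forall>x. x - q x \<in> B)"
    using g by (intro exI[of _ "\<lambda>x. x - g x"]) auto
  from someI_ex[OF this]
  show "clinear (coset_rep B)" "x \<in> B \<Longrightarrow> coset_rep B x = 0" "x - coset_rep B x \<in> B"
    unfolding coset_rep_def by auto
qed


section \<open>Semisimple Lie algebras and Cartan subalgebras\<close>

class complex_lie_algebra = complex_vector +
  fixes bracket :: "'a \<Rightarrow> 'a \<Rightarrow> 'a"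
  assumes bracket_add_left: "bracket (x + y) z = bracket x z + bracket y z"
    and bracket_add_right: "bracket x (y + z) = bracket x y + bracket x z"
    and bracket_scaleC_left: "bracket (a *\<^sub>C x) y = a *\<^sub>C bracket x y"
    and bracket_scaleC_right: "bracket x (a *\<^sub>C y) = a *\<^sub>C bracket x y"
    and bracket_self: "bracket x x = 0"
    and jacobi: "bracket x (bracket y z) + bracket y (bracket z x) + bracket z (bracket x y) = 0"

definition bracket_span :: "'g::complex_lie_algebra set \<Rightarrow> 'g set \<Rightarrow> 'g set"
  where "bracket_span A B = complex_vector.span {bracket x y | x y. x \<in> A \<and> y \<in> B}"

definition lie_subalgebra :: "'g::complex_lie_algebra set \<Rightarrow> bool"
  where "lie_subalgebra A \<longleftrightarrow>
    complex_vector.subspace A \<and> (\<forall>x\<in>A. \<forall>y\<in>A. bracket x y \<in> A)"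

definition lie_ideal :: "'g::complex_lie_algebra set \<Rightarrow> bool"
  where "lie_ideal I \<longleftrightarrow> complex_vector.subspace I \<and> (\<forall>x. \<forall>y\<in>I. bracket x y \<in> I)"

definition solvable :: "'g::complex_lie_algebra set \<Rightarrow> bool"
  where "solvable A \<longleftrightarrow> (\<exists>n. ((\<lambda>D. bracket_span D D) ^^ n) A = {0})"

text \<open>Finite dimensional with vanishing radical; the zero Lie algebra is allowed.\<close>

definition semisimple :: "'g::complex_lie_algebra itself \<Rightarrow> bool"
  where "semisimple _ \<longleftrightarrow>
    (\<exists>B :: 'g set. finite B \<and> complex_vector.span B = UNIV) \<and>
    (\<forall>I :: 'g set. lie_ideal I \<and> solvable I \<longrightarrow> I = {0})"

definition abelian_subalgebra :: "'g::complex_lie_algebra set \<Rightarrow> bool"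
  where "abelian_subalgebra A \<longleftrightarrow>
    complex_vector.subspace A \<and> (\<forall>x\<in>A. \<forall>y\<in>A. bracket x y = 0)"

definition ad_diagonalizable :: "'g::complex_lie_algebra \<Rightarrow> bool"
  where "ad_diagonalizable x \<longleftrightarrow>
    complex_vector.span {y. \<exists>c. bracket x y = c *\<^sub>C y} = UNIV"

text \<open>
  The definition of a Cartan subalgebra of a complex semisimple Lie algebra used by Helgason and
  Hall: a maximal abelian subalgebra consisting of ad-diagonalizable elements.
\<close>

definition cartan_subalgebra :: "'g::complex_lie_algebra set \<Rightarrow> bool"
  where "cartan_subalgebra h \<longleftrightarrow>
    abelian_subalgebra h \<and>
    (\<forall>a. abelian_subalgebra a \<and> h \<subseteq> a \<longrightarrow> a = h) \<and>
    (\<forall>x\<in>h. ad_diagonalizable x)"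

definition borel_subalgebra :: "'g::complex_lie_algebra set \<Rightarrow> bool"
  where "borel_subalgebra b \<longleftrightarrow>
    lie_subalgebra b \<and> solvable b \<and>
    (\<forall>a. lie_subalgebra a \<and> solvable a \<and> b \<subseteq> a \<longrightarrow> a = b)"

text \<open>
  The complex dimension of the flag variety \<open>G / B\<close>, that is, of its tangent space
  \<open>\<gg> / \<bb>\<close> at a Borel subalgebra \<open>\<bb>\<close>. All Borel subalgebras have the same dimension; we
  take one that contains the given Cartan subalgebra.
\<close>

definition flag_dim :: "'g::complex_lie_algebra set \<Rightarrow> nat"
  where "flag_dim h =
    complex_vector.dim (UNIV :: 'g set) -
    complex_vector.dim (SOME b. borel_subalgebra b \<and> h \<subseteq> b)"


section \<open>Roots and the Weyl group\<close>

text \<open>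
  Linear forms on a subspace \<open>h\<close> are represented by functions on the ambient space that vanish
  outside \<open>h\<close> (and are in general not linear on the ambient space).
\<close>

definition dual :: "'g::complex_vector set \<Rightarrow> ('g \<Rightarrow> complex) set"
  where "dual h = {l.
    (\<forall>x\<in>h. \<forall>y\<in>h. l (x + y) = l x + l y) \<and>
    (\<forall>c. \<forall>x\<in>h. l (c *\<^sub>C x) = c * l x) \<and>
    (\<forall>x. x \<notin> h \<longrightarrow> l x = 0)}"

definition root_space :: "'g::complex_lie_algebra set \<Rightarrow> ('g \<Rightarrow> complex) \<Rightarrow> 'g set"
  where "root_space h \<alpha> = {x. \<forall>H\<in>h. bracket H x = \<alpha> H *\<^sub>C x}"

definition roots :: "'g::complex_lie_algebra set \<Rightarrow> ('g \<Rightarrow> complex) set"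
  where "roots h = {\<alpha> \<in> dual h. \<alpha> \<noteq> 0 \<and> root_space h \<alpha> \<noteq> {0}}"

definition coroot :: "'g::complex_lie_algebra set \<Rightarrow> ('g \<Rightarrow> complex) \<Rightarrow> 'g"
  where "coroot h \<alpha> =
    (THE H. H \<in> bracket_span (root_space h \<alpha>) (root_space h (- \<alpha>)) \<and> \<alpha> H = 2)"

text \<open>
  Automorphisms of \<open>dual h\<close> are extended by the identity to all functions, so that they are
  determined by their values on \<open>dual h\<close>, composition is \<open>(\<circ>)\<close>, and inversion is \<open>inv\<close>.
\<close>

definition root_reflection ::
    "'g::complex_lie_algebra set \<Rightarrow> ('g \<Rightarrow> complex) \<Rightarrow> ('g \<Rightarrow> complex) \<Rightarrow> 'g \<Rightarrow> complex"
  where "root_reflection h \<alpha> l =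
    (if l \<in> dual h then l - l (coroot h \<alpha>) *\<^sub>C \<alpha> else l)"

text \<open>Reflections being involutions, the submonoid they generate is the group they generate.\<close>

inductive_set weyl_group ::
    "'g::complex_lie_algebra set \<Rightarrow> (('g \<Rightarrow> complex) \<Rightarrow> 'g \<Rightarrow> complex) set"
  for h :: "'g set"
  where
    id: "id \<in> weyl_group h"
  | reflection: "\<alpha> \<in> roots h \<Longrightarrow> w \<in> weyl_group h \<Longrightarrow> root_reflection h \<alpha> \<circ> w \<in> weyl_group h"

definition regular :: "'g::complex_lie_algebra set \<Rightarrow> ('g \<Rightarrow> complex) set"
  where "regular h = {l \<in> dual h. \<forall>w\<in>weyl_group h. w l = l \<longrightarrow> w = id}"

definition representation ::
    "'g::complex_lie_algebra set \<Rightarrow>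
      ((('g \<Rightarrow> complex) \<Rightarrow> 'g \<Rightarrow> complex) \<Rightarrow> 'v::complex_vector \<Rightarrow> 'v) \<Rightarrow> bool"
  where "representation h \<rho> \<longleftrightarrow>
    (\<forall>w\<in>weyl_group h. clinear (\<rho> w)) \<and>
    \<rho> id = id \<and>
    (\<forall>w\<in>weyl_group h. \<forall>w'\<in>weyl_group h. \<rho> (w \<circ> w') = \<rho> w \<circ> \<rho> w')"

definition irreducible_representation ::
    "'g::complex_lie_algebra set \<Rightarrow>
      ((('g \<Rightarrow> complex) \<Rightarrow> 'g \<Rightarrow> complex) \<Rightarrow> 'v::complex_vector \<Rightarrow> 'v) \<Rightarrow> bool"
  where "irreducible_representation h \<rho> \<longleftrightarrow>
    representation h \<rho> \<and>
    (UNIV :: 'v set) \<noteq> {0} \<and>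
    (\<forall>U. complex_vector.subspace U \<and> (\<forall>w\<in>weyl_group h. \<rho> w ` U \<subseteq> U) \<longrightarrow> U = {0} \<or> U = UNIV)"


section \<open>The algebra \<open>\<O>(\<hh>\<^sup>*) = Sym \<hh>\<close> and its coinvariants\<close>

text \<open>
  An element of \<open>h\<close> is a linear form on \<open>dual h\<close> by evaluation; \<open>sym_power h d\<close> is spanned by
  the \<open>d\<close>-fold products of such forms. Functions on \<open>dual h\<close> are extended by zero.
\<close>

definition sym_power ::
    "'g::complex_vector set \<Rightarrow> nat \<Rightarrow> (('g \<Rightarrow> complex) \<Rightarrow> complex) set"
  where "sym_power h d = complex_vector.span
    {(\<lambda>l. if l \<in> dual h then prod_list (map l xs) else 0) | xs. set xs \<subseteq> h \<and> length xs = d}"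

text \<open>The grading in which \<open>h\<close> has degree two.\<close>

definition sym_degree ::
    "'g::complex_vector set \<Rightarrow> int \<Rightarrow> (('g \<Rightarrow> complex) \<Rightarrow> complex) set"
  where "sym_degree h k = (if 0 \<le> k \<and> even k then sym_power h (nat (k div 2)) else {0})"

definition sym_algebra :: "'g::complex_vector set \<Rightarrow> (('g \<Rightarrow> complex) \<Rightarrow> complex) set"
  where "sym_algebra h = complex_vector.span (\<Union>k. sym_degree h k)"

definition positive_invariants ::
    "'g::complex_lie_algebra set \<Rightarrow> (('g \<Rightarrow> complex) \<Rightarrow> complex) set"
  where "positive_invariants h =
    {f \<in> complex_vector.span (\<Union>k\<in>{0<..}. sym_degree h k). \<forall>w\<in>weyl_group h. f \<circ> w = f}"

definition coinvariant_ideal ::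
    "'g::complex_lie_algebra set \<Rightarrow> (('g \<Rightarrow> complex) \<Rightarrow> complex) set"
  where "coinvariant_ideal h =
    complex_vector.span {g * f | g f. g \<in> sym_algebra h \<and> f \<in> positive_invariants h}"

text \<open>
  The graded \<open>W\<close>-module \<open>H\<^sup>k(\<B>, \<complex>)\<close>, taken in the form of the degree \<open>k\<close> part of the
  coinvariant algebra. On \<open>Sym \<hh>\<close>, the Weyl group acts by \<open>(w \<cdot> f)(l) = f (w\<^sup>-\<^sup>1 l)\<close>; the
  action on a coset is computed on its representative.
\<close>

definition flag_cohomology ::
    "'g::complex_lie_algebra set \<Rightarrow> int \<Rightarrow> (('g \<Rightarrow> complex) \<Rightarrow> complex) set"
  where "flag_cohomology h k = quotient_space (sym_degree h k) (coinvariant_ideal h)"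

definition flag_cohomology_action ::
    "'g::complex_lie_algebra set \<Rightarrow> (('g \<Rightarrow> complex) \<Rightarrow> 'g \<Rightarrow> complex) \<Rightarrow>
      (('g \<Rightarrow> complex) \<Rightarrow> complex) \<Rightarrow> ('g \<Rightarrow> complex) \<Rightarrow> complex"
  where "flag_cohomology_action h w u = coset_rep (coinvariant_ideal h) (u \<circ> inv w)"

definition weyl_hom ::
    "'g::complex_lie_algebra set \<Rightarrow>
      ((('g \<Rightarrow> complex) \<Rightarrow> 'g \<Rightarrow> complex) \<Rightarrow> 'v::complex_vector \<Rightarrow> 'v) \<Rightarrow>
      int \<Rightarrow> ('v \<Rightarrow> ('g \<Rightarrow> complex) \<Rightarrow> complex) set"
  where "weyl_hom h \<rho> k = {\<phi>. clinear \<phi> \<and> range \<phi> \<subseteq> flag_cohomology h k \<and>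
    (\<forall>w\<in>weyl_group h. \<forall>v. \<phi> (\<rho> w v) = flag_cohomology_action h w (\<phi> v))}"

text \<open>The terms with \<open>i > flag_dim h\<close> vanish, as the cohomological degree is then negative.\<close>

definition kostka_polynomial ::
    "'g::complex_lie_algebra set \<Rightarrow>
      ((('g \<Rightarrow> complex) \<Rightarrow> 'g \<Rightarrow> complex) \<Rightarrow> 'v::complex_vector \<Rightarrow> 'v) \<Rightarrow> int poly"
  where "kostka_polynomial h \<rho> = (\<Sum>i\<le>flag_dim h.
    monom (int (complex_vector.dim (weyl_hom h \<rho> (2 * int (flag_dim h) - 2 * int i)))) i)"


section \<open>The canonical filtration\<close>

text \<open>
  Elements of \<open>(\<chi> \<otimes> \<O>(\<hh>\<^sup>*))\<^sup>W\<close> of degree at most \<open>n\<close>; the elementary tensor \<open>v \<otimes> p\<close> is the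
  map \<open>l \<mapsto> p(l) v\<close>.
\<close>

definition equivariant_maps ::
    "'g::complex_lie_algebra set \<Rightarrow>
      ((('g \<Rightarrow> complex) \<Rightarrow> 'g \<Rightarrow> complex) \<Rightarrow> 'v::complex_vector \<Rightarrow> 'v) \<Rightarrow>
      int \<Rightarrow> (('g \<Rightarrow> complex) \<Rightarrow> 'v) set"
  where "equivariant_maps h \<rho> n =
    {f \<in> complex_vector.span {(\<lambda>l. p l *\<^sub>C v) | p v k. k \<le> n \<and> p \<in> sym_degree h k}.
      \<forall>w\<in>weyl_group h. \<forall>l\<in>dual h. f (w l) = \<rho> w (f l)}"

definition canonical_filtration ::
    "'g::complex_lie_algebra set \<Rightarrow>
      ((('g \<Rightarrow> complex) \<Rightarrow> 'g \<Rightarrow> complex) \<Rightarrow> 'v::complex_vector \<Rightarrow> 'v) \<Rightarrow>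
      ('g \<Rightarrow> complex) \<Rightarrow> int \<Rightarrow> 'v set"
  where "canonical_filtration h \<rho> l m =
    {f l | f. f \<in> equivariant_maps h \<rho> (m + 2 * int (flag_dim h))}"

definition is_filtration :: "(int \<Rightarrow> 'v::complex_vector set) \<Rightarrow> bool"
  where "is_filtration F \<longleftrightarrow>
    (\<forall>m. complex_vector.subspace (F m)) \<and> mono F \<and> (\<Union>m. F m) = UNIV \<and> (\<Inter>m. F m) = {0}"

definition graded_has_hilbert_series ::
    "(int \<Rightarrow> 'v::complex_vector set) \<Rightarrow> int fls \<Rightarrow> bool"
  where "graded_has_hilbert_series F S \<longleftrightarrow>
    (\<forall>m. fls_nth S m = int (complex_vector.dim (quotient_space (F m) (F (m - 1)))))"

text \<open>The Laurent polynomial \<open>K(y\<^sup>-\<^sup>2)\<close> in the variable \<open>y\<close>.\<close>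

definition at_y_inv_squared :: "int poly \<Rightarrow> int fls"
  where "at_y_inv_squared K = poly (map_poly fls_const K) (fls_X_inv ^ 2)"

end

theory Submission
  imports Defs
begin

text \<open>
  Let \<open>I\<close> be the coinvariant ideal. The polynomials that vanish on a regular orbit \<open>W l\<close> have their
  leading forms in \<open>I\<close>: divided differences preserve vanishing on the orbit, which allows induction
  on the degree. Conversely, every homogeneous element of \<open>I\<close> agrees on the orbit with a polynomial
  of lower degree. So the functions on \<open>W l\<close>, filtered by degree, have \<open>Sym h / I\<close> as associated graded
  algebra, and the graded piece of \<open>\<chi>\<close> in degree \<open>d\<close> is the degree \<open>d\<close> part of
  \<open>(\<chi> \<otimes> Sym h / I)\<^sup>W\<close>. An invariant Hermitian form on \<open>\<chi>\<close> and complex conjugation on \<open>h\<close> with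
  respect to the real span of the coroots identify this, antilinearly, with \<open>Hom\<^sub>W(\<chi>, Sym h / I)\<close>.

  No piece is lost by the truncation of the Kostka polynomial, since \<open>Sym h / I\<close> vanishes above the
  number of reflections: its top degree is represented by an antisymmetric polynomial, which is an
  invariant times the product of half of the coroots. That number is at most \<open>dim \<B>\<close>, as a solvable
  subalgebra contains no \<open>sl\<^sub>2\<close>.

  Root strings need no Killing form: the root spaces with \<open>[\<gg>\<^sub>\<alpha>, \<gg>\<^sub>-\<^sub>\<alpha>] = 0\<close> span an ideal, nilpotent
  by Engel's theorem for weakly closed sets, hence zero.
\<close>


section \<open>Linear algebra\<close>

text \<open>The filtration consists of values of elements of \<open>\<chi> \<otimes> Sym h\<close>,
  and invariants there are homomorphisms out of the dual of \<chi>, whereas the Kostka polynomial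
  counts homomorphisms out of \<chi>. The invariant form turns the dual into the complex conjugate
  of \<chi>, and a conjugation of \<open>h\<close> that commutes with the Weyl group turns
  \<open>Sym h\<close> into its own conjugate; the two effects cancel. The price is that dimensions
  are compared through an antilinear map, and that polynomials are evaluated at the conjugate of
  \<open>l\<close>, which is regular together with \<open>l\<close>. The indices match as follows:
  with N the dimension of the flag variety and d the polynomial degree, the filtration index is
  \<open>m = 2 d - 2 N\<close> and the exponent in the Kostka polynomial is
  \<open>i = N - d\<close>, so \<open>m = - 2 i\<close>. Linear forms and Weyl group elements are
  encoded as total functions, and polynomials as functions of linear forms instead of formal
  expressions. Hence identities are checked pointwise, and cancellation of a linear factor is
  derived by restricting to lines.\<close>

abbreviation cspan :: "'a::complex_vector set \<Rightarrow> 'a set"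
  where "cspan \<equiv> complex_vector.span"

abbreviation csubspace :: "'a::complex_vector set \<Rightarrow> bool"
  where "csubspace \<equiv> complex_vector.subspace"

abbreviation cdim :: "'a::complex_vector set \<Rightarrow> nat"
  where "cdim \<equiv> complex_vector.dim"

lemma clinearI:
  assumes "\<And>x y. f (x + y) = f x + f y" and "\<And>c x. f (c *\<^sub>C x) = c *\<^sub>C f x"
  shows "clinear f"
  unfolding Vector_Spaces.linear_iff using assms by (intro conjI allI complex_vector.vector_space_axioms)

lemma scaleC_fun_apply [simp]: "(c *\<^sub>C f) x = c *\<^sub>C f x"
  by (simp add: scaleC_fun_def)

lemma scaleC_complex [simp]: "c *\<^sub>C (z :: complex) = c * z"
  by (simp add: scaleC_complex_def)

lemma sum_fun_apply: "sum f A x = (\<Sum>a\<in>A. f a x)"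
  by (induction A rule: infinite_finite_induct) auto

lemma span_UN_sum:
  assumes "x \<in> cspan (\<Union>i\<in>I. V i)" and "\<And>i. i \<in> I \<Longrightarrow> csubspace (V i)"
  obtains A u where "finite A" "A \<subseteq> I" "\<And>i. i \<in> A \<Longrightarrow> u i \<in> V i" "x = sum u A"
proof -
  have "\<exists>A u. finite A \<and> A \<subseteq> I \<and> (\<forall>i\<in>A. u i \<in> V i) \<and> x = sum u A"
    using assms(1)
  proof (induction rule: complex_vector.span_induct_alt)
    case base
    show ?case by (intro exI[of _ "{}"]) auto
  next
    case (step c x y)
    then obtain j A u where j: "j \<in> I" "x \<in> V j" and
      A: "finite A" "A \<subseteq> I" "\<forall>i\<in>A. u i \<in> V i" "y = sum u A" by blast
    show ?case
    proof (cases "j \<in> A")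
      case True
      have "c *\<^sub>C x + y = sum (u(j := c *\<^sub>C x + u j)) A"
        using True A by (simp add: sum.remove[of A j] add.assoc)
      moreover have "c *\<^sub>C x + u j \<in> V j"
        using True A j assms(2) complex_vector.subspace_add complex_vector.subspace_scale by metis
      ultimately show ?thesis using A
        by (intro exI[of _ A] exI[of _ "u(j := c *\<^sub>C x + u j)"]) auto
    next
      case False
      have "c *\<^sub>C x + y = sum (u(j := c *\<^sub>C x)) (insert j A)"
      proof -
        have "sum (u(j := c *\<^sub>C x)) A = sum u A"
          using False by (intro sum.cong) auto
        then show ?thesis using False A by simp
      qed
      moreover have "c *\<^sub>C x \<in> V j"
        using j assms(2) complex_vector.subspace_scale by metis
      ultimately show ?thesis using A j
        by (intro exI[of _ "insert j A"] exI[of _ "u(j := c *\<^sub>C x)"]) auto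
    qed
  qed
  then show thesis using that by blast
qed

lemma separated_components:
  fixes u :: "'i \<Rightarrow> 'a::complex_vector"
  assumes "finite A" and V: "csubspace V"
    and "\<And>a b. a \<in> A \<Longrightarrow> b \<in> A \<Longrightarrow> a \<noteq> b \<Longrightarrow>
      \<exists>T e. clinear T \<and> T ` V \<subseteq> V \<and> (\<forall>c\<in>A. T (u c) = e c *\<^sub>C u c) \<and> e a \<noteq> (e b :: complex)"
    and "sum u A \<in> V" and "a \<in> A"
  shows "u a \<in> V"
  using assms(1,3-)
proof (induction A arbitrary: u a rule: finite_psubset_induct)
  case (psubset A)
  show ?case
  proof (cases "A = {a}")
    case True
    then show ?thesis using psubset.prems by simp
  next
    case False
    then obtain b where b: "b \<in> A" "b \<noteq> a" using psubset.prems by blast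
    then obtain T e where T: "clinear T" "T ` V \<subseteq> V" "\<forall>c\<in>A. T (u c) = e c *\<^sub>C u c" "e a \<noteq> e b"
      using psubset.prems(1)[of a b] psubset.prems(3) by blast
    define u' where "u' c = (e c - e b) *\<^sub>C u c" for c
    have "u' a \<in> V"
    proof (rule psubset.IH[of "A - {b}"])
      show "A - {b} \<subset> A" using b by blast
      show "a \<in> A - {b}" using b psubset.prems by simp
      have "sum u' (A - {b}) = sum u' A"
        using b psubset.hyps by (simp add: sum.remove[of A b] u'_def)
      also have "\<dots> = T (sum u A) - e b *\<^sub>C sum u A"
        using T(3) by (simp add: u'_def complex_vector.linear_sum[OF T(1)] sum_subtractf
            complex_vector.scale_sum_right complex_vector.scale_left_diff_distrib)
      also have "\<dots> \<in> V"
        using psubset.prems(2) T(2) V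
        by (intro complex_vector.subspace_diff complex_vector.subspace_scale) auto
      finally show "sum u' (A - {b}) \<in> V" .
      fix p q assume "p \<in> A - {b}" "q \<in> A - {b}" "p \<noteq> q"
      then obtain T' e' where T': "clinear T'" "T' ` V \<subseteq> V" "\<forall>c\<in>A. T' (u c) = e' c *\<^sub>C u c"
        "e' p \<noteq> e' q" using psubset.prems(1)[of p q] by blast
      have "\<forall>c\<in>A - {b}. T' (u' c) = e' c *\<^sub>C u' c"
        using T'(3) by (simp add: u'_def complex_vector.linear_scale[OF T'(1)] mult.commute)
      then show "\<exists>T e. clinear T \<and> T ` V \<subseteq> V \<and> (\<forall>c\<in>A - {b}. T (u' c) = e c *\<^sub>C u' c) \<and> e p \<noteq> e q"
        using T' by blast
    qed
    then have "inverse (e a - e b) *\<^sub>C u' a \<in> V"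
      by (intro complex_vector.subspace_scale V)
    then show ?thesis using T(4) by (simp add: u'_def)
  qed
qed

lemma finite_basis:
  assumes "h \<subseteq> cspan B" and "finite B"
  obtains F where "finite F" "F \<subseteq> h" "h \<subseteq> cspan F" "complex_vector.independent F"
  using complex_vector.maximal_independent_subset[of h] complex_vector.independent_span_bound[of B] assms
  by (metis subset_trans)

lemma finite_UNIV_basis:
  fixes B :: "'a::complex_vector set"
  assumes "finite B" "cspan B = UNIV"
  obtains C :: "'a set" where "finite C" "cspan C = UNIV" "complex_vector.independent C"
proof -
  have "UNIV \<subseteq> cspan B" using assms by simp
  then obtain C :: "'a set" where C: "finite C" "UNIV \<subseteq> cspan C" "complex_vector.independent C"
    using assms(1) by (rule finite_basis)
  show thesis using C(1) _ C(3) by (rule that) (use C(2) in blast)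
qed

lemma subspace_dim_less:
  fixes V :: "'a::complex_vector set"
  assumes "finite B" "cspan B = (UNIV :: 'a set)" "csubspace V" "csubspace W" "V \<subset> W"
  shows "cdim V < cdim W"
proof -
  obtain C :: "'a set" where C: "finite C" "cspan C = UNIV" "complex_vector.independent C"
    using assms(1,2) by (rule finite_UNIV_basis)
  interpret finite_dimensional_vector_space "scaleC :: complex \<Rightarrow> 'a \<Rightarrow> 'a" C
    by unfold_locales (use C in auto)
  show ?thesis
  proof (rule dim_psubset)
    have "cspan V = V" "cspan W = W" using assms(3,4) by (simp_all only: complex_vector.span_eq_iff)
    then show "cspan V \<subset> cspan W" using assms(5) by (simp only:)
  qed
qed


section \<open>Weights\<close>

lemma bracket_linear: "clinear (bracket x)"
  by (rule clinearI) (simp_all add: bracket_add_right bracket_scaleC_right)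

lemma bracket_pow_linear: "clinear (bracket x ^^ n)"
proof (induction n)
  case (Suc n)
  then show ?case
    by (intro clinearI) (simp_all add: complex_vector.linear_add complex_vector.linear_scale
        bracket_add_right bracket_scaleC_right)
qed (simp add: clinearI)

lemma bracket_linear_left: "clinear (\<lambda>x. bracket x y)"
  by (rule clinearI) (simp_all add: bracket_add_left bracket_scaleC_left)

lemmas bracket_0_right [simp] = complex_vector.linear_0[OF bracket_linear]
lemmas bracket_0_left [simp] = complex_vector.linear_0[OF bracket_linear_left]
lemmas bracket_minus_right = complex_vector.linear_neg[OF bracket_linear]
lemmas bracket_diff_right = complex_vector.linear_diff[OF bracket_linear]
lemmas bracket_sum_right = complex_vector.linear_sum[OF bracket_linear]

lemma bracket_anticommute: "bracket x y = - bracket y (x :: 'g::complex_lie_algebra)"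
proof -
  have "bracket x y + bracket y x = 0"
    using bracket_self[of "x + y"] bracket_self[of x] bracket_self[of y]
    unfolding bracket_add_left bracket_add_right by (simp add: add.commute)
  then show ?thesis by (rule add.inverse_unique[symmetric, OF trans[OF add.commute]])
qed

lemma bracket_derivation:
  "bracket x (bracket y z) = bracket (bracket x y) z + bracket y (bracket x (z :: 'g::complex_lie_algebra))"
proof -
  have "bracket y (bracket z x) = - bracket y (bracket x z)"
    using bracket_anticommute[of z x] by (simp add: bracket_minus_right)
  moreover have "bracket z (bracket x y) = - bracket (bracket x y) z"
    by (rule bracket_anticommute)
  ultimately show ?thesis using jacobi[of x y z] by (simp add: algebra_simps)
qed

lemma subspace_root_space: "csubspace (root_space h \<alpha>)"
  by (rule complex_vector.subspaceI)
    (auto simp: root_space_def bracket_add_right bracket_scaleC_right scaleC_add_right mult.commute)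

lemma bracket_root_space:
  assumes "x \<in> root_space h \<alpha>" and "y \<in> root_space h \<beta>"
  shows "bracket x y \<in> root_space h (\<alpha> + \<beta>)"
  using assms bracket_derivation[of _ x y]
  by (simp add: root_space_def bracket_scaleC_right bracket_scaleC_left scaleC_add_left)

lemma bracket_pow_root_space:
  assumes "x \<in> root_space h \<alpha>" and "z \<in> root_space h \<beta>"
  shows "(bracket x ^^ n) z \<in> root_space h (\<beta> + of_nat n *\<^sub>C \<alpha>)"
proof (induction n)
  case 0
  then show ?case using assms by simp
next
  case (Suc n)
  have "\<alpha> + (\<beta> + of_nat n *\<^sub>C \<alpha>) = \<beta> + of_nat (Suc n) *\<^sub>C \<alpha>"
    by (simp add: scaleC_add_left scaleC_one add.commute add.left_commute)
  then show ?case using bracket_root_space[OF assms(1) Suc] by (metis funpow.simps(2) o_apply)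
qed

lemma subspace_dual: "csubspace (dual h)"
  by (rule complex_vector.subspaceI) (auto simp: dual_def algebra_simps)

lemma subspace_dual_simps:
  "l \<in> dual h \<Longrightarrow> m \<in> dual h \<Longrightarrow> l + m \<in> dual h"
  "l \<in> dual h \<Longrightarrow> m \<in> dual h \<Longrightarrow> l - m \<in> dual h"
  "l \<in> dual h \<Longrightarrow> c *\<^sub>C l \<in> dual h" "l \<in> dual h \<Longrightarrow> - l \<in> dual h"
  using complex_vector.subspace_add[OF subspace_dual] complex_vector.subspace_diff[OF subspace_dual]
    complex_vector.subspace_scale[OF subspace_dual] complex_vector.subspace_neg[OF subspace_dual] by blast+

lemma dual_eqI:
  assumes "\<alpha> \<in> dual h" and "\<beta> \<in> dual h" and "\<And>H. H \<in> h \<Longrightarrow> \<alpha> H = \<beta> H"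
  shows "\<alpha> = \<beta>"
proof (rule ext)
  fix x show "\<alpha> x = \<beta> x" using assms by (cases "x \<in> h") (auto simp: dual_def)
qed

lemma dual_sum:
  assumes "l \<in> dual h" "csubspace h" "\<And>i. i \<in> A \<Longrightarrow> x i \<in> h"
  shows "l (sum x A) = (\<Sum>i\<in>A. l (x i))"
  using assms(3)
proof (induction A rule: infinite_finite_induct)
  case (insert a A)
  then have "sum x A \<in> h" using assms(2) by (intro complex_vector.subspace_sum) auto
  then show ?case using insert assms(1) by (simp add: dual_def)
next
  case empty
  have "l (0 *\<^sub>C 0) = 0 * l 0"
    using assms complex_vector.subspace_0 unfolding dual_def by blast
  then show ?case by simp
next
  case (infinite A)
  have "l (0 *\<^sub>C 0) = 0 * l 0"
    using assms complex_vector.subspace_0 unfolding dual_def by blast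
  then show ?case using infinite by simp
qed

lemma bracket_span_trivial:
  assumes "\<And>x y. x \<in> A \<Longrightarrow> y \<in> B \<Longrightarrow> bracket x y = 0"
  shows "bracket_span A B = {0}"
proof -
  have "{bracket x y |x y. x \<in> A \<and> y \<in> B} \<subseteq> {0}" using assms by auto
  then show ?thesis
    unfolding bracket_span_def
    using complex_vector.span_minimal[OF _ complex_vector.subspace_single_0] complex_vector.span_zero
    by blast
qed

section \<open>Weight space decomposition under the Cartan subalgebra\<close>

locale cartan_pair =
  fixes h :: "'g::complex_lie_algebra set"
  assumes semisimple: "semisimple TYPE('g)" and cartan: "cartan_subalgebra h"
begin

lemma subspace_h: "csubspace h"
  using cartan by (auto simp: cartan_subalgebra_def abelian_subalgebra_def)

lemma subspace_h_simps:
  "x \<in> h \<Longrightarrow> y \<in> h \<Longrightarrow> x + y \<in> h" "x \<in> h \<Longrightarrow> y \<in> h \<Longrightarrow> x - y \<in> h" "x \<in> h \<Longrightarrow> c *\<^sub>C x \<in> h"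
  "x \<in> h \<Longrightarrow> - x \<in> h" "0 \<in> h"
  using complex_vector.subspace_add[OF subspace_h] complex_vector.subspace_diff[OF subspace_h]
    complex_vector.subspace_scale[OF subspace_h] complex_vector.subspace_neg[OF subspace_h]
    complex_vector.subspace_0[OF subspace_h] by blast+

lemma abelian_h: "x \<in> h \<Longrightarrow> y \<in> h \<Longrightarrow> bracket x y = 0"
  using cartan by (auto simp: cartan_subalgebra_def abelian_subalgebra_def)

lemma dual_linear:
  assumes "l \<in> dual h"
  shows "x \<in> h \<Longrightarrow> y \<in> h \<Longrightarrow> l (x + y) = l x + l y" "x \<in> h \<Longrightarrow> l (c *\<^sub>C x) = c * l x"
    "l 0 = 0" "x \<in> h \<Longrightarrow> y \<in> h \<Longrightarrow> l (x - y) = l x - l y" "x \<in> h \<Longrightarrow> l (- x) = - l x"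
proof -
  show 1: "x \<in> h \<Longrightarrow> y \<in> h \<Longrightarrow> l (x + y) = l x + l y" "x \<in> h \<Longrightarrow> l (c *\<^sub>C x) = c * l x" for x y c
    using assms by (auto simp: dual_def)
  show "l 0 = 0" using 1(2)[of 0 0] subspace_h_simps(5) by simp
  show 2: "x \<in> h \<Longrightarrow> l (- x) = - l x" for x
    using 1(2)[of x "-1"] by simp
  show "x \<in> h \<Longrightarrow> y \<in> h \<Longrightarrow> l (x - y) = l x - l y" for x y
    using 1(1)[of x "- y"] 2[of y] subspace_h_simps(4) by simp
qed

lemma finite_dim: obtains B :: "'g set" where "finite B" "cspan B = UNIV"
  using semisimple unfolding semisimple_def by blast

lemma no_solvable_ideal: "lie_ideal (I :: 'g set) \<Longrightarrow> solvable I \<Longrightarrow> I = {0}"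
  using semisimple unfolding semisimple_def by blast

text \<open>The span of \<open>x\<close> and \<open>h\<close> is again abelian, so the maximality of
  \<open>h\<close> absorbs \<open>x\<close>.\<close>

lemma self_centralizing:
  assumes "\<And>H. H \<in> h \<Longrightarrow> bracket H x = 0"
  shows "x \<in> h"
proof -
  have "abelian_subalgebra (cspan (insert x h))"
    unfolding abelian_subalgebra_def
  proof (intro conjI ballI)
    fix a b assume a: "a \<in> cspan (insert x h)" and b: "b \<in> cspan (insert x h)"
    have *: "bracket a b = 0" if "a \<in> insert x h" for a
      using b
    proof (induction rule: complex_vector.span_induct)
      case base
      then show ?case by (auto intro!: complex_vector.subspaceI simp: bracket_add_right bracket_scaleC_right)
    next
      case (step b)
      then show ?case using that assms abelian_h bracket_self bracket_anticommute[of x b] by auto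
    qed
    show "bracket a b = 0"
      using a
    proof (induction rule: complex_vector.span_induct)
      case base
      then show ?case by (auto intro!: complex_vector.subspaceI simp: bracket_add_left bracket_scaleC_left)
    qed (rule *)
  qed auto
  moreover have "h \<subseteq> cspan (insert x h)"
    using complex_vector.span_superset by blast
  ultimately have "cspan (insert x h) = h"
    using cartan unfolding cartan_subalgebra_def by blast
  then show ?thesis using complex_vector.span_base[of x "insert x h"] by simp
qed

lemma root_space_0: "root_space h 0 = h"
  using self_centralizing abelian_h by (auto simp: root_space_def)

text \<open>Induction on the commuting family: the joint eigenspace \<open>E\<close> of
  \<open>F\<close> that contains \<open>y\<close> is stable under \<open>bracket K\<close>, so it
  contains the components of \<open>y\<close> in the eigenspaces of \<open>K\<close>, and these are
  eigenvectors of the enlarged family.\<close>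

lemma simultaneous_eigenvectors:
  assumes "finite F" "F \<subseteq> h"
  shows "cspan {y. \<forall>H\<in>F. \<exists>c. bracket H y = c *\<^sub>C y} = UNIV"
  using assms
proof (induction F)
  case empty
  then show ?case by simp
next
  case (insert K F)
  let ?Y = "{y. \<forall>H\<in>F. \<exists>c. bracket H y = c *\<^sub>C y}"
  let ?Z = "{y. \<forall>H\<in>insert K F. \<exists>c. bracket H y = c *\<^sub>C y}"
  have "?Y \<subseteq> cspan ?Z"
  proof
    fix y assume "y \<in> ?Y"
    then obtain c where c: "\<And>H. H \<in> F \<Longrightarrow> bracket H y = c H *\<^sub>C y" by (auto dest!: bchoice)
    define E where "E = {y. \<forall>H\<in>F. bracket H y = c H *\<^sub>C y}"
    have E: "csubspace E"
      by (rule complex_vector.subspaceI)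
        (auto simp: E_def bracket_add_right bracket_scaleC_right scaleC_add_right mult.commute)
    have KE: "bracket K ` E \<subseteq> E"
    proof
      fix z assume "z \<in> bracket K ` E"
      then obtain e where e: "e \<in> E" "z = bracket K e" by blast
      have "bracket H z = c H *\<^sub>C z" if "H \<in> F" for H
      proof -
        have "bracket H K = 0" using that insert.prems abelian_h by auto
        then show ?thesis using e that bracket_derivation[of H K e]
          by (simp add: E_def bracket_scaleC_right)
      qed
      then show "z \<in> E" by (simp add: E_def)
    qed
    let ?V = "\<lambda>e. {z. bracket K z = e *\<^sub>C z}"
    have "{y. \<exists>c. bracket K y = c *\<^sub>C y} = (\<Union>e\<in>UNIV. ?V e)" by auto
    then have "y \<in> cspan (\<Union>e\<in>UNIV. ?V e)"
      using cartan insert.prems unfolding cartan_subalgebra_def ad_diagonalizable_def by auto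
    moreover have "csubspace (?V e)" for e
      by (rule complex_vector.subspaceI)
        (auto simp: bracket_add_right bracket_scaleC_right scaleC_add_right mult.commute)
    ultimately obtain A u where A: "finite A" "\<And>e. e \<in> A \<Longrightarrow> u e \<in> ?V e" "y = sum u A"
      by (rule span_UN_sum) auto
    have "u e \<in> E" if "e \<in> A" for e
    proof (rule separated_components[OF A(1) E _ _ that])
      show "sum u A \<in> E" using A(3) c by (simp add: E_def)
      fix a b :: complex assume "a \<noteq> b"
      then show "\<exists>T e. clinear T \<and> T ` E \<subseteq> E \<and> (\<forall>c\<in>A. T (u c) = e c *\<^sub>C u c) \<and> e a \<noteq> e b"
        using KE A(2) bracket_linear[of K] by (intro exI[of _ "bracket K"] exI[of _ "\<lambda>e. e"]) auto
    qed
    then have "u e \<in> ?Z" if "e \<in> A" for e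
      using that A(2) by (fastforce simp: E_def)
    then show "y \<in> cspan ?Z"
      unfolding A(3) by (intro complex_vector.span_sum complex_vector.span_base) auto
  qed
  then have "cspan ?Y \<subseteq> cspan ?Z"
    by (simp add: complex_vector.span_minimal)
  then show ?case using insert by blast
qed

lemma span_root_spaces: "cspan (\<Union>\<alpha>\<in>dual h. root_space h \<alpha>) = UNIV"
proof -
  obtain B :: "'g set" where B: "finite B" "cspan B = UNIV" by (rule finite_dim)
  have "h \<subseteq> cspan B" using B by simp
  then obtain F where F: "finite F" "F \<subseteq> h" "h \<subseteq> cspan F" using B(1) by (rule finite_basis)
  let ?Y = "{y. \<forall>H\<in>F. \<exists>c. bracket H y = c *\<^sub>C y}"
  have "?Y \<subseteq> cspan (\<Union>\<alpha>\<in>dual h. root_space h \<alpha>)"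
  proof
    fix y assume y: "y \<in> ?Y"
    show "y \<in> cspan (\<Union>\<alpha>\<in>dual h. root_space h \<alpha>)"
    proof (cases "y = 0")
      case True
      then show ?thesis by (simp add: complex_vector.span_zero)
    next
      case False
      have "\<exists>c. bracket H y = c *\<^sub>C y" if "H \<in> h" for H
      proof -
        have "H \<in> cspan F" using that F by blast
        then show ?thesis
        proof (induction rule: complex_vector.span_induct)
          case base
          show ?case
          proof (rule complex_vector.subspaceI)
            show "0 \<in> {a. \<exists>c. bracket a y = c *\<^sub>C y}" by (auto intro: exI[of _ 0])
          qed (auto simp: bracket_add_left bracket_scaleC_left scaleC_add_left[symmetric])
        qed (use y in auto)
      qed
      then obtain c where c: "\<And>H. H \<in> h \<Longrightarrow> bracket H y = c H *\<^sub>C y" by metis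
      \<comment> \<open>Extension by zero is the encoding of \<open>dual h\<close>; linearity on
        \<open>h\<close> follows by cancelling the nonzero vector \<open>y\<close>.\<close>
      define \<alpha> where "\<alpha> H = (if H \<in> h then c H else 0)" for H
      have "c (H + K) = c H + c K" if "H \<in> h" "K \<in> h" for H K
      proof -
        have "c (H + K) *\<^sub>C y = (c H + c K) *\<^sub>C y"
          using c that subspace_h_simps(1)
          by (metis bracket_add_left scaleC_add_left)
        then show ?thesis using False complex_vector.scale_right_imp_eq by blast
      qed
      moreover have "c (a *\<^sub>C H) = a * c H" if "H \<in> h" for H a
      proof -
        have "c (a *\<^sub>C H) *\<^sub>C y = (a * c H) *\<^sub>C y"
          using c that subspace_h_simps(3)
          by (metis bracket_scaleC_left scaleC_scaleC)
        then show ?thesis using False complex_vector.scale_right_imp_eq by blast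
      qed
      ultimately have "\<alpha> \<in> dual h"
        using subspace_h by (auto simp: dual_def \<alpha>_def complex_vector.subspace_add complex_vector.subspace_scale)
      moreover have "y \<in> root_space h \<alpha>" using c by (simp add: root_space_def \<alpha>_def)
      ultimately show ?thesis by (blast intro: complex_vector.span_base)
    qed
  qed
  then have "cspan ?Y \<subseteq> cspan (\<Union>\<alpha>\<in>dual h. root_space h \<alpha>)"
    by (simp add: complex_vector.span_minimal)
  then show ?thesis using simultaneous_eigenvectors[OF F(1,2)] by blast
qed

lemma weight_decomposition:
  obtains A u where "finite A" "A \<subseteq> dual h" "\<And>\<alpha>. \<alpha> \<in> A \<Longrightarrow> u \<alpha> \<in> root_space h \<alpha>" "y = sum u A"
proof -
  have "y \<in> cspan (\<Union>\<alpha>\<in>dual h. root_space h \<alpha>)" using span_root_spaces by simp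
  then show thesis using subspace_root_space by (rule span_UN_sum) (rule that)
qed

lemma weight_components:
  assumes "finite A" "A \<subseteq> dual h" "\<And>\<alpha>. \<alpha> \<in> A \<Longrightarrow> u \<alpha> \<in> root_space h \<alpha>"
    and "csubspace V" "\<And>H. H \<in> h \<Longrightarrow> bracket H ` V \<subseteq> V" "sum u A \<in> V" "\<alpha> \<in> A"
  shows "u \<alpha> \<in> V"
proof (rule separated_components[OF assms(1,4) _ assms(6,7)])
  fix \<alpha> \<beta> assume "\<alpha> \<in> A" "\<beta> \<in> A" "\<alpha> \<noteq> \<beta>"
  then obtain H where "H \<in> h" "\<alpha> H \<noteq> \<beta> H" using dual_eqI assms(2) by blast
  then show "\<exists>T e. clinear T \<and> T ` V \<subseteq> V \<and> (\<forall>c\<in>A. T (u c) = e c *\<^sub>C u c) \<and> e \<alpha> \<noteq> e \<beta>"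
    using assms(3,5) bracket_linear[of H]
    by (intro exI[of _ "bracket H"] exI[of _ "\<lambda>\<gamma>. \<gamma> H"]) (auto simp: root_space_def)
qed

text \<open>Nonzero vectors of distinct weights are linearly independent, so there are at most as
  many weights as elements in a finite spanning set.\<close>

lemma finite_weights: "finite {\<alpha> \<in> dual h. root_space h \<alpha> \<noteq> {0}}" (is "finite ?P")
proof (rule ccontr)
  assume inf: "infinite ?P"
  obtain B :: "'g set" where B: "finite B" "cspan B = UNIV" by (rule finite_dim)
  obtain A where A: "A \<subseteq> ?P" "finite A" "card A = Suc (card B)"
    using infinite_arbitrarily_large[OF inf] by blast
  have "\<forall>\<alpha>\<in>A. \<exists>x. x \<in> root_space h \<alpha> \<and> x \<noteq> 0"
    using A(1) complex_vector.subspace_0[OF subspace_root_space] by blast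
  then obtain x where x: "\<And>\<alpha>. \<alpha> \<in> A \<Longrightarrow> x \<alpha> \<in> root_space h \<alpha> \<and> x \<alpha> \<noteq> 0" by metis
  have zero: "f \<alpha> = 0" if "(\<Sum>\<alpha>\<in>A. f \<alpha> *\<^sub>C x \<alpha>) = 0" "\<alpha> \<in> A" for f \<alpha>
  proof -
    have "f \<alpha> *\<^sub>C x \<alpha> \<in> {0}"
      by (rule weight_components[of A "\<lambda>\<alpha>. f \<alpha> *\<^sub>C x \<alpha>"])
        (use that A x in \<open>auto intro: complex_vector.subspace_scale[OF subspace_root_space]\<close>)
    then show ?thesis using x that by simp
  qed
  have inj: "inj_on x A"
  proof (rule inj_onI, rule ccontr)
    fix \<alpha> \<beta> assume *: "\<alpha> \<in> A" "\<beta> \<in> A" "x \<alpha> = x \<beta>" "\<alpha> \<noteq> \<beta>"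
    let ?f = "\<lambda>\<gamma>. if \<gamma> = \<alpha> then 1 else if \<gamma> = \<beta> then - 1 else (0 :: complex)"
    have "(\<Sum>\<gamma>\<in>A. ?f \<gamma> *\<^sub>C x \<gamma>) = (\<Sum>\<gamma>\<in>{\<alpha>, \<beta>}. ?f \<gamma> *\<^sub>C x \<gamma>)"
      using * A(2) by (intro sum.mono_neutral_right) auto
    also have "\<dots> = 0" using * by (simp add: scaleC_one)
    finally show False using zero[of ?f \<alpha>] * by simp
  qed
  have "complex_vector.independent (x ` A)"
  proof (rule complex_vector.independent_if_scalars_zero)
    fix f v assume "(\<Sum>v\<in>x ` A. f v *\<^sub>C v) = 0" "v \<in> x ` A"
    then show "f v = 0" using zero[of "\<lambda>\<alpha>. f (x \<alpha>)"] inj by (auto simp: sum.reindex)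
  qed (use A in simp)
  then have "card (x ` A) \<le> card B"
    using complex_vector.independent_span_bound[of B "x ` A"] B by auto
  then show False using A(3) card_image[OF inj] by simp
qed

text \<open>An element of \<open>h\<close> killed by all roots commutes with every weight vector, so
  it is central and spans an abelian ideal, which is zero by semisimplicity.\<close>

lemma roots_separate:
  assumes "x \<in> h" "\<And>\<alpha>. \<alpha> \<in> roots h \<Longrightarrow> \<alpha> x = 0"
  shows "x = 0"
proof -
  have central: "bracket x y = 0" for y
  proof -
    obtain A u where A: "finite A" "A \<subseteq> dual h" "\<And>\<alpha>. \<alpha> \<in> A \<Longrightarrow> u \<alpha> \<in> root_space h \<alpha>" "y = sum u A"
      by (rule weight_decomposition[where y = y]) blast
    have "bracket x (u \<alpha>) = 0" if "\<alpha> \<in> A" for \<alpha>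
    proof (cases "u \<alpha> = 0 \<or> \<alpha> = 0")
      case True
      then show ?thesis using A(3)[OF that] assms(1) by (auto simp: root_space_def)
    next
      case False
      then have "\<alpha> \<in> roots h" using A that by (auto simp: roots_def)
      then show ?thesis using A(3)[OF that] assms by (simp add: root_space_def)
    qed
    then show ?thesis by (simp add: A(4) bracket_sum_right)
  qed
  have c2: "bracket a b = 0" if "b \<in> cspan {x}" for a b
    using that
  proof (induction rule: complex_vector.span_induct)
    case base
    then show ?case by (auto intro!: complex_vector.subspaceI simp: bracket_add_right bracket_scaleC_right)
  next
    case (step b)
    then show ?case using bracket_anticommute[of a x] central by simp
  qed
  have "lie_ideal (cspan {x})"
    by (simp add: lie_ideal_def c2 complex_vector.span_zero)
  moreover have "bracket_span (cspan {x}) (cspan {x}) = {0}"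
    by (rule bracket_span_trivial) (rule c2)
  then have "solvable (cspan {x})" unfolding solvable_def by (intro exI[of _ 1]) simp
  ultimately have "cspan {x} = {0}" by (rule no_solvable_ideal)
  moreover have "x \<in> cspan {x}" by (rule complex_vector.span_base) blast
  ultimately show ?thesis by blast
qed

end


section \<open>Root strings\<close>

context cartan_pair
begin

text \<open>There are only finitely many weights. Termination of root strings, nilpotency of root
  vectors and the comparison of coroots all come from this.\<close>

lemma weight_progression:
  assumes "\<alpha> \<in> dual h" "\<beta> \<in> dual h" "\<And>n :: nat. root_space h (\<beta> + of_nat n *\<^sub>C \<alpha>) \<noteq> {0}"
  shows "\<alpha> = 0"
proof (rule ccontr)
  assume "\<alpha> \<noteq> 0"
  then have inj: "inj (\<lambda>n :: nat. \<beta> + of_nat n *\<^sub>C \<alpha>)"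
    by (auto intro!: injI)
  have "range (\<lambda>n :: nat. \<beta> + of_nat n *\<^sub>C \<alpha>) \<subseteq> {\<alpha> \<in> dual h. root_space h \<alpha> \<noteq> {0}}"
    using assms by (auto intro!: subspace_dual_simps(1) subspace_dual_simps(3))
  then have "finite (range (\<lambda>n :: nat. \<beta> + of_nat n *\<^sub>C \<alpha>))"
    by (rule finite_subset[OF _ finite_weights])
  then show False using finite_imageD[OF _ inj] by simp
qed

lemma ad_nilpotent_root_space:
  assumes "y \<in> root_space h \<alpha>" "\<alpha> \<in> dual h" "\<alpha> \<noteq> 0" "v \<in> root_space h \<mu>" "\<mu> \<in> dual h"
  shows "\<exists>n. (bracket y ^^ n) v = 0"
proof (rule ccontr)
  assume *: "\<nexists>n. (bracket y ^^ n) v = 0"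
  have "root_space h (\<mu> + of_nat n *\<^sub>C \<alpha>) \<noteq> {0}" for n :: nat
    using bracket_pow_root_space[OF assms(1,4), of n] * by auto
  then show False using weight_progression assms by blast
qed

text \<open>Nilpotency on each weight space gives an exponent for every single vector; the maximum
  over a finite spanning set is the uniform exponent that the Engel argument requires.\<close>

lemma ad_nilpotent:
  assumes "y \<in> root_space h \<alpha>" "\<alpha> \<in> dual h" "\<alpha> \<noteq> 0"
  shows "\<exists>n. \<forall>z. (bracket y ^^ n) z = 0"
proof -
  note lin = complex_vector.linear_0[OF bracket_pow_linear] complex_vector.linear_add[OF bracket_pow_linear]
    complex_vector.linear_scale[OF bracket_pow_linear]
  have le: "(bracket y ^^ m) z = 0" if "(bracket y ^^ n) z = 0" "n \<le> m" for m n z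
  proof -
    have "(bracket y ^^ m) z = (bracket y ^^ (m - n)) ((bracket y ^^ n) z)"
      using that(2) by (metis funpow_add le_add_diff_inverse2 o_apply)
    then show ?thesis using that lin by simp
  qed
  have local: "\<exists>n. (bracket y ^^ n) z = 0" for z
  proof -
    have "z \<in> cspan (\<Union>\<alpha>\<in>dual h. root_space h \<alpha>)" using span_root_spaces by simp
    then show ?thesis
    proof (induction rule: complex_vector.span_induct_alt)
      case base
      then show ?case by (auto intro: exI[of _ 0])
    next
      case (step c u w)
      then obtain \<mu> where "\<mu> \<in> dual h" "u \<in> root_space h \<mu>" by blast
      then obtain n m where "(bracket y ^^ n) u = 0" "(bracket y ^^ m) w = 0"
        using ad_nilpotent_root_space[OF assms] step by metis
      then have "(bracket y ^^ (max n m)) u = 0" "(bracket y ^^ (max n m)) w = 0"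
        using le by (metis max.cobounded1, metis max.cobounded2)
      then show ?case by (intro exI[of _ "max n m"]) (simp add: lin)
    qed
  qed
  obtain B :: "'g set" where B: "finite B" "cspan B = UNIV" by (rule finite_dim)
  obtain N where N: "\<And>z. (bracket y ^^ N z) z = 0" using local by metis
  have "(bracket y ^^ (Max (N ` B))) z = 0" for z
  proof -
    have "z \<in> cspan B" using B by simp
    then show ?thesis
    proof (induction rule: complex_vector.span_induct_alt)
      case base
      then show ?case by (simp add: lin)
    next
      case (step c u w)
      have "(bracket y ^^ (Max (N ` B))) u = 0"
        by (rule le[OF N]) (use step B in simp)
      then show ?case using step by (simp add: lin)
    qed
  qed
  then show ?thesis by blast
qed

lemma bracket_opposite_in_h:
  assumes "x \<in> root_space h \<alpha>" "y \<in> root_space h (- \<alpha>)"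
  shows "bracket x y \<in> h"
  using bracket_root_space[OF assms] by (simp add: root_space_0)

lemma string_formula:
  assumes "x \<in> root_space h \<alpha>" "y \<in> root_space h (- \<alpha>)" "v \<in> root_space h \<mu>" "bracket x v = 0"
  shows "bracket x ((bracket y ^^ Suc j) v) =
    (of_nat (Suc j) * (\<mu> (bracket x y) - of_nat j * \<alpha> (bracket x y) / 2)) *\<^sub>C (bracket y ^^ j) v"
proof (induction j)
  case 0
  then show ?case using assms bracket_derivation[of x y v] bracket_opposite_in_h[OF assms(1,2)]
    by (simp add: root_space_def)
next
  case (Suc j)
  let ?Z = "bracket x y" and ?w = "(bracket y ^^ Suc j) v"
  let ?c = "of_nat (Suc j) * (\<mu> ?Z - of_nat j * \<alpha> ?Z / 2)"
  have "bracket x (bracket y ?w) = bracket ?Z ?w + bracket y (bracket x ?w)"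
    by (rule bracket_derivation)
  also have "bracket ?Z ?w = (\<mu> ?Z - of_nat (Suc j) * \<alpha> ?Z) *\<^sub>C ?w"
    using bracket_pow_root_space[OF assms(2,3), of "Suc j"] bracket_opposite_in_h[OF assms(1,2)]
    unfolding root_space_def by (simp del: of_nat_Suc funpow.simps)
  also have "bracket y (bracket x ?w) = ?c *\<^sub>C ?w"
    unfolding Suc by (simp add: bracket_scaleC_right del: of_nat_Suc)
  also have "(\<mu> ?Z - of_nat (Suc j) * \<alpha> ?Z) *\<^sub>C ?w + ?c *\<^sub>C ?w =
      (\<mu> ?Z - of_nat (Suc j) * \<alpha> ?Z + ?c) *\<^sub>C ?w"
    by (rule scaleC_add_left[symmetric])
  also have "\<mu> ?Z - of_nat (Suc j) * \<alpha> ?Z + ?c =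
      of_nat (Suc (Suc j)) * (\<mu> ?Z - of_nat (Suc j) * \<alpha> ?Z / 2)"
    by (simp add: field_simps)
  finally show ?case by simp
qed

text \<open>Let \<open>j + 1\<close> be the least exponent for which the power of
  \<open>bracket y\<close> kills \<open>v\<close>. The formula at \<open>j\<close> then has a zero
  left side and a nonzero vector on the right, so its scalar vanishes.\<close>

lemma string:
  assumes "x \<in> root_space h \<alpha>" "y \<in> root_space h (- \<alpha>)" "\<alpha> \<in> dual h" "\<alpha> \<noteq> 0"
    and "v \<in> root_space h \<mu>" "\<mu> \<in> dual h" "v \<noteq> 0" "bracket x v = 0"
  obtains j :: nat where "\<mu> (bracket x y) = of_nat j * \<alpha> (bracket x y) / 2"
    "\<And>i. i \<le> j \<Longrightarrow> (bracket y ^^ i) v \<noteq> 0"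
proof -
  have "- \<alpha> \<in> dual h" "- \<alpha> \<noteq> 0"
    using assms subspace_dual_simps(4) by auto
  then have ex: "\<exists>n. (bracket y ^^ n) v = 0"
    using ad_nilpotent_root_space assms by blast
  define n where "n = (LEAST n. (bracket y ^^ n) v = 0)"
  have n: "(bracket y ^^ n) v = 0" unfolding n_def using ex by (rule LeastI_ex)
  then have "n \<noteq> 0" using assms by (intro notI) simp
  then obtain j where j: "n = Suc j" by (metis not0_implies_Suc)
  have nz: "(bracket y ^^ i) v \<noteq> 0" if "i \<le> j" for i
    using that j not_less_Least[of i "\<lambda>n. (bracket y ^^ n) v = 0"] unfolding n_def by linarith
  have "(of_nat (Suc j) * (\<mu> (bracket x y) - of_nat j * \<alpha> (bracket x y) / 2)) *\<^sub>C (bracket y ^^ j) v = 0"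
    using string_formula[OF assms(1,2,5,8), of j] n j by (simp del: of_nat_Suc funpow.simps)
  then have "of_nat (Suc j) * (\<mu> (bracket x y) - of_nat j * \<alpha> (bracket x y) / 2) = 0"
    using nz[of j] complex_vector.scale_eq_0_iff by blast
  then have "\<mu> (bracket x y) = of_nat j * \<alpha> (bracket x y) / 2"
    by (simp del: of_nat_Suc)
  then show thesis using nz that by blast
qed

lemma top_of_string:
  assumes "\<alpha> \<in> dual h" "\<alpha> \<noteq> 0" "\<mu> \<in> dual h" "root_space h \<mu> \<noteq> {0}"
  obtains p :: nat and v where "v \<in> root_space h (\<mu> + of_nat p *\<^sub>C \<alpha>)" "v \<noteq> 0"
    "\<And>x. x \<in> root_space h \<alpha> \<Longrightarrow> bracket x v = 0"
proof -
  have "\<exists>p :: nat. root_space h (\<mu> + of_nat p *\<^sub>C \<alpha>) \<noteq> {0} \<and> root_space h (\<mu> + of_nat (Suc p) *\<^sub>C \<alpha>) = {0}"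
  proof (rule ccontr)
    assume *: "\<not> ?thesis"
    have "root_space h (\<mu> + of_nat n *\<^sub>C \<alpha>) \<noteq> {0}" for n :: nat
    proof (induction n)
      case 0
      then show ?case using assms by simp
    next
      case (Suc n)
      then show ?case using * by blast
    qed
    then show False using weight_progression assms by blast
  qed
  then obtain p :: nat where p: "root_space h (\<mu> + of_nat p *\<^sub>C \<alpha>) \<noteq> {0}"
    "root_space h (\<mu> + of_nat (Suc p) *\<^sub>C \<alpha>) = {0}" by blast
  obtain v where v: "v \<in> root_space h (\<mu> + of_nat p *\<^sub>C \<alpha>)" "v \<noteq> 0"
    using p(1) complex_vector.subspace_0[OF subspace_root_space] by blast
  have eq: "\<alpha> + (\<mu> + of_nat p *\<^sub>C \<alpha>) = \<mu> + of_nat (Suc p) *\<^sub>C \<alpha>"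
    by (simp add: fun_eq_iff algebra_simps)
  have "bracket x v = 0" if "x \<in> root_space h \<alpha>" for x
    using bracket_root_space[OF that v(1)] unfolding eq p(2) by simp
  then show thesis using v that by blast
qed

section \<open>Roots, sl2 triples and coroots\<close>

lemma rootsI: "\<alpha> \<in> dual h \<Longrightarrow> \<alpha> \<noteq> 0 \<Longrightarrow> x \<in> root_space h \<alpha> \<Longrightarrow> x \<noteq> 0 \<Longrightarrow> \<alpha> \<in> roots h"
  by (auto simp: roots_def)

lemma rootsD: "\<alpha> \<in> roots h \<Longrightarrow> \<alpha> \<in> dual h" "\<alpha> \<in> roots h \<Longrightarrow> \<alpha> \<noteq> 0"
    "\<alpha> \<in> roots h \<Longrightarrow> root_space h \<alpha> \<noteq> {0}"
  by (auto simp: roots_def)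

lemma finite_roots: "finite (roots h)"
  by (rule finite_subset[OF _ finite_weights]) (auto simp: roots_def)

text \<open>At the top of the \<alpha>-string of any root \<beta>, the weight takes on
  \<open>bracket x y\<close> a multiple of \<open>\<alpha> (bracket x y) = 0\<close>. Hence every
  root vanishes on \<open>bracket x y\<close>, and the roots separate the points of
  \<open>h\<close>.\<close>

lemma bracket_opposite_eq_0:
  assumes "x \<in> root_space h \<alpha>" "y \<in> root_space h (- \<alpha>)" "\<alpha> \<in> roots h" "\<alpha> (bracket x y) = 0"
  shows "bracket x y = 0"
proof (rule roots_separate)
  show "bracket x y \<in> h" using assms by (intro bracket_opposite_in_h)
  fix \<beta> assume \<beta>: "\<beta> \<in> roots h"
  obtain p :: nat and v where v: "v \<in> root_space h (\<beta> + of_nat p *\<^sub>C \<alpha>)" "v \<noteq> 0" "bracket x v = 0"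
    using top_of_string[of \<alpha> \<beta>] rootsD assms(1,3) \<beta> by metis
  have "\<beta> + of_nat p *\<^sub>C \<alpha> \<in> dual h"
    using rootsD assms(3) \<beta> by (intro subspace_dual_simps(1) subspace_dual_simps(3))
  then obtain j :: nat where "(\<beta> + of_nat p *\<^sub>C \<alpha>) (bracket x y) = of_nat j * \<alpha> (bracket x y) / 2"
    using string[OF assms(1,2) rootsD(1,2)[OF assms(3)] v(1) _ v(2,3)] by blast
  then show "\<beta> (bracket x y) = 0" using assms(4) by simp
qed

text \<open>The value 2 is the standard normalisation: it makes \<open>x\<close> and
  \<open>y\<close> eigenvectors of \<open>bracket x y\<close> with eigenvalues 2 and -2.\<close>

definition sl2 :: "('g \<Rightarrow> complex) \<Rightarrow> 'g \<Rightarrow> 'g \<Rightarrow> bool"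
  where "sl2 \<alpha> x y \<longleftrightarrow> \<alpha> \<in> roots h \<and> x \<in> root_space h \<alpha> \<and> y \<in> root_space h (- \<alpha>) \<and> \<alpha> (bracket x y) = 2"

lemma sl2D:
  assumes "sl2 \<alpha> x y"
  shows "\<alpha> \<in> roots h" "\<alpha> \<in> dual h" "\<alpha> \<noteq> 0" "x \<in> root_space h \<alpha>" "y \<in> root_space h (- \<alpha>)"
    "\<alpha> (bracket x y) = 2" "bracket x y \<in> h"
  using assms bracket_opposite_in_h rootsD by (auto simp: sl2_def)

lemma sl2_exists:
  assumes "\<alpha> \<in> roots h" "x \<in> root_space h \<alpha>" "y \<in> root_space h (- \<alpha>)" "bracket x y \<noteq> 0"
  obtains c where "sl2 \<alpha> (c *\<^sub>C x) y"
proof -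
  let ?Z = "bracket x y"
  have nz: "\<alpha> ?Z \<noteq> 0" using bracket_opposite_eq_0 assms by blast
  have "\<alpha> ((2 / \<alpha> ?Z) *\<^sub>C ?Z) = 2"
    using dual_linear(2)[OF rootsD(1)[OF assms(1)] bracket_opposite_in_h[OF assms(2,3)]] nz by simp
  then have "sl2 \<alpha> ((2 / \<alpha> ?Z) *\<^sub>C x) y"
    using assms complex_vector.subspace_scale[OF subspace_root_space]
    by (simp add: sl2_def bracket_scaleC_left)
  then show thesis by (rule that)
qed

lemma sl2_uminus:
  assumes "sl2 \<alpha> x y"
  shows "sl2 (- \<alpha>) y x"
proof -
  note s = sl2D[OF assms]
  have xy: "bracket y x = - bracket x y" by (rule bracket_anticommute)
  have "bracket x y \<noteq> 0" using s dual_linear(3)[OF s(2)] by auto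
  then have "y \<noteq> 0" by auto
  moreover have "- \<alpha> \<in> dual h" using s subspace_dual_simps(4) by blast
  ultimately have "- \<alpha> \<in> roots h" using s by (intro rootsI[of "- \<alpha>" y]) auto
  then show ?thesis using s dual_linear(5)[OF s(2,7)] by (simp add: sl2_def xy)
qed

text \<open>The multiple \<open>c\<close> of \<open>y\<close> is chosen so that \<alpha> vanishes on
  \<open>bracket x w\<close>, whence \<open>bracket x w = 0\<close>. A nonzero \<open>w\<close>
  would then be the top of a string, where the weight has a nonnegative value on
  \<open>bracket x y\<close>; but \<open>- \<alpha>\<close> has value -2.\<close>

lemma sl2_one_dim_opposite:
  assumes "sl2 \<alpha> x y" "z \<in> root_space h (- \<alpha>)"
  obtains c where "z = c *\<^sub>C y"
proof -
  note s = sl2D[OF assms(1)]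
  define c where "c = \<alpha> (bracket x z) / 2"
  define w where "w = z - c *\<^sub>C y"
  have w: "w \<in> root_space h (- \<alpha>)"
    unfolding w_def using assms s
    by (intro complex_vector.subspace_diff[OF subspace_root_space] complex_vector.subspace_scale[OF subspace_root_space])
  have "\<alpha> (bracket x w) = 0"
    using s dual_linear(2)[OF s(2,7)] bracket_opposite_in_h[OF s(4) assms(2)]
      dual_linear(4)[OF s(2), of "bracket x z" "c *\<^sub>C bracket x y"] complex_vector.subspace_scale[OF subspace_h s(7)]
    by (simp add: w_def bracket_diff_right bracket_scaleC_right c_def)
  then have xw: "bracket x w = 0" using bracket_opposite_eq_0 s w by blast
  have "w = 0"
  proof (rule ccontr)
    assume "w \<noteq> 0"
    moreover have "- \<alpha> \<in> dual h" using s subspace_dual_simps(4) by blast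
    ultimately obtain j :: nat where "(- \<alpha>) (bracket x y) = of_nat j * \<alpha> (bracket x y) / 2"
      using string[OF s(4,5,2,3) w _ _ xw] by blast
    then have "of_nat (j + 2) = (0 :: complex)" using s(6) by simp
    then have "j + 2 = 0" by (simp only: of_nat_eq_0_iff)
    then show False by simp
  qed
  then have "z = c *\<^sub>C y" by (simp add: w_def)
  then show thesis by (rule that)
qed

lemma sl2_one_dim:
  assumes "sl2 \<alpha> x y" "z \<in> root_space h \<alpha>"
  obtains c where "z = c *\<^sub>C x"
  using sl2_one_dim_opposite[OF sl2_uminus[OF assms(1)]] assms(2) by auto

lemma coroot_sl2:
  assumes "sl2 \<alpha> x y"
  shows "coroot h \<alpha> = bracket x y"
  unfolding coroot_def
proof (rule the_equality)
  note s = sl2D[OF assms]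
  show "bracket x y \<in> bracket_span (root_space h \<alpha>) (root_space h (- \<alpha>)) \<and> \<alpha> (bracket x y) = 2"
    using s unfolding bracket_span_def by (blast intro: complex_vector.span_base)
  fix H assume H: "H \<in> bracket_span (root_space h \<alpha>) (root_space h (- \<alpha>)) \<and> \<alpha> H = 2"
  have "{bracket a b |a b. a \<in> root_space h \<alpha> \<and> b \<in> root_space h (- \<alpha>)} \<subseteq> cspan {bracket x y}"
  proof clarify
    fix a b assume "a \<in> root_space h \<alpha>" "b \<in> root_space h (- \<alpha>)"
    then obtain c d where "a = c *\<^sub>C x" "b = d *\<^sub>C y"
      using sl2_one_dim[OF assms] sl2_one_dim_opposite[OF assms] by metis
    then show "bracket a b \<in> cspan {bracket x y}"
      by (auto simp: bracket_scaleC_left bracket_scaleC_right complex_vector.span_singleton)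
  qed
  then have "H \<in> cspan {bracket x y}"
    using H complex_vector.span_minimal[OF _ complex_vector.subspace_span] unfolding bracket_span_def by blast
  then obtain k where k: "H = k *\<^sub>C bracket x y" by (auto simp: complex_vector.span_singleton)
  then have "k = 1" using H dual_linear(2)[OF s(2,7)] s(6) by simp
  then show "H = bracket x y" using k by simp
qed

text \<open>Here \<open>p\<close> is the number of steps from \<beta> up to the top of its string,
  and \<open>j\<close> is the guaranteed length of the descent from there. The coefficients of
  \<alpha> that are reached run from \<open>p\<close> down to \<open>p - j\<close>, which is minus
  the sum of \<open>p\<close> and the value of \<beta> on \<open>bracket x y\<close>.\<close>

lemma half_string:
  assumes "sl2 \<alpha> x y" "\<beta> \<in> dual h" "root_space h \<beta> \<noteq> {0}"
  obtains p j :: nat where "\<beta> (bracket x y) + 2 * of_nat p = of_nat j"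
    "\<And>i. i \<le> j \<Longrightarrow> root_space h (\<beta> + (of_nat p - of_nat i) *\<^sub>C \<alpha>) \<noteq> {0}"
proof -
  note s = sl2D[OF assms(1)]
  obtain p :: nat and v where v: "v \<in> root_space h (\<beta> + of_nat p *\<^sub>C \<alpha>)" "v \<noteq> 0" "bracket x v = 0"
    using top_of_string[OF s(2,3) assms(2,3)] s(4) by metis
  have "\<beta> + of_nat p *\<^sub>C \<alpha> \<in> dual h"
    using s assms by (intro subspace_dual_simps(1) subspace_dual_simps(3))
  then obtain j :: nat where j: "(\<beta> + of_nat p *\<^sub>C \<alpha>) (bracket x y) = of_nat j * \<alpha> (bracket x y) / 2"
    "\<And>i. i \<le> j \<Longrightarrow> (bracket y ^^ i) v \<noteq> 0"
    using string[OF s(4,5,2,3) v(1) _ v(2,3)] by blast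
  have "root_space h (\<beta> + (of_nat p - of_nat i) *\<^sub>C \<alpha>) \<noteq> {0}" if "i \<le> j" for i
  proof -
    have eq: "\<beta> + of_nat p *\<^sub>C \<alpha> + of_nat i *\<^sub>C (- \<alpha>) = \<beta> + (of_nat p - of_nat i) *\<^sub>C \<alpha>"
      by (simp add: fun_eq_iff algebra_simps)
    show ?thesis using bracket_pow_root_space[OF s(5) v(1), of i] j(2)[OF that] unfolding eq by blast
  qed
  moreover have "\<beta> (bracket x y) + 2 * of_nat p = of_nat j" using j(1) s(6) by (simp add: mult.commute)
  ultimately show thesis using that by blast
qed

text \<open>With \<open>m\<close> the value of \<beta> on \<open>bracket x y\<close>, the
  coefficient \<open>- m\<close> must be reached. The descent covers \<open>p\<close> down to
  \<open>- m - p\<close>, so it succeeds if \<open>m + p\<close> is nonnegative. Otherwise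
  \<open>m\<close> is negative, and the triple of \<open>- \<alpha>\<close> covers
  \<open>- q\<close> up to \<open>q - m\<close>, which contains \<open>- m\<close>.\<close>

lemma weight_reflection:
  assumes "sl2 \<alpha> x y" "\<beta> \<in> dual h" "root_space h \<beta> \<noteq> {0}"
  obtains n :: int where "\<beta> (bracket x y) = of_int n" "root_space h (\<beta> - \<beta> (bracket x y) *\<^sub>C \<alpha>) \<noteq> {0}"
proof -
  note s = sl2D[OF assms(1)]
  obtain p j :: nat where j: "\<beta> (bracket x y) + 2 * of_nat p = of_nat j"
    "\<And>i. i \<le> j \<Longrightarrow> root_space h (\<beta> + (of_nat p - of_nat i) *\<^sub>C \<alpha>) \<noteq> {0}"
    using half_string[OF assms] by blast
  have "\<beta> (bracket y x) = - \<beta> (bracket x y)"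
    using dual_linear(5)[OF assms(2) s(7)] bracket_anticommute[of y x] by simp
  then obtain q k :: nat where k: "- \<beta> (bracket x y) + 2 * of_nat q = of_nat k"
    "\<And>i. i \<le> k \<Longrightarrow> root_space h (\<beta> + (of_nat q - of_nat i) *\<^sub>C (- \<alpha>)) \<noteq> {0}"
    using half_string[OF sl2_uminus[OF assms(1)] assms(2,3)] by metis
  define m where "m = int j - 2 * int p"
  have m: "\<beta> (bracket x y) = of_int m" using j(1) by (simp add: m_def algebra_simps)
  have "(of_int (2 * int q - m - int k) :: complex) = 0" using k(1) m by (simp add: algebra_simps)
  then have mk: "int k = 2 * int q - m" by (simp only: of_int_eq_0_iff)
  have "root_space h (\<beta> - of_int m *\<^sub>C \<alpha>) \<noteq> {0}"
  proof (cases "m + int p \<ge> 0")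
    case True
    then have "nat (m + int p) \<le> j" by (simp add: m_def)
    moreover have "\<beta> + (of_nat p - of_nat (nat (m + int p))) *\<^sub>C \<alpha> = \<beta> - of_int m *\<^sub>C \<alpha>"
      using True by (simp add: fun_eq_iff algebra_simps)
    ultimately show ?thesis using j(2)[of "nat (m + int p)"] by metis
  next
    case False
    then have "nat (int q - m) \<le> k" using mk by simp
    moreover have "\<beta> + (of_nat q - of_nat (nat (int q - m))) *\<^sub>C (- \<alpha>) = \<beta> - of_int m *\<^sub>C \<alpha>"
      using False by (simp add: fun_eq_iff algebra_simps)
    ultimately show ?thesis using k(2)[of "nat (int q - m)"] by metis
  qed
  then show thesis using m that by simp
qed

text \<open>Lowering from the highest multiple of \<gamma> down to \<gamma> itself ends in the line
  of \<open>x\<close>, which \<open>bracket x\<close> kills. The string formula gives instead the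
  scalar \<open>(m + 1) * (m + 4)\<close> times a nonzero vector.\<close>

lemma no_multiple_root:
  assumes "sl2 \<gamma> x y" "k \<ge> 2"
  shows "root_space h (of_nat k *\<^sub>C \<gamma>) = {0}"
proof (rule ccontr)
  assume nz: "root_space h (of_nat k *\<^sub>C \<gamma>) \<noteq> {0}"
  note s = sl2D[OF assms(1)]
  have dk: "of_nat k *\<^sub>C \<gamma> \<in> dual h" for k :: nat
    using s subspace_dual_simps(3) by blast
  obtain p :: nat and v where v: "v \<in> root_space h (of_nat k *\<^sub>C \<gamma> + of_nat p *\<^sub>C \<gamma>)" "v \<noteq> 0" "bracket x v = 0"
    using top_of_string[OF s(2,3) dk nz] s(4) by metis
  \<comment> \<open>The top weight is \<open>m + 2\<close> times \<gamma>, so that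
    \<open>m + 1\<close> lowering steps lead to \<gamma>.\<close>
  define m where "m = k + p - 2"
  have "k + p = m + 2" using assms(2) by (simp add: m_def)
  then have m: "of_nat k *\<^sub>C \<gamma> + of_nat p *\<^sub>C \<gamma> = of_nat (m + 2) *\<^sub>C \<gamma>"
    by (simp only: scaleC_add_left[symmetric] of_nat_add[symmetric])
  obtain j :: nat where j: "(of_nat (m + 2) *\<^sub>C \<gamma>) (bracket x y) = of_nat j * \<gamma> (bracket x y) / 2"
    "\<And>i. i \<le> j \<Longrightarrow> (bracket y ^^ i) v \<noteq> 0"
    using string[OF s(4,5,2,3) v(1)[unfolded m] dk v(2,3)] by blast
  have "(of_nat j :: complex) = of_nat (2 * (m + 2))" using j(1) s(6) by (simp add: mult.commute)
  then have "j = 2 * (m + 2)" by (simp only: of_nat_eq_iff)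
  then have nz: "(bracket y ^^ m) v \<noteq> 0" using j(2)[of m] by simp
  have eq: "of_nat (m + 2) *\<^sub>C \<gamma> + of_nat (Suc m) *\<^sub>C (- \<gamma>) = \<gamma>"
    by (simp add: fun_eq_iff algebra_simps)
  have "(bracket y ^^ Suc m) v \<in> root_space h \<gamma>"
    using bracket_pow_root_space[OF s(5) v(1)[unfolded m], of "Suc m"] unfolding eq .
  then obtain c where "(bracket y ^^ Suc m) v = c *\<^sub>C x" by (rule sl2_one_dim[OF assms(1)])
  then have "bracket x ((bracket y ^^ Suc m) v) = 0" by (simp add: bracket_scaleC_right bracket_self)
  then have "of_nat (Suc m) * ((of_nat (m + 2) *\<^sub>C \<gamma>) (bracket x y) - of_nat m * \<gamma> (bracket x y) / 2) = 0"
    using string_formula[OF s(4,5) v(1)[unfolded m] v(3), of m] nz complex_vector.scale_eq_0_iff by metis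
  then have "(of_nat (m + 2) *\<^sub>C \<gamma>) (bracket x y) - of_nat m * \<gamma> (bracket x y) / 2 = 0"
    using of_nat_neq_0 mult_eq_0_iff by blast
  moreover have "of_nat (m + 4) = (of_nat (m + 2) *\<^sub>C \<gamma>) (bracket x y) - of_nat m * \<gamma> (bracket x y) / 2"
    using s(6) by (simp add: algebra_simps)
  ultimately have "of_nat (m + 4) = (0 :: complex)" by (simp only:)
  then have "m + 4 = 0" by (simp only: of_nat_eq_0_iff)
  then show False by simp
qed

text \<open>The product of the two reflections is a transvection; it has infinite order on the finite set
  of weights unless it is trivial.\<close>

lemma proportional_coroots:
  assumes "sl2 \<beta> x y" "sl2 \<gamma> x' y'" "bracket x' y' = c *\<^sub>C bracket x y"
  shows "\<beta> = c *\<^sub>C \<gamma>"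
proof -
  note s = sl2D[OF assms(1)] and t = sl2D[OF assms(2)]
  let ?H = "bracket x y" and ?K = "bracket x' y'"
  have val: "\<mu> ?K = c * \<mu> ?H" if "\<mu> \<in> dual h" for \<mu>
    using dual_linear(2)[OF that s(7)] assms(3) by simp
  have c\<gamma>: "c * \<gamma> ?H = 2" using val[OF t(2)] t(6) by simp
  define \<delta> where "\<delta> = c *\<^sub>C \<gamma> - \<beta>"
  have \<delta>: "\<delta> \<in> dual h" unfolding \<delta>_def
    using s t by (intro subspace_dual_simps(2) subspace_dual_simps(3))
  have step: "root_space h (\<mu> - \<mu> ?H *\<^sub>C \<beta>) \<noteq> {0}" "root_space h (\<mu> - \<mu> ?K *\<^sub>C \<gamma>) \<noteq> {0}"
    if "\<mu> \<in> dual h" "root_space h \<mu> \<noteq> {0}" for \<mu>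
    using weight_reflection[OF assms(1) that] weight_reflection[OF assms(2) that] by blast+
  \<comment> \<open>A weight with value 2 on \<open>?H\<close> is reflected in \<gamma> and then in
    \<beta>; together this adds \<open>(- 2) *\<^sub>C \<delta>\<close>. As \<delta> vanishes on
    \<open>?H\<close>, the value 2 persists and the step can be repeated.\<close>
  have "root_space h (\<beta> + of_nat n *\<^sub>C ((- 2) *\<^sub>C \<delta>)) \<noteq> {0}" for n :: nat
  proof (induction n)
    case 0
    then show ?case using rootsD(3)[OF s(1)] by simp
  next
    case (Suc n)
    define \<mu> where "\<mu> = \<beta> + of_nat n *\<^sub>C ((- 2) *\<^sub>C \<delta>)"
    define \<nu> where "\<nu> = \<mu> - \<mu> ?K *\<^sub>C \<gamma>"
    have d: "\<mu> \<in> dual h" unfolding \<mu>_def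
      using s \<delta> by (intro subspace_dual_simps(1) subspace_dual_simps(3))
    have d2: "\<nu> \<in> dual h" unfolding \<nu>_def
      using d t by (intro subspace_dual_simps(2) subspace_dual_simps(3))
    have "\<delta> ?H = 0" using c\<gamma> s(6) by (simp add: \<delta>_def)
    then have \<mu>H: "\<mu> ?H = 2" using s(6) by (simp add: \<mu>_def)
    then have \<mu>K: "\<mu> ?K = 2 * c" using val[OF d] by simp
    then have \<nu>H: "\<nu> ?H = - 2" using c\<gamma> \<mu>H by (simp add: \<nu>_def algebra_simps)
    have "\<nu> - (- 2) *\<^sub>C \<beta> = \<beta> + of_nat (Suc n) *\<^sub>C ((- 2) *\<^sub>C \<delta>)"
      unfolding \<nu>_def \<mu>K by (simp add: fun_eq_iff \<delta>_def \<mu>_def algebra_simps)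
    moreover have "root_space h \<nu> \<noteq> {0}"
      unfolding \<nu>_def by (rule step(2)[OF d]) (use Suc in \<open>simp only: \<mu>_def not_False_eq_True\<close>)
    ultimately show ?case
      using step(1)[OF d2] unfolding \<nu>H by metis
  qed
  then have "(- 2) *\<^sub>C \<delta> = 0"
    using weight_progression[of "(- 2) *\<^sub>C \<delta>" \<beta>] s(2) subspace_dual_simps(3)[OF \<delta>] by blast
  then have "\<delta> = 0" using complex_vector.scale_eq_0_iff[of "-2" \<delta>] by simp
  then show ?thesis by (simp add: \<delta>_def)
qed


section \<open>Roots whose root space brackets trivially with the opposite one\<close>

definition degenerate :: "('g \<Rightarrow> complex) \<Rightarrow> bool"
  where "degenerate \<alpha> \<longleftrightarrow> \<alpha> \<in> roots h \<and> (\<forall>x\<in>root_space h \<alpha>. \<forall>y\<in>root_space h (- \<alpha>). bracket x y = 0)"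

lemma nondegenerate_sl2:
  assumes "\<alpha> \<in> roots h" "\<not> degenerate \<alpha>"
  obtains x y where "sl2 \<alpha> x y"
  using assms sl2_exists unfolding degenerate_def by metis

text \<open>Both \<open>2 c\<close> and \<open>2 / c\<close> are values of a root on a coroot, hence
  integers \<open>n\<close> and \<open>m\<close> with product 4. If \<open>n\<close> is 4 or 1 up to
  sign, one of the roots is twice the other up to sign, which \<open>no_multiple_root\<close>
  forbids.\<close>

lemma proportional_roots:
  assumes "sl2 \<beta> x y" "sl2 \<gamma> x' y'" "\<beta> = c *\<^sub>C \<gamma>"
  shows "c = 1 \<or> c = - 1"
proof -
  note s = sl2D[OF assms(1)] and t = sl2D[OF assms(2)]
  obtain n :: int where n: "\<beta> (bracket x' y') = of_int n"
    using weight_reflection[OF assms(2) s(2) rootsD(3)[OF s(1)]] by blast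
  obtain m :: int where m: "\<gamma> (bracket x y) = of_int m"
    using weight_reflection[OF assms(1) t(2) rootsD(3)[OF t(1)]] by blast
  have cn: "of_int n = 2 * c" unfolding n[symmetric] assms(3) by (simp add: t(6))
  have hc: "c = of_int n / 2" unfolding cn by simp
  have cm: "c * of_int m = 2" using m assms(3) s(6) by simp
  have "(of_int (n * m) :: complex) = of_int 4" using cn cm by simp
  then have nm: "n * m = 4" by (simp only: of_int_eq_iff)
  then have "n dvd 4" by (metis dvd_triv_left)
  then have "\<bar>n\<bar> \<le> 4" using zdvd_imp_le[of "\<bar>n\<bar>" 4] by simp
  then have "n \<in> {-4..4}" by auto
  then have "n = -4 \<or> n = -3 \<or> n = -2 \<or> n = -1 \<or> n = 0 \<or> n = 1 \<or> n = 2 \<or> n = 3 \<or> n = 4" by auto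
  then have "n = -4 \<or> n = -2 \<or> n = -1 \<or> n = 1 \<or> n = 2 \<or> n = 4" using nm by presburger
  moreover have "n \<noteq> 4"
  proof
    assume "n = 4"
    then have "\<beta> = of_nat 2 *\<^sub>C \<gamma>" using cn assms(3) by simp
    then show False using no_multiple_root[OF assms(2), of 2] rootsD(3)[OF s(1)] by simp
  qed
  moreover have "n \<noteq> - 4"
  proof
    assume "n = - 4"
    then have "c = - 2" by (simp add: hc)
    then have "\<beta> = of_nat 2 *\<^sub>C (- \<gamma>)" using assms(3) by (simp add: fun_eq_iff)
    then show False using no_multiple_root[OF sl2_uminus[OF assms(2)], of 2] rootsD(3)[OF s(1)] by simp
  qed
  moreover have "n \<noteq> 1"
  proof
    assume "n = 1"
    then have "\<gamma> = of_nat 2 *\<^sub>C \<beta>" using cn assms(3) by (simp add: fun_eq_iff field_simps)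
    then show False using no_multiple_root[OF assms(1), of 2] rootsD(3)[OF t(1)] by simp
  qed
  moreover have "n \<noteq> - 1"
  proof
    assume "n = - 1"
    then have c: "2 * c = - 1" using cn by simp
    have "\<gamma> = of_nat 2 *\<^sub>C (- \<beta>)"
    proof
      fix z
      have "\<gamma> z = - (2 * c) * \<gamma> z" unfolding c by simp
      then show "\<gamma> z = (of_nat 2 *\<^sub>C (- \<beta>)) z" by (simp add: assms(3))
    qed
    then show False using no_multiple_root[OF sl2_uminus[OF assms(1)], of 2] rootsD(3)[OF t(1)] by simp
  qed
  ultimately have "n = 2 \<or> n = - 2" by auto
  then show ?thesis by (auto simp: hc)
qed

text \<open>This makes the degenerate root spaces span an ideal. If \<gamma> were nondegenerate with
  triple \<open>a\<close>, \<open>f\<close>, then \<open>bracket x e\<close> is a nonzero multiple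
  of \<open>a\<close>. Moving \<open>x\<close> past \<open>e\<close> in
  \<open>bracket x (bracket e f) = 0\<close> shows that \<open>bracket e u\<close> is a nonzero
  multiple of \<open>bracket a f\<close>. So \<beta> is nondegenerate as well, with a coroot
  proportional to that of \<gamma>; then \<beta> is \<gamma> or its negative, and \<alpha> is zero
  or twice \<gamma>.\<close>

lemma degenerate_bracket:
  assumes "degenerate \<alpha>" "x \<in> root_space h \<alpha>" "\<beta> \<in> dual h" "e \<in> root_space h \<beta>" "bracket x e \<noteq> 0"
  shows "degenerate (\<alpha> + \<beta>)"
proof (rule ccontr)
  assume nd: "\<not> degenerate (\<alpha> + \<beta>)"
  have \<alpha>: "\<alpha> \<in> roots h" using assms by (simp add: degenerate_def)
  define \<gamma> where "\<gamma> = \<alpha> + \<beta>"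
  have xe: "bracket x e \<in> root_space h \<gamma>"
    unfolding \<gamma>_def by (rule bracket_root_space) (use assms in auto)
  have "\<gamma> \<noteq> 0"
  proof
    assume "\<gamma> = 0"
    then have "\<beta> = - \<alpha>" by (simp add: \<gamma>_def eq_neg_iff_add_eq_0 add.commute)
    then show False using assms by (auto simp: degenerate_def)
  qed
  moreover have "\<gamma> \<in> dual h"
    unfolding \<gamma>_def using rootsD(1)[OF \<alpha>] assms by (intro subspace_dual_simps(1))
  ultimately have "\<gamma> \<in> roots h" using rootsI xe assms by blast
  then obtain a f where af: "sl2 \<gamma> a f" using nondegenerate_sl2 nd unfolding \<gamma>_def by blast
  note t = sl2D[OF af]
  obtain c where c: "bracket x e = c *\<^sub>C a" by (rule sl2_one_dim[OF af xe])
  have c0: "c \<noteq> 0" using c assms by auto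
  define u where "u = bracket x f"
  have u: "u \<in> root_space h (- \<beta>)"
  proof -
    have "\<alpha> + (- \<gamma>) = - \<beta>" by (simp add: \<gamma>_def)
    then show ?thesis unfolding u_def using bracket_root_space[OF assms(2) t(5)] by simp
  qed
  have "bracket e f \<in> root_space h (- \<alpha>)"
  proof -
    have "\<beta> + (- \<gamma>) = - \<alpha>" by (simp add: \<gamma>_def)
    then show ?thesis using bracket_root_space[OF assms(4) t(5)] by simp
  qed
  then have "bracket x (bracket e f) = 0" using assms by (auto simp: degenerate_def)
  then have eu: "bracket e u = (- c) *\<^sub>C bracket a f"
    using bracket_derivation[of x e f] unfolding u_def c by (simp add: bracket_scaleC_left add_eq_0_iff)
  have "bracket a f \<noteq> 0" using t(6) dual_linear(3)[OF t(2)] by auto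
  then have eu0: "bracket e u \<noteq> 0" using eu c0 by simp
  have "\<beta> \<noteq> 0"
  proof
    assume "\<beta> = 0"
    then have "degenerate \<gamma>" using assms by (simp add: \<gamma>_def)
    then show False using nd by (simp add: \<gamma>_def)
  qed
  then have "\<beta> \<in> roots h" using rootsI assms by fastforce
  then obtain d where d: "sl2 \<beta> (d *\<^sub>C e) u" using sl2_exists[OF _ assms(4) u eu0] by blast
  have d0: "d \<noteq> 0" using sl2D(6)[OF d] dual_linear(3)[OF assms(3)] by auto
  have "(- inverse (c * d)) *\<^sub>C bracket (d *\<^sub>C e) u = ((- inverse (c * d)) * (d * (- c))) *\<^sub>C bracket a f"
    by (simp only: bracket_scaleC_left eu scaleC_scaleC mult.assoc)
  moreover have "(- inverse (c * d)) * (d * (- c)) = 1" using c0 d0 by (simp add: field_simps)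
  ultimately have "bracket a f = (- inverse (c * d)) *\<^sub>C bracket (d *\<^sub>C e) u"
    by (simp only: scaleC_one)
  then have \<beta>: "\<beta> = (- inverse (c * d)) *\<^sub>C \<gamma>" by (rule proportional_coroots[OF d af])
  then have "- inverse (c * d) = 1 \<or> - inverse (c * d) = - 1" by (rule proportional_roots[OF d af])
  then consider "\<beta> = \<gamma>" | "\<beta> = - \<gamma>" using \<beta> by (metis complex_vector.scale_minus_left complex_vector.scale_one)
  then show False
  proof cases
    case 1
    then have "\<alpha> = 0" by (simp add: \<gamma>_def)
    then show False using rootsD(2)[OF \<alpha>] by simp
  next
    case 2
    then have "\<alpha> = of_nat 2 *\<^sub>C \<gamma>" by (simp add: \<gamma>_def fun_eq_iff algebra_simps)
    then show False using no_multiple_root[OF af, of 2] rootsD(3)[OF \<alpha>] by simp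
  qed
qed

end


section \<open>Weakly closed sets of nilpotent elements\<close>

lemma bracket_span_mono: "A \<subseteq> A' \<Longrightarrow> B \<subseteq> B' \<Longrightarrow> bracket_span A B \<subseteq> bracket_span A' B'"
  unfolding bracket_span_def by (rule complex_vector.span_mono) blast

lemma bracket_spanI: "x \<in> A \<Longrightarrow> y \<in> B \<Longrightarrow> bracket x y \<in> bracket_span A B"
  unfolding bracket_span_def by (blast intro: complex_vector.span_base)

lemma bracket_span_least:
  "(\<And>x y. x \<in> A \<Longrightarrow> y \<in> B \<Longrightarrow> bracket x y \<in> P) \<Longrightarrow> csubspace P \<Longrightarrow> bracket_span A B \<subseteq> P"
  unfolding bracket_span_def by (rule complex_vector.span_minimal) blast+

lemma subspace_bracket_span: "csubspace (bracket_span A B)"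
  unfolding bracket_span_def by simp

text \<open>The span of all \<open>n\<close>-fold brackets of elements of \<open>V\<close> applied
  to arbitrary elements. That it is zero for some \<open>n\<close> says that the adjoint action of
  \<open>V\<close> generates a nilpotent associative algebra.\<close>

abbreviation central_descent :: "'g::complex_lie_algebra set \<Rightarrow> nat \<Rightarrow> 'g set"
  where "central_descent V n \<equiv> (bracket_span V ^^ n) UNIV"

lemma subspace_central_descent: "csubspace (central_descent V n)"
  by (cases n) (simp_all add: subspace_bracket_span)

text \<open>By the derivation rule. It lets \<open>bracket x\<close> act on the quotients of
  consecutive terms when \<open>x\<close> normalises \<open>V\<close>.\<close>

lemma central_descent_stable:
  assumes "\<And>v. v \<in> V \<Longrightarrow> bracket x v \<in> V"
  shows "z \<in> central_descent V n \<Longrightarrow> bracket x z \<in> central_descent V n"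
proof (induction n arbitrary: z)
  case (Suc n)
  have "z \<in> cspan {bracket v u |v u. v \<in> V \<and> u \<in> central_descent V n}"
    using Suc.prems by (simp add: bracket_span_def[of V "central_descent V n"])
  then show ?case
  proof (induction rule: complex_vector.span_induct)
    case base
    show ?case
      using subspace_central_descent[where V = V and n = "Suc n"]
      by (intro complex_vector.subspaceI)
        (auto simp: bracket_add_right bracket_scaleC_right complex_vector.subspace_0
          complex_vector.subspace_add complex_vector.subspace_scale simp del: funpow.simps)
  next
    case (step z)
    then obtain v u where z: "z = bracket v u" "v \<in> V" "u \<in> central_descent V n" by blast
    have "bracket x z = bracket (bracket x v) u + bracket v (bracket x u)"
      unfolding z(1) by (rule bracket_derivation)
    moreover have "bracket (bracket x v) u \<in> central_descent V (Suc n)"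
      using assms z by (simp add: bracket_spanI)
    moreover have "bracket v (bracket x u) \<in> central_descent V (Suc n)"
      using Suc.IH[OF z(3)] z(2) by (simp add: bracket_spanI)
    ultimately show ?case
      using complex_vector.subspace_add[OF subspace_central_descent[where V = V and n = "Suc n"]] by simp
  qed
qed simp

lemma central_descent_decreasing: "central_descent V (Suc n) \<subseteq> central_descent V n"
proof (induction n)
  case (Suc n)
  then show ?case using bracket_span_mono[of V V] by simp
qed simp

text \<open>On the quotient of consecutive terms \<open>V\<close> acts by zero, so the enlarged
  space acts there by multiples of \<open>bracket x\<close>. Hence \<open>n\<close> brackets lead
  from one term to the next, and \<open>n * k\<close> brackets lead to zero.\<close>

lemma extend_nilpotent:
  assumes V: "csubspace V" "\<And>v. v \<in> V \<Longrightarrow> bracket x v \<in> V"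
    and k: "central_descent V k = {0}" and n: "\<And>z. (bracket x ^^ n) z = 0"
  shows "\<exists>m. central_descent (cspan (insert x V)) m = {0}"
proof -
  let ?V = "cspan (insert x V)"
  let ?U = "central_descent V"
  \<comment> \<open>Modulo the next term, \<open>j\<close> brackets with the enlarged space give
    nothing but values of the \<open>j\<close>-th power of \<open>bracket x\<close>.\<close>
  have *: "(bracket_span ?V ^^ j) (?U i) \<subseteq> {z. \<exists>w\<in>?U i. z - (bracket x ^^ j) w \<in> ?U (Suc i)} \<inter> ?U i" for i j
  proof (induction j)
    case 0
    have *: "z - (bracket x ^^ 0) z \<in> ?U (Suc i)" for z
      using complex_vector.subspace_0[OF subspace_central_descent[where V = V and n = "Suc i"]] by (simp del: funpow.simps(2))
    show ?case
    proof
      fix z assume "z \<in> (bracket_span ?V ^^ 0) (?U i)"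
      then have "z \<in> ?U i" by simp
      then show "z \<in> {z. \<exists>w\<in>?U i. z - (bracket x ^^ 0) w \<in> ?U (Suc i)} \<inter> ?U i"
        using * by blast
    qed
  next
    case (Suc j)
    note lin = bracket_pow_linear[where x = x]
    let ?P = "{z. \<exists>w\<in>?U i. z - (bracket x ^^ Suc j) w \<in> ?U (Suc i)} \<inter> ?U i"
    have sub: "csubspace ?P"
    proof (rule complex_vector.subspaceI)
      show "0 \<in> ?P"
        using complex_vector.subspace_0[OF subspace_central_descent] complex_vector.linear_0[OF lin]
        by (auto intro!: bexI[of _ 0] simp del: funpow.simps)
    next
      fix a b assume a: "a \<in> ?P" and b: "b \<in> ?P"
      then obtain w w' where w: "w \<in> ?U i" "a - (bracket x ^^ Suc j) w \<in> ?U (Suc i)"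
        "w' \<in> ?U i" "b - (bracket x ^^ Suc j) w' \<in> ?U (Suc i)" by blast
      have "a + b - (bracket x ^^ Suc j) (w + w') =
          (a - (bracket x ^^ Suc j) w) + (b - (bracket x ^^ Suc j) w')"
        unfolding complex_vector.linear_add[OF lin] by simp
      also have "\<dots> \<in> ?U (Suc i)" by (rule complex_vector.subspace_add[OF subspace_central_descent w(2,4)])
      finally show "a + b \<in> ?P"
        using a b w complex_vector.subspace_add[OF subspace_central_descent] by blast
    next
      fix c a assume a: "a \<in> ?P"
      then obtain w where w: "w \<in> ?U i" "a - (bracket x ^^ Suc j) w \<in> ?U (Suc i)" by blast
      have "c *\<^sub>C a - (bracket x ^^ Suc j) (c *\<^sub>C w) = c *\<^sub>C (a - (bracket x ^^ Suc j) w)"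
        unfolding complex_vector.linear_scale[OF lin] by (simp add: complex_vector.scale_right_diff_distrib)
      also have "\<dots> \<in> ?U (Suc i)" by (rule complex_vector.subspace_scale[OF subspace_central_descent w(2)])
      finally show "c *\<^sub>C a \<in> ?P"
        using a w complex_vector.subspace_scale[OF subspace_central_descent] by blast
    qed
    have "bracket y z \<in> ?P" if y: "y \<in> ?V" and z: "z \<in> (bracket_span ?V ^^ j) (?U i)" for y z
    proof -
      obtain c v where yc: "y = c *\<^sub>C x + v" "v \<in> V"
        using y V(1) complex_vector.span_breakdown_eq[of y x V] complex_vector.span_eq_iff[of V]
        by (metis add.commute diff_add_cancel)
      obtain w where w: "w \<in> ?U i" "z - (bracket x ^^ j) w \<in> ?U (Suc i)" "z \<in> ?U i"
        using Suc z by blast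
      have v: "bracket v z \<in> ?U (Suc i)" using yc w by (simp add: bracket_spanI)
      have "bracket y z - (bracket x ^^ Suc j) (c *\<^sub>C w) = c *\<^sub>C bracket x (z - (bracket x ^^ j) w) + bracket v z"
        unfolding yc complex_vector.linear_scale[OF lin]
        by (simp add: bracket_add_left bracket_scaleC_left bracket_diff_right complex_vector.scale_right_diff_distrib)
      also have "\<dots> \<in> ?U (Suc i)"
        by (intro complex_vector.subspace_add[OF subspace_central_descent] v
            complex_vector.subspace_scale[OF subspace_central_descent] central_descent_stable[OF V(2)] w)
      finally have 1: "bracket y z - (bracket x ^^ Suc j) (c *\<^sub>C w) \<in> ?U (Suc i)" .
      have "bracket y z = c *\<^sub>C bracket x z + bracket v z"
        by (simp add: yc bracket_add_left bracket_scaleC_left)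
      also have "\<dots> \<in> ?U i"
        using v central_descent_decreasing[where V = V and n = i]
        by (intro complex_vector.subspace_add[OF subspace_central_descent]
            complex_vector.subspace_scale[OF subspace_central_descent] central_descent_stable[OF V(2)] w) auto
      finally have 2: "bracket y z \<in> ?U i" .
      have "c *\<^sub>C w \<in> ?U i" using w by (intro complex_vector.subspace_scale[OF subspace_central_descent])
      then show ?thesis using 1 2 by blast
    qed
    then have "bracket_span ?V ((bracket_span ?V ^^ j) (?U i)) \<subseteq> ?P"
      by (intro bracket_span_least sub)
    then show ?case by simp
  qed
  have step: "(bracket_span ?V ^^ n) (?U i) \<subseteq> ?U (Suc i)" for i
  proof
    fix z assume "z \<in> (bracket_span ?V ^^ n) (?U i)"
    then obtain w where "z - (bracket x ^^ n) w \<in> ?U (Suc i)" using * by blast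
    then show "z \<in> ?U (Suc i)" unfolding n by (simp only: diff_zero)
  qed
  have mono: "(bracket_span ?V ^^ j) A \<subseteq> (bracket_span ?V ^^ j) B" if "A \<subseteq> B" for j A B
    using that by (induction j) (auto dest: bracket_span_mono[OF order_refl])
  have "(bracket_span ?V ^^ (n * i)) UNIV \<subseteq> ?U i" for i
  proof (induction i)
    case (Suc i)
    have "(bracket_span ?V ^^ (n * Suc i)) UNIV = (bracket_span ?V ^^ n) ((bracket_span ?V ^^ (n * i)) UNIV)"
      by (simp add: funpow_add)
    also have "\<dots> \<subseteq> ?U (Suc i)" using mono[OF Suc] step by blast
    finally show ?case .
  qed simp
  then have "central_descent ?V (n * k) \<subseteq> {0}" using k by metis
  then show ?thesis
    using complex_vector.subspace_0[OF subspace_central_descent] by (intro exI[of _ "n * k"]) blast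
qed

text \<open>Jacobson's version of Engel's theorem, for the adjoint representation.\<close>

lemma weakly_closed_nilpotent:
  fixes S :: "'g::complex_lie_algebra set"
  assumes fin: "finite B" "cspan B = (UNIV :: 'g set)"
    and S: "0 \<in> S" "\<And>a b. a \<in> S \<Longrightarrow> b \<in> S \<Longrightarrow> bracket a b \<in> S"
    and nilp: "\<And>x. x \<in> S \<Longrightarrow> \<exists>n. \<forall>z. (bracket x ^^ n) z = 0"
  obtains V k where "S \<subseteq> V" "csubspace V" "central_descent V k = {0}"
proof -
  \<comment> \<open>A subspace of maximal dimension is taken among those that are spanned by
    elements of \<open>S\<close>, closed under brackets and already satisfy the conclusion.\<close>
  define good where "good V \<longleftrightarrow> V = cspan (S \<inter> V) \<and> (\<forall>a\<in>V. \<forall>b\<in>V. bracket a b \<in> V) \<and>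
    (\<exists>k. central_descent V k = {0})" for V
  have "good {0}"
  proof -
    have "central_descent {0} 1 = ({0} :: 'g set)" using bracket_span_trivial[of "{0}" "UNIV :: 'g set"] by simp
    moreover have "S \<inter> {0} = {0}" using S by blast
    moreover have "cspan {0} = ({0} :: 'g set)" by simp
    ultimately show ?thesis unfolding good_def by (auto intro: exI[of _ 1])
  qed
  moreover have "cdim V < Suc (card B)" for V :: "'g set"
    using complex_vector.dim_le_card[of V B] fin by (simp add: less_Suc_eq_le)
  ultimately obtain V where V: "good V" "\<And>V'. good V' \<Longrightarrow> cdim V' \<le> cdim V"
    using ex_has_greatest_nat[of good "{0}" cdim "Suc (card B)"] by (metis less_imp_le)
  have sub: "csubspace V" using V(1) unfolding good_def by (metis complex_vector.subspace_span)
  obtain k where k: "central_descent V k = {0}" using V(1) unfolding good_def by blast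
  have "S \<subseteq> V"
  proof (rule ccontr)
    assume "\<not> S \<subseteq> V"
    have "\<exists>x\<in>S - V. \<forall>t\<in>V. bracket t x \<in> V"
    proof (rule ccontr)
      assume no: "\<not> ?thesis"
      \<comment> \<open>If no element of \<open>S\<close> outside \<open>V\<close> normalises
        \<open>V\<close>, brackets with \<open>S \<inter> V\<close> can always be chosen to stay
        outside \<open>V\<close> while descending further, although the descent ends in
        zero.\<close>
      have "(S - V) \<inter> central_descent V n \<noteq> {}" for n
      proof (induction n)
        case 0
        then show ?case using \<open>\<not> S \<subseteq> V\<close> by auto
      next
        case (Suc n)
        then obtain x where x: "x \<in> S - V" "x \<in> central_descent V n" by blast
        have "\<exists>t\<in>S \<inter> V. bracket t x \<notin> V"
        proof (rule ccontr)
          assume *: "\<not> ?thesis"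
          have "bracket t x \<in> V" if "t \<in> V" for t
          proof -
            have "t \<in> cspan (S \<inter> V)" using that V(1) unfolding good_def by blast
            then show ?thesis
            proof (induction rule: complex_vector.span_induct)
              case base
              show ?case using sub
                by (intro complex_vector.subspaceI)
                  (auto simp: bracket_add_left bracket_scaleC_left complex_vector.subspace_0
                    complex_vector.subspace_add complex_vector.subspace_scale)
            qed (use * in blast)
          qed
          then show False using no x by blast
        qed
        then obtain t where "t \<in> S \<inter> V" "bracket t x \<notin> V" by blast
        then have "bracket t x \<in> (S - V) \<inter> central_descent V (Suc n)"
          using S(2) x by (simp add: bracket_spanI)
        then show ?case by blast
      qed
      from this[of k] show False using k sub complex_vector.subspace_0 by auto
    qed
    then obtain x where x: "x \<in> S" "x \<notin> V" "\<And>t. t \<in> V \<Longrightarrow> bracket t x \<in> V" by blast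
    have xt: "bracket x t \<in> V" if "t \<in> V" for t
      using x(3)[OF that] complex_vector.subspace_neg[OF sub] bracket_anticommute[of x t] by metis
    define V' where "V' = cspan (insert x V)"
    have VV': "insert x V \<subseteq> V'" unfolding V'_def by (rule complex_vector.span_superset)
    have "good V'"
      unfolding good_def
    proof (intro conjI ballI)
      have "insert x V \<subseteq> cspan (S \<inter> V')"
      proof -
        have "cspan (S \<inter> V) \<subseteq> cspan (S \<inter> V')" using VV' by (intro complex_vector.span_mono) blast
        then have "V \<subseteq> cspan (S \<inter> V')" using V(1) unfolding good_def by blast
        moreover have "x \<in> cspan (S \<inter> V')" using x(1) VV' by (intro complex_vector.span_base) blast
        ultimately show ?thesis by blast
      qed
      then have "V' \<subseteq> cspan (S \<inter> V')"
        unfolding V'_def by (intro complex_vector.span_minimal) simp_all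
      moreover have "cspan (S \<inter> V') \<subseteq> V'"
        by (rule complex_vector.span_minimal) (simp_all add: V'_def)
      ultimately show "V' = cspan (S \<inter> V')" by blast
      obtain n where "\<And>z. (bracket x ^^ n) z = 0" using nilp[OF x(1)] by blast
      then show "\<exists>k. central_descent V' k = {0}"
        unfolding V'_def by (intro extend_nilpotent[OF sub xt k])
      fix a b assume "a \<in> V'" "b \<in> V'"
      then obtain c d v w where ab: "a = c *\<^sub>C x + v" "v \<in> V" "b = d *\<^sub>C x + w" "w \<in> V"
        using sub complex_vector.span_breakdown_eq[of _ x V] complex_vector.span_eq_iff[of V]
        unfolding V'_def by (metis add.commute diff_add_cancel)
      have "bracket a b = c *\<^sub>C bracket x w + d *\<^sub>C bracket v x + bracket v w"
        unfolding ab by (simp add: bracket_add_left bracket_add_right bracket_scaleC_left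
            bracket_scaleC_right bracket_self)
      also have "\<dots> \<in> V"
        using ab xt x(3) V(1) unfolding good_def
        by (intro complex_vector.subspace_add[OF sub] complex_vector.subspace_scale[OF sub]) auto
      finally show "bracket a b \<in> V'" using VV' by blast
    qed
    then have "cdim V' \<le> cdim V" by (rule V(2))
    moreover have "csubspace V'" "V \<subset> V'" using VV' x(2) unfolding V'_def by auto
    ultimately show False using subspace_dim_less[OF fin sub, of V'] by simp
  qed
  then show thesis using sub k by (rule that)
qed

context cartan_pair
begin

lemma no_degenerate_roots: "\<not> degenerate \<alpha>"
proof
  assume \<alpha>: "degenerate \<alpha>"
  define S where "S = insert 0 (\<Union>\<alpha>\<in>{\<alpha>. degenerate \<alpha>}. root_space h \<alpha>)"
  have dd: "\<beta> \<in> dual h" "\<beta> \<noteq> 0" if "degenerate \<beta>" for \<beta> using that rootsD unfolding degenerate_def by blast+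
  have SS: "bracket a b \<in> S" if a: "a \<in> S" and b: "b \<in> root_space h \<beta>" "\<beta> \<in> dual h" for a b \<beta>
  proof (cases "bracket a b = 0")
    case True
    then show ?thesis by (simp add: S_def)
  next
    case False
    then have "a \<noteq> 0" by auto
    then obtain \<gamma> where g: "degenerate \<gamma>" "a \<in> root_space h \<gamma>" using a unfolding S_def by blast
    then have "degenerate (\<gamma> + \<beta>)" using degenerate_bracket b False by blast
    moreover have "bracket a b \<in> root_space h (\<gamma> + \<beta>)" by (rule bracket_root_space[OF g(2) b(1)])
    ultimately show ?thesis unfolding S_def by blast
  qed
  have S1: "bracket a b \<in> S" if a: "a \<in> S" and b: "b \<in> S" for a b
  proof (cases "b = 0")
    case True
    then show ?thesis by (simp add: S_def)
  next
    case False
    then obtain \<beta> where "degenerate \<beta>" "b \<in> root_space h \<beta>" using b unfolding S_def by blast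
    then show ?thesis using SS a dd by blast
  qed
  have S2: "\<exists>n. \<forall>z. (bracket x ^^ n) z = 0" if x: "x \<in> S" for x
  proof (cases "x = 0")
    case True
    then show ?thesis by (intro exI[of _ 1]) simp
  next
    case False
    then obtain \<beta> where "degenerate \<beta>" "x \<in> root_space h \<beta>" using x unfolding S_def by blast
    then show ?thesis using ad_nilpotent dd by blast
  qed
  obtain B :: "'g set" where B: "finite B" "cspan B = UNIV" by (rule finite_dim)
  obtain V k where V: "S \<subseteq> V" "csubspace V" "central_descent V k = {0}"
    using weakly_closed_nilpotent[OF B, of S] S1 S2 unfolding S_def by (metis insertI1)
  have SR: "cspan S \<subseteq> V" using V by (simp add: complex_vector.span_minimal)
  have ideal': "bracket a b \<in> cspan S" if "a \<in> cspan S" for a b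
    using that
  proof (induction rule: complex_vector.span_induct)
    case base
    show ?case
      by (intro complex_vector.subspaceI)
        (auto simp: bracket_add_left bracket_scaleC_left complex_vector.span_zero
          complex_vector.span_add complex_vector.span_scale)
  next
    case (step a)
    have "b \<in> cspan (\<Union>\<alpha>\<in>dual h. root_space h \<alpha>)" using span_root_spaces by simp
    then show ?case
    proof (induction rule: complex_vector.span_induct)
      case base
      show ?case
        by (intro complex_vector.subspaceI)
          (auto simp: bracket_add_right bracket_scaleC_right complex_vector.span_zero
            complex_vector.span_add complex_vector.span_scale)
    qed (use SS step in \<open>blast intro: complex_vector.span_base\<close>)
  qed
  have "lie_ideal (cspan S)"
    unfolding lie_ideal_def
    using ideal' bracket_anticommute complex_vector.span_neg by (metis complex_vector.subspace_span)
  moreover have "solvable (cspan S)"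
  proof -
    \<comment> \<open>The derived series of the ideal is bounded by the descent of the larger space
      \<open>V\<close>.\<close>
    have "((\<lambda>D. bracket_span D D) ^^ n) (cspan S) \<subseteq> cspan S \<inter> central_descent V n" for n
    proof (induction n)
      case (Suc n)
      let ?D = "((\<lambda>D. bracket_span D D) ^^ n) (cspan S)"
      have "bracket_span ?D ?D \<subseteq> bracket_span V (central_descent V n)"
        using Suc SR by (intro bracket_span_mono) blast+
      moreover have "bracket_span ?D ?D \<subseteq> cspan S"
        unfolding bracket_span_def[of ?D] using Suc ideal' by (intro complex_vector.span_minimal) blast+
      ultimately show ?case by simp
    qed simp
    from this[of k] V(3) have "((\<lambda>D. bracket_span D D) ^^ k) (cspan S) \<subseteq> {0}" by blast
    moreover have "0 \<in> ((\<lambda>D. bracket_span D D) ^^ k) (cspan S)"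
      by (cases k) (simp_all add: complex_vector.span_zero complex_vector.subspace_0 subspace_bracket_span)
    ultimately show ?thesis unfolding solvable_def by blast
  qed
  ultimately have "cspan S = {0}" by (rule no_solvable_ideal)
  moreover have "S \<subseteq> cspan S" by (rule complex_vector.span_superset)
  ultimately have "root_space h \<alpha> \<subseteq> {0}" using \<alpha> unfolding S_def by blast
  then show False using \<alpha> rootsD(3) complex_vector.subspace_0[OF subspace_root_space] unfolding degenerate_def by blast
qed

lemma root_sl2:
  assumes "\<alpha> \<in> roots h"
  obtains x y where "sl2 \<alpha> x y" "coroot h \<alpha> = bracket x y"
proof -
  obtain x y where "sl2 \<alpha> x y" by (rule nondegenerate_sl2[OF assms no_degenerate_roots])
  then show thesis using coroot_sl2 by (intro that)
qed

end


section \<open>The Weyl group\<close>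

context cartan_pair
begin

lemma roots_separate_eq:
  assumes "x \<in> h" "y \<in> h" "\<And>\<alpha>. \<alpha> \<in> roots h \<Longrightarrow> \<alpha> x = \<alpha> y"
  shows "x = y"
proof -
  have "\<alpha> (x - y) = 0" if "\<alpha> \<in> roots h" for \<alpha>
    using dual_linear(4)[OF rootsD(1)[OF that] assms(1,2)] assms(3)[OF that] by simp
  then show ?thesis using roots_separate[of "x - y"] subspace_h_simps(2)[OF assms(1,2)] by simp
qed

lemma coroot_in_h: "\<alpha> \<in> roots h \<Longrightarrow> coroot h \<alpha> \<in> h"
  by (elim root_sl2) (auto dest: sl2D)

lemma root_coroot: "\<alpha> \<in> roots h \<Longrightarrow> \<alpha> (coroot h \<alpha>) = 2"
  by (elim root_sl2) (auto dest: sl2D)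

lemma coroot_nonzero: "\<alpha> \<in> roots h \<Longrightarrow> coroot h \<alpha> \<noteq> 0"
  using root_coroot dual_linear(3)[OF rootsD(1)] by (metis zero_neq_numeral)

lemma root_coroot_int:
  assumes "\<alpha> \<in> roots h" "\<beta> \<in> roots h"
  obtains n :: int where "\<beta> (coroot h \<alpha>) = of_int n"
proof -
  obtain x y where "sl2 \<alpha> x y" "coroot h \<alpha> = bracket x y" by (rule root_sl2[OF assms(1)])
  then show thesis using weight_reflection[of \<alpha> x y \<beta>] rootsD[OF assms(2)] that by metis
qed

lemma uminus_root: "\<alpha> \<in> roots h \<Longrightarrow> - \<alpha> \<in> roots h"
  by (elim root_sl2) (auto dest: sl2_uminus sl2D)

lemma coroot_uminus: "\<alpha> \<in> roots h \<Longrightarrow> coroot h (- \<alpha>) = - coroot h \<alpha>"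
  by (elim root_sl2) (metis coroot_sl2 sl2_uminus bracket_anticommute)

lemma root_reflection_apply: "l \<in> dual h \<Longrightarrow> root_reflection h \<alpha> l = l - l (coroot h \<alpha>) *\<^sub>C \<alpha>"
  by (simp add: root_reflection_def)

lemma root_reflection_dual: "\<alpha> \<in> roots h \<Longrightarrow> l \<in> dual h \<Longrightarrow> root_reflection h \<alpha> l \<in> dual h"
  using rootsD(1) by (simp add: root_reflection_apply subspace_dual_simps)

lemma root_reflection_involution:
  assumes "\<alpha> \<in> roots h"
  shows "root_reflection h \<alpha> (root_reflection h \<alpha> l) = l"
proof (cases "l \<in> dual h")
  case True
  then show ?thesis
    using root_reflection_dual[OF assms True] root_coroot[OF assms]
    by (simp add: root_reflection_apply fun_eq_iff algebra_simps)
qed (simp add: root_reflection_def)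

lemma root_reflection_root:
  assumes "\<alpha> \<in> roots h" "\<beta> \<in> roots h"
  shows "root_reflection h \<alpha> \<beta> \<in> roots h"
proof -
  have "root_reflection h \<alpha> \<beta> \<noteq> 0"
  proof
    assume "root_reflection h \<alpha> \<beta> = 0"
    then have "\<beta> = root_reflection h \<alpha> 0" using root_reflection_involution[OF assms(1)] by metis
    then have "\<beta> = 0" by (simp add: root_reflection_def)
    then show False using rootsD(2) assms by blast
  qed
  moreover have "root_space h (root_reflection h \<alpha> \<beta>) \<noteq> {0}"
  proof -
    obtain x y where "sl2 \<alpha> x y" "coroot h \<alpha> = bracket x y" by (rule root_sl2[OF assms(1)])
    then show ?thesis
      using weight_reflection[of \<alpha> x y \<beta>] rootsD[OF assms(2)] by (metis root_reflection_apply)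
  qed
  ultimately show ?thesis using root_reflection_dual[OF assms(1)] rootsD(1)[OF assms(2)] by (simp add: roots_def)
qed

section \<open>The Weyl group through its transposes on the Cartan subalgebra\<close>

definition coreflection :: "('g \<Rightarrow> complex) \<Rightarrow> 'g \<Rightarrow> 'g"
  where "coreflection \<alpha> x = x - \<alpha> x *\<^sub>C coroot h \<alpha>"

lemma coreflection_in_h: "\<alpha> \<in> roots h \<Longrightarrow> x \<in> h \<Longrightarrow> coreflection \<alpha> x \<in> h"
  by (simp add: coreflection_def subspace_h_simps coroot_in_h)

lemma root_reflection_eval:
  assumes "\<alpha> \<in> roots h" "l \<in> dual h" "x \<in> h"
  shows "root_reflection h \<alpha> l x = l (coreflection \<alpha> x)"
  using assms coroot_in_h[OF assms(1)]
  by (simp add: root_reflection_apply coreflection_def dual_linear subspace_h_simps mult.commute)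

lemma weyl_reflection: "\<alpha> \<in> roots h \<Longrightarrow> root_reflection h \<alpha> \<in> weyl_group h"
  using weyl_group.reflection[OF _ weyl_group.id, of \<alpha> h] by simp

lemma weyl_dual: "w \<in> weyl_group h \<Longrightarrow> l \<in> dual h \<Longrightarrow> w l \<in> dual h"
  by (induction rule: weyl_group.induct) (auto intro: root_reflection_dual)

lemma weyl_outside: "w \<in> weyl_group h \<Longrightarrow> l \<notin> dual h \<Longrightarrow> w l = l"
  by (induction rule: weyl_group.induct) (auto simp: root_reflection_def)

lemma weyl_comp: "w \<in> weyl_group h \<Longrightarrow> v \<in> weyl_group h \<Longrightarrow> w \<circ> v \<in> weyl_group h"
  by (induction rule: weyl_group.induct) (auto simp: comp_assoc intro: weyl_group.reflection)

lemma weyl_inverse: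
  assumes "w \<in> weyl_group h"
  shows "\<exists>v\<in>weyl_group h. v \<circ> w = id \<and> w \<circ> v = id"
  using assms
proof (induction rule: weyl_group.induct)
  case id
  show ?case by (intro bexI[of _ id] weyl_group.id) auto
next
  case (reflection \<alpha> w)
  then obtain v where v: "v \<in> weyl_group h" "v \<circ> w = id" "w \<circ> v = id" by blast
  have vw: "v (w x) = x" "w (v x) = x" for x using v(2,3) by (metis comp_apply id_apply)+
  have "(v \<circ> root_reflection h \<alpha>) \<circ> (root_reflection h \<alpha> \<circ> w) = id"
    by (rule ext) (simp add: vw root_reflection_involution[OF reflection(1)])
  moreover have "(root_reflection h \<alpha> \<circ> w) \<circ> (v \<circ> root_reflection h \<alpha>) = id"
    by (rule ext) (simp add: vw root_reflection_involution[OF reflection(1)])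
  ultimately show ?case using weyl_comp[OF v(1) weyl_reflection[OF reflection(1)]] by blast
qed

lemma weyl_bij: "w \<in> weyl_group h \<Longrightarrow> bij w"
  using weyl_inverse[of w] o_bij by blast

lemma weyl_inv: "w \<in> weyl_group h \<Longrightarrow> inv w \<in> weyl_group h"
  using weyl_inverse[of w] inv_unique_comp by metis

lemma weyl_inv_apply [simp]:
  assumes "w \<in> weyl_group h"
  shows "inv w (w l) = l" "w (inv w l) = l" "inv w \<circ> w = id" "w \<circ> inv w = id"
proof -
  show "inv w (w l) = l" for l using weyl_bij[OF assms] by (simp add: bij_is_inj)
  then show "inv w \<circ> w = id" by (simp add: fun_eq_iff)
  show "w (inv w l) = l" for l using weyl_bij[OF assms] by (simp add: bij_is_surj surj_f_inv_f)
  then show "w \<circ> inv w = id" by (simp add: fun_eq_iff)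
qed

lemma weyl_root: "w \<in> weyl_group h \<Longrightarrow> \<alpha> \<in> roots h \<Longrightarrow> w \<alpha> \<in> roots h"
  by (induction rule: weyl_group.induct) (auto intro: root_reflection_root)

text \<open>A product of reflections is transposed to the product of coreflections in the opposite
  order. Each coreflection moves a point by a multiple of a coroot; this last clause is recorded for
  \<open>coroots_span\<close>.\<close>

lemma weyl_transpose:
  assumes "w \<in> weyl_group h"
  shows "\<exists>t. \<forall>x\<in>h. t x \<in> h \<and> (\<forall>l\<in>dual h. w l x = l (t x)) \<and> x - t x \<in> cspan (coroot h ` roots h)"
  using assms
proof (induction rule: weyl_group.induct)
  case id
  show ?case by (rule exI[of _ "\<lambda>x. x"]) (simp add: complex_vector.span_zero)
next
  case (reflection \<alpha> w)
  then obtain t where t: "\<And>x. x \<in> h \<Longrightarrow> t x \<in> h"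
    "\<And>x l. x \<in> h \<Longrightarrow> l \<in> dual h \<Longrightarrow> w l x = l (t x)"
    "\<And>x. x \<in> h \<Longrightarrow> x - t x \<in> cspan (coroot h ` roots h)" by blast
  show ?case
  proof (intro exI[of _ "\<lambda>x. t (coreflection \<alpha> x)"] ballI conjI)
    fix x assume x: "x \<in> h"
    note cx = coreflection_in_h[OF reflection(1) x]
    show "t (coreflection \<alpha> x) \<in> h" using t cx by blast
    show "(root_reflection h \<alpha> \<circ> w) l x = l (t (coreflection \<alpha> x))" if l: "l \<in> dual h" for l
      using root_reflection_eval[OF reflection(1) weyl_dual[OF reflection(2) l] x] t(2)[OF cx l] by simp
    have "x - t (coreflection \<alpha> x) = \<alpha> x *\<^sub>C coroot h \<alpha> + (coreflection \<alpha> x - t (coreflection \<alpha> x))"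
      by (simp add: coreflection_def)
    also have "\<dots> \<in> cspan (coroot h ` roots h)"
      using reflection(1) by (intro complex_vector.span_add complex_vector.span_scale t(3)[OF cx])
        (auto intro: complex_vector.span_base)
    finally show "x - t (coreflection \<alpha> x) \<in> cspan (coroot h ` roots h)" .
  qed
qed

lemma weyl_linear:
  assumes "w \<in> weyl_group h" "l \<in> dual h" "m \<in> dual h"
  shows "w (l + m) = w l + w m" "w (c *\<^sub>C l) = c *\<^sub>C w l"
proof -
  obtain t where t: "\<And>x. x \<in> h \<Longrightarrow> t x \<in> h"
    "\<And>x l. x \<in> h \<Longrightarrow> l \<in> dual h \<Longrightarrow> w l x = l (t x)"
    using weyl_transpose[OF assms(1)] by blast
  note d = weyl_dual[OF assms(1)] subspace_dual_simps[where h = h]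
  show "w (l + m) = w l + w m" "w (c *\<^sub>C l) = c *\<^sub>C w l"
    using assms t d by (auto intro!: dual_eqI[of _ h])
qed

text \<open>Equal values on the roots force equal transposes, since the roots separate points of
  \<open>h\<close>. This embeds the Weyl group into the self-maps of the finite set of
  roots.\<close>

lemma weyl_eqI:
  assumes w: "w \<in> weyl_group h" and v: "v \<in> weyl_group h" and eq: "\<And>\<alpha>. \<alpha> \<in> roots h \<Longrightarrow> w \<alpha> = v \<alpha>"
  shows "w = v"
proof
  fix l
  show "w l = v l"
  proof (cases "l \<in> dual h")
    case True
    obtain t where t: "\<And>x. x \<in> h \<Longrightarrow> t x \<in> h" "\<And>x l. x \<in> h \<Longrightarrow> l \<in> dual h \<Longrightarrow> w l x = l (t x)"
      using weyl_transpose[OF w] by blast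
    obtain u where u: "\<And>x. x \<in> h \<Longrightarrow> u x \<in> h" "\<And>x l. x \<in> h \<Longrightarrow> l \<in> dual h \<Longrightarrow> v l x = l (u x)"
      using weyl_transpose[OF v] by blast
    have "t x = u x" if "x \<in> h" for x
      using t u that eq rootsD(1) by (intro roots_separate_eq) (metis)+
    then show ?thesis
      using True t u weyl_dual w v by (intro dual_eqI[of _ h]) auto
  qed (use weyl_outside assms in simp)
qed

lemma finite_weyl: "finite (weyl_group h)"
proof -
  let ?f = "\<lambda>w \<alpha>. if \<alpha> \<in> roots h then w \<alpha> else (0 :: 'g \<Rightarrow> complex)"
  have "?f ` weyl_group h \<subseteq> {f. \<forall>\<alpha>. (\<alpha> \<in> roots h \<longrightarrow> f \<alpha> \<in> roots h) \<and> (\<alpha> \<notin> roots h \<longrightarrow> f \<alpha> = 0)}"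
    using weyl_root by auto
  then have "finite (?f ` weyl_group h)"
    by (rule finite_subset) (rule finite_set_of_finite_funs[OF finite_roots finite_roots])
  moreover have "inj_on ?f (weyl_group h)"
  proof (rule inj_onI)
    fix w v assume "w \<in> weyl_group h" "v \<in> weyl_group h" and eq: "?f w = ?f v"
    then show "w = v" using fun_cong[OF eq] by (intro weyl_eqI) presburger+
  qed
  ultimately show ?thesis by (rule finite_imageD)
qed

lemma sum_weyl_right:
  assumes "v \<in> weyl_group h"
  shows "(\<Sum>w\<in>weyl_group h. f (w \<circ> v)) = (\<Sum>w\<in>weyl_group h. f w)"
  by (rule sum.reindex_bij_witness[of _ "\<lambda>w. w \<circ> inv v" "\<lambda>w. w \<circ> v"])
    (use assms weyl_comp weyl_inv in \<open>auto simp: comp_assoc\<close>)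

lemma card_weyl_nonzero: "of_nat (card (weyl_group h)) \<noteq> (0 :: complex)"
  using finite_weyl weyl_group.id by auto

text \<open>The sum \<open>z\<close> of the transposes applied to \<open>x\<close> is fixed by all
  coreflections, so every root vanishes on it and \<open>z = 0\<close>. Hence the order of the group
  times \<open>x\<close> is the sum of the differences \<open>x - y w\<close>, which lie in the span
  of the coroots.\<close>

lemma coroots_span: "h \<subseteq> cspan (coroot h ` roots h)"
proof
  fix x assume x: "x \<in> h"
  have "\<forall>w\<in>weyl_group h. \<exists>y. y \<in> h \<and> (\<forall>l\<in>dual h. w l x = l y) \<and> x - y \<in> cspan (coroot h ` roots h)"
    using weyl_transpose x by meson
  then obtain y where y: "\<And>w. w \<in> weyl_group h \<Longrightarrow> y w \<in> h"
    "\<And>w l. w \<in> weyl_group h \<Longrightarrow> l \<in> dual h \<Longrightarrow> w l x = l (y w)"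
    "\<And>w. w \<in> weyl_group h \<Longrightarrow> x - y w \<in> cspan (coroot h ` roots h)" by metis
  define z where "z = sum y (weyl_group h)"
  have z: "z \<in> h" unfolding z_def using y by (intro complex_vector.subspace_sum[OF subspace_h])
  have val: "l z = (\<Sum>w\<in>weyl_group h. w l x)" if "l \<in> dual h" for l
  proof -
    have "l z = (\<Sum>w\<in>weyl_group h. l (y w))"
      unfolding z_def by (rule dual_sum[OF that subspace_h y(1)])
    also have "\<dots> = (\<Sum>w\<in>weyl_group h. w l x)"
      by (rule sum.cong[OF refl]) (rule y(2)[OF _ that, symmetric])
    finally show ?thesis .
  qed
  have "z = 0"
  proof (rule roots_separate[OF z])
    fix \<beta> assume \<beta>: "\<beta> \<in> roots h"
    have "coreflection \<beta> z = z"
    proof (rule roots_separate_eq)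
      fix \<alpha> assume \<alpha>: "\<alpha> \<in> roots h"
      note d = rootsD(1)[OF \<alpha>]
      have "\<alpha> (coreflection \<beta> z) = root_reflection h \<beta> \<alpha> z" using root_reflection_eval[OF \<beta> d z] by simp
      also have "\<dots> = (\<Sum>w\<in>weyl_group h. (w \<circ> root_reflection h \<beta>) \<alpha> x)"
        using val[OF root_reflection_dual[OF \<beta> d]] by simp
      also have "\<dots> = \<alpha> z"
        using sum_weyl_right[OF weyl_reflection[OF \<beta>], of "\<lambda>w. w \<alpha> x"] val[OF d] by simp
      finally show "\<alpha> (coreflection \<beta> z) = \<alpha> z" .
    qed (use z \<beta> coreflection_in_h in auto)
    then have "\<beta> z *\<^sub>C coroot h \<beta> = 0" by (simp add: coreflection_def)
    then show "\<beta> z = 0" using coroot_nonzero[OF \<beta>] complex_vector.scale_eq_0_iff by blast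
  qed
  then have "of_nat (card (weyl_group h)) *\<^sub>C x = (\<Sum>w\<in>weyl_group h. x - y w)"
    by (simp add: sum_subtractf z_def[symmetric] complex_vector.sum_constant_scale)
  also have "\<dots> \<in> cspan (coroot h ` roots h)"
    using y(3) by (rule complex_vector.span_sum)
  finally have "inverse (of_nat (card (weyl_group h))) *\<^sub>C of_nat (card (weyl_group h)) *\<^sub>C x \<in> cspan (coroot h ` roots h)"
    by (rule complex_vector.span_scale)
  then show "x \<in> cspan (coroot h ` roots h)" using card_weyl_nonzero by simp
qed

text \<open>Two reflections with the same root: their product is a transvection of finite order.\<close>

lemma reflection_unique:
  assumes "r \<in> weyl_group h" "r' \<in> weyl_group h" "H \<in> h" "H' \<in> h" "\<gamma> \<in> dual h" "\<gamma> H = 2" "\<gamma> H' = 2" "\<gamma> \<noteq> 0"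
    and r: "\<And>l. l \<in> dual h \<Longrightarrow> r l = l - l H *\<^sub>C \<gamma>" and r': "\<And>l. l \<in> dual h \<Longrightarrow> r' l = l - l H' *\<^sub>C \<gamma>"
  shows "H = H'"
proof (rule roots_separate_eq[OF assms(3,4)])
  fix \<alpha> assume "\<alpha> \<in> roots h"
  then have \<alpha>: "\<alpha> \<in> dual h" by (rule rootsD)
  define q where "q = r \<circ> r'"
  define k where "k = \<alpha> H' - \<alpha> H"
  have mem: "q ^^ n \<in> weyl_group h" for n
  proof (induction n)
    case 0
    show ?case using weyl_group.id by (simp add: id_def)
  next
    case (Suc n)
    then show ?case using weyl_comp[OF weyl_comp[OF assms(1,2)] Suc] unfolding q_def[symmetric] by (simp only: funpow.simps)
  qed
  have val: "(q ^^ n) \<alpha> = \<alpha> + (of_nat n * k) *\<^sub>C \<gamma>" for n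
  proof (induction n)
    case (Suc n)
    let ?l = "\<alpha> + (of_nat n * k) *\<^sub>C \<gamma>"
    have l: "?l \<in> dual h" using \<alpha> assms by (simp add: subspace_dual_simps)
    have "(q ^^ Suc n) \<alpha> = q ((q ^^ n) \<alpha>)" by simp
    also have "\<dots> = r (r' ?l)" by (simp only: Suc) (simp only: q_def o_apply)
    also have "\<dots> = ?l + (?l H' - ?l H) *\<^sub>C \<gamma>"
      using r'[OF l] r[of "?l - ?l H' *\<^sub>C \<gamma>"] l assms(5,6)
      by (simp add: subspace_dual_simps) (simp add: fun_eq_iff algebra_simps)
    also have "\<dots> = \<alpha> + (of_nat (Suc n) * k) *\<^sub>C \<gamma>"
      using assms(6,7) by (simp add: fun_eq_iff k_def algebra_simps)
    finally show ?case .
  qed simp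
  have "range (\<lambda>n. q ^^ n) \<subseteq> weyl_group h" using mem by blast
  then have "finite (range (\<lambda>n. q ^^ n))" using finite_weyl finite_subset by blast
  then have "\<not> inj (\<lambda>n. q ^^ n)" using finite_imageD by blast
  then obtain n m where "n \<noteq> m" "q ^^ n = q ^^ m" unfolding inj_def by blast
  then have "(of_nat n * k) *\<^sub>C \<gamma> = (of_nat m * k) *\<^sub>C \<gamma>" using val[of n] val[of m] by simp
  then have "k = 0" using \<open>n \<noteq> m\<close> assms(8) by (simp add: complex_vector.scale_cancel_right)
  then show "\<alpha> H = \<alpha> H'" by (simp add: k_def)
qed

text \<open>The reflection in the transformed root and the conjugate of the reflection in \<beta>
  are reflections with the same root, so \<open>reflection_unique\<close> identifies their
  coroots.\<close>

lemma coroot_reflection: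
  assumes \<alpha>: "\<alpha> \<in> roots h" and \<beta>: "\<beta> \<in> roots h"
  shows "coroot h (root_reflection h \<alpha> \<beta>) = coreflection \<alpha> (coroot h \<beta>)"
proof -
  let ?s = "root_reflection h \<alpha>"
  let ?\<gamma> = "?s \<beta>"
  have \<gamma>: "?\<gamma> \<in> roots h" using assms by (rule root_reflection_root)
  have eval: "?s l (coroot h \<beta>) = l (coreflection \<alpha> (coroot h \<beta>))" if "l \<in> dual h" for l
    by (rule root_reflection_eval[OF \<alpha> that coroot_in_h[OF \<beta>]])
  show ?thesis
  proof (rule reflection_unique[where \<gamma> = ?\<gamma> and r = "root_reflection h ?\<gamma>"
        and r' = "?s \<circ> root_reflection h \<beta> \<circ> ?s"])
    show "root_reflection h ?\<gamma> \<in> weyl_group h" using \<gamma> by (rule weyl_reflection)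
    show "?s \<circ> root_reflection h \<beta> \<circ> ?s \<in> weyl_group h"
      using assms by (intro weyl_comp weyl_reflection)
    show "?\<gamma> (coreflection \<alpha> (coroot h \<beta>)) = 2"
      using eval[OF rootsD(1)[OF \<gamma>]] root_reflection_involution[OF \<alpha>] root_coroot[OF \<beta>] by simp
    show "(?s \<circ> root_reflection h \<beta> \<circ> ?s) l = l - l (coreflection \<alpha> (coroot h \<beta>)) *\<^sub>C ?\<gamma>"
      if l: "l \<in> dual h" for l
    proof -
      have sl: "?s l \<in> dual h" using root_reflection_dual[OF \<alpha> l] .
      have b: "\<beta> \<in> dual h" using rootsD(1)[OF \<beta>] .
      have "?s (?s l + (- ?s l (coroot h \<beta>)) *\<^sub>C \<beta>) = ?s (?s l) + (- ?s l (coroot h \<beta>)) *\<^sub>C ?\<gamma>"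
        using weyl_linear[OF weyl_reflection[OF \<alpha>]] sl b subspace_dual_simps(3) by metis
      then show ?thesis
        using root_reflection_involution[OF \<alpha>] eval[OF l] root_reflection_apply[OF sl, of \<beta>] by simp
    qed
  qed (use \<gamma> rootsD coroot_in_h coreflection_in_h[OF \<alpha> coroot_in_h[OF \<beta>]] root_coroot
      in \<open>auto simp: root_reflection_apply\<close>)
qed

lemma coroot_proportional:
  assumes "\<beta> \<in> roots h" "\<gamma> \<in> roots h" "coroot h \<gamma> = c *\<^sub>C coroot h \<beta>"
  shows "\<beta> = \<gamma> \<or> \<beta> = - \<gamma>"
proof -
  obtain x y where xy: "sl2 \<beta> x y" "coroot h \<beta> = bracket x y" by (rule root_sl2[OF assms(1)])
  obtain x' y' where xy': "sl2 \<gamma> x' y'" "coroot h \<gamma> = bracket x' y'" by (rule root_sl2[OF assms(2)])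
  have "\<beta> = c *\<^sub>C \<gamma>" using proportional_coroots[OF xy(1) xy'(1)] assms(3) xy xy' by simp
  moreover from this have "c = 1 \<or> c = - 1" by (rule proportional_roots[OF xy(1) xy'(1)])
  ultimately show ?thesis by (auto simp: fun_eq_iff)
qed

subsection \<open>Half of the roots and the dimension of the flag variety\<close>

text \<open>The set \<open>{\<alpha>, -\<alpha>}\<close> is the same for \<open>\<alpha>\<close> and \<open>-\<alpha>\<close>, so one root of each pair is chosen.\<close>

definition half_roots :: "('g \<Rightarrow> complex) set"
  where "half_roots = {\<alpha> \<in> roots h. (SOME \<beta>. \<beta> \<in> {\<alpha>, - \<alpha>}) = \<alpha>}"

lemma half_roots:
  shows half_roots_sub: "half_roots \<subseteq> roots h"
    and half_roots_or: "\<alpha> \<in> roots h \<Longrightarrow> \<alpha> \<in> half_roots \<or> - \<alpha> \<in> half_roots"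
    and half_roots_not: "\<alpha> \<in> half_roots \<Longrightarrow> - \<alpha> \<notin> half_roots"
    and finite_half_roots: "finite half_roots"
proof -
  show sub: "half_roots \<subseteq> roots h" by (auto simp: half_roots_def)
  then show "finite half_roots" using finite_roots finite_subset by blast
  have some: "(SOME \<beta>. \<beta> \<in> {\<alpha>, - \<alpha>}) \<in> {\<alpha>, - \<alpha>}" for \<alpha> :: "'g \<Rightarrow> complex"
    by (rule someI[of _ \<alpha>]) simp
  have swap: "{- \<alpha>, - (- \<alpha>)} = {\<alpha>, - \<alpha>}" for \<alpha> :: "'g \<Rightarrow> complex" by auto
  show "\<alpha> \<in> roots h \<Longrightarrow> \<alpha> \<in> half_roots \<or> - \<alpha> \<in> half_roots"
    using some[of \<alpha>] uminus_root[of \<alpha>] unfolding half_roots_def mem_Collect_eq swap by blast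
  show "- \<alpha> \<notin> half_roots" if a: "\<alpha> \<in> half_roots"
  proof
    assume "- \<alpha> \<in> half_roots"
    then have "- \<alpha> = \<alpha>" using a unfolding half_roots_def mem_Collect_eq swap by simp
    then have "(- \<alpha>) (coroot h \<alpha>) = \<alpha> (coroot h \<alpha>)" by (rule fun_cong)
    then show False using root_coroot[of \<alpha>] a sub by auto
  qed
qed

text \<open>Up to nonzero scalars \<open>x\<close>, \<open>y\<close> and their bracket are brackets
  of one another, so they survive in every term of the derived series.\<close>

lemma solvable_no_sl2:
  assumes "lie_subalgebra b" "solvable b" "sl2 \<alpha> x y" "x \<in> b"
  shows "y \<notin> b"
proof
  assume y: "y \<in> b"
  note s = sl2D[OF assms(3)]
  let ?H = "bracket x y"
  let ?D = "\<lambda>n. ((\<lambda>D. bracket_span D D) ^^ n) b"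
  have sub: "csubspace (?D n)" for n
    using assms(1) by (cases n) (simp_all add: lie_subalgebra_def subspace_bracket_span)
  have "x \<in> ?D n \<and> y \<in> ?D n \<and> ?H \<in> ?D n" for n
  proof (induction n)
    case 0
    then show ?case using assms(1,4) y by (simp add: lie_subalgebra_def)
  next
    case (Suc n)
    have "bracket ?H x = 2 *\<^sub>C x" "bracket ?H y = (- 2) *\<^sub>C y"
      using s by (simp_all add: root_space_def)
    moreover have "bracket ?H x \<in> ?D (Suc n)" "bracket ?H y \<in> ?D (Suc n)" "?H \<in> ?D (Suc n)"
      using Suc by (simp_all add: bracket_spanI)
    ultimately have 1: "2 *\<^sub>C x \<in> ?D (Suc n)" "(- 2) *\<^sub>C y \<in> ?D (Suc n)" "?H \<in> ?D (Suc n)"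
      by (simp_all only:)
    then have "(1/2) *\<^sub>C (2 *\<^sub>C x) \<in> ?D (Suc n)" "(- 1/2) *\<^sub>C ((- 2) *\<^sub>C y) \<in> ?D (Suc n)"
      using complex_vector.subspace_scale[OF sub] by blast+
    then show ?case using 1(3) by (simp del: funpow.simps)
  qed
  moreover obtain n where "?D n = {0}" using assms(2) unfolding solvable_def by blast
  ultimately have "?H = 0" by blast
  then show False using s dual_linear(3)[OF s(2)] by simp
qed

text \<open>Gives meaning to the choice in \<open>flag_dim\<close>. A solvable subalgebra containing
  \<open>h\<close> of maximal dimension is a Borel subalgebra.\<close>

lemma borel_exists: "\<exists>b. borel_subalgebra b \<and> h \<subseteq> b"
proof -
  obtain B :: "'g set" where B: "finite B" "cspan B = UNIV" by (rule finite_dim)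
  define good where "good b \<longleftrightarrow> lie_subalgebra b \<and> solvable b \<and> h \<subseteq> b" for b
  have "good h"
    unfolding good_def
  proof (intro conjI order_refl)
    show "lie_subalgebra h" using subspace_h abelian_h subspace_h_simps by (simp add: lie_subalgebra_def)
    have "bracket_span h h = {0}" by (rule bracket_span_trivial) (rule abelian_h)
    then show "solvable h" unfolding solvable_def by (intro exI[of _ 1]) simp
  qed
  moreover have "cdim V < Suc (card B)" for V :: "'g set"
    using complex_vector.dim_le_card[of V B] B by (simp add: less_Suc_eq_le)
  ultimately obtain b where b: "good b" "\<And>b'. good b' \<Longrightarrow> cdim b' \<le> cdim b"
    using ex_has_greatest_nat[of good h cdim "Suc (card B)"] by (metis less_imp_le)
  have "a = b" if a: "lie_subalgebra a" "solvable a" "b \<subseteq> a" for a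
  proof (rule ccontr)
    assume "a \<noteq> b"
    then have "cdim b < cdim a"
      using a b(1) by (intro subspace_dim_less[OF B]) (auto simp: good_def lie_subalgebra_def)
    moreover have "good a" using a b(1) by (auto simp: good_def)
    ultimately show False using b(2) by force
  qed
  then have "borel_subalgebra b" using b(1) by (auto simp: good_def borel_subalgebra_def)
  then show ?thesis using b(1) by (auto simp: good_def)
qed

text \<open>From each pair of opposite roots, at least one of the two vectors of an sl2 triple lies
  outside \<open>b\<close>. The vectors so chosen have distinct weights and \<open>b\<close> is
  stable under \<open>h\<close>, so they are independent modulo \<open>b\<close>.\<close>

lemma card_half_roots_le_flag_dim: "card half_roots \<le> flag_dim h"
proof -
  obtain B :: "'g set" where B: "finite B" "cspan B = UNIV" by (rule finite_dim)
  define b where "b = (SOME b. borel_subalgebra b \<and> h \<subseteq> b)"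
  have b: "borel_subalgebra b" "h \<subseteq> b" using someI_ex[OF borel_exists] unfolding b_def by blast+
  have bs: "lie_subalgebra b" "solvable b" "csubspace b"
    using b by (auto simp: borel_subalgebra_def lie_subalgebra_def)
  have "\<exists>\<beta> x. (\<beta> = \<alpha> \<or> \<beta> = - \<alpha>) \<and> \<beta> \<in> roots h \<and> x \<in> root_space h \<beta> \<and> x \<notin> b" if "\<alpha> \<in> half_roots" for \<alpha>
  proof -
    have \<alpha>: "\<alpha> \<in> roots h" using that half_roots_sub by blast
    then obtain x y where xy: "sl2 \<alpha> x y" by (rule root_sl2)
    then have "x \<notin> b \<or> y \<notin> b" using solvable_no_sl2 bs by blast
    then show ?thesis using sl2D[OF xy] \<alpha> uminus_root by blast
  qed
  then obtain \<beta> x where \<beta>: "\<And>\<alpha>. \<alpha> \<in> half_roots \<Longrightarrow> \<beta> \<alpha> = \<alpha> \<or> \<beta> \<alpha> = - \<alpha>"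
    "\<And>\<alpha>. \<alpha> \<in> half_roots \<Longrightarrow> \<beta> \<alpha> \<in> roots h" "\<And>\<alpha>. \<alpha> \<in> half_roots \<Longrightarrow> x \<alpha> \<in> root_space h (\<beta> \<alpha>)"
    "\<And>\<alpha>. \<alpha> \<in> half_roots \<Longrightarrow> x \<alpha> \<notin> b" by metis
  have inj: "\<beta> \<alpha> \<noteq> \<beta> \<alpha>'" if "\<alpha> \<in> half_roots" "\<alpha>' \<in> half_roots" "\<alpha> \<noteq> \<alpha>'" for \<alpha> \<alpha>'
    using \<beta>(1) that half_roots_not by (metis minus_minus)
  have zero: "c \<alpha> = 0" if "(\<Sum>\<alpha>\<in>half_roots. c \<alpha> *\<^sub>C x \<alpha>) \<in> b" "\<alpha> \<in> half_roots" for c \<alpha>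
  proof -
    have "c \<alpha> *\<^sub>C x \<alpha> \<in> b"
    proof (rule separated_components[OF finite_half_roots bs(3) _ that])
      fix \<gamma> \<gamma>' assume g: "\<gamma> \<in> half_roots" "\<gamma>' \<in> half_roots" "\<gamma> \<noteq> \<gamma>'"
      then obtain H where H: "H \<in> h" "\<beta> \<gamma> H \<noteq> \<beta> \<gamma>' H"
        using inj \<beta>(2) rootsD(1) dual_eqI by metis
      show "\<exists>T e. clinear T \<and> T ` b \<subseteq> b \<and>
          (\<forall>\<alpha>\<in>half_roots. T (c \<alpha> *\<^sub>C x \<alpha>) = e \<alpha> *\<^sub>C c \<alpha> *\<^sub>C x \<alpha>) \<and> e \<gamma> \<noteq> e \<gamma>'"
      proof (intro exI[of _ "bracket H"] exI[of _ "\<lambda>\<alpha>. \<beta> \<alpha> H"] conjI ballI bracket_linear)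
        show "bracket H ` b \<subseteq> b" using bs(1) b(2) H(1) by (auto simp: lie_subalgebra_def)
        show "bracket H (c \<alpha> *\<^sub>C x \<alpha>) = \<beta> \<alpha> H *\<^sub>C c \<alpha> *\<^sub>C x \<alpha>" if "\<alpha> \<in> half_roots" for \<alpha>
          using \<beta>(3)[OF that] H(1) by (simp add: root_space_def bracket_scaleC_right mult.commute)
      qed (rule H(2))
    qed
    then have "inverse (c \<alpha>) *\<^sub>C c \<alpha> *\<^sub>C x \<alpha> \<in> b" by (rule complex_vector.subspace_scale[OF bs(3)])
    then show ?thesis using \<beta>(4)[OF that(2)] by (cases "c \<alpha> = 0") auto
  qed
  obtain C where C: "C \<subseteq> b" "complex_vector.independent C" "b \<subseteq> cspan C" "card C = cdim b"
    by (rule complex_vector.basis_exists)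
  have Cb: "cspan C = b" using C bs by (simp add: complex_vector.span_subspace)
  have finC: "finite C" using complex_vector.independent_span_bound[OF B(1) C(2)] B by simp
  \<comment> \<open>Enlarging a basis of \<open>b\<close> by the chosen vectors one at a time keeps
    it independent, as a dependence would put a nontrivial combination of these vectors into
    \<open>b\<close>.\<close>
  have ind: "complex_vector.independent (x ` A \<union> C) \<and> card (x ` A \<union> C) = card A + card C \<and> finite (x ` A \<union> C)"
    if "finite A" "A \<subseteq> half_roots" for A
    using that
  proof (induction A)
    case empty
    then show ?case using C finC by simp
  next
    case (insert \<alpha> A)
    have "x \<alpha> \<notin> cspan (x ` A \<union> C)"
    proof
      assume "x \<alpha> \<in> cspan (x ` A \<union> C)"
      then obtain u v where uv: "x \<alpha> = u + v" "u \<in> cspan (x ` A)" "v \<in> b"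
        unfolding complex_vector.span_Un Cb by blast
      have "\<exists>c. u = (\<Sum>a\<in>A. c a *\<^sub>C x a)"
        using uv(2)
      proof (induction rule: complex_vector.span_induct_alt)
        case base
        show ?case by (rule exI[of _ "\<lambda>_. 0"]) simp
      next
        case (step c z u)
        then obtain a d where a: "a \<in> A" "z = x a" "u = (\<Sum>a\<in>A. d a *\<^sub>C x a)" by blast
        have "c *\<^sub>C z = (\<Sum>i\<in>A. (if i = a then c else 0) *\<^sub>C x i)"
          using insert.hyps a by (simp add: if_distrib[of "\<lambda>c. c *\<^sub>C _"] sum.delta cong: if_cong)
        then have "c *\<^sub>C z + u = (\<Sum>i\<in>A. ((if i = a then c else 0) + d i) *\<^sub>C x i)"
          using a by (simp add: scaleC_add_left sum.distrib)
        then show ?case by (rule exI[of _ "\<lambda>i. (if i = a then c else 0) + d i"])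
      qed
      then obtain c where c: "u = (\<Sum>a\<in>A. c a *\<^sub>C x a)" by blast
      define d where "d a = (if a = \<alpha> then 1 else if a \<in> A then - c a else 0)" for a
      have "(\<Sum>a\<in>half_roots. d a *\<^sub>C x a) = (\<Sum>a\<in>insert \<alpha> A. d a *\<^sub>C x a)"
        using insert finite_half_roots by (intro sum.mono_neutral_right) (auto simp: d_def)
      also have "\<dots> = d \<alpha> *\<^sub>C x \<alpha> + (\<Sum>a\<in>A. d a *\<^sub>C x a)" using insert by simp
      also have "(\<Sum>a\<in>A. d a *\<^sub>C x a) = (\<Sum>a\<in>A. - (c a *\<^sub>C x a))"
        using insert by (intro sum.cong) (auto simp: d_def)
      also have "d \<alpha> *\<^sub>C x \<alpha> + \<dots> = v" using uv(1) c by (simp add: d_def scaleC_one sum_negf)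
      finally have "d \<alpha> = 0" using zero[of d \<alpha>] uv(3) insert by simp
      then show False by (simp add: d_def)
    qed
    moreover from this have "x \<alpha> \<notin> x ` A \<union> C" using complex_vector.span_superset[of "x ` A \<union> C"] by blast
    moreover have "complex_vector.independent (x ` A \<union> C)" "card (x ` A \<union> C) = card A + card C"
      "finite (x ` A \<union> C)" using insert by blast+
    ultimately show ?case
      using insert.hyps complex_vector.independent_insertI[of "x \<alpha>" "x ` A \<union> C"] by simp
  qed
  have "card half_roots + cdim b = card (x ` half_roots \<union> C)"
    using ind[OF finite_half_roots order_refl] C(4) by simp
  also have "\<dots> = cdim (x ` half_roots \<union> C)"
    using ind[OF finite_half_roots order_refl]
    by (intro complex_vector.dim_eq_card_independent[symmetric]) blast
  also have "\<dots> \<le> cdim (UNIV :: 'g set)"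
  proof -
    obtain C' where C': "finite C'" "cspan C' = (UNIV :: 'g set)" "complex_vector.independent C'"
      using B by (rule finite_UNIV_basis)
    interpret finite_dimensional_vector_space "scaleC :: complex \<Rightarrow> 'g \<Rightarrow> 'g" C'
      by unfold_locales (use C' in auto)
    show ?thesis by (rule dim_subset) simp
  qed
  finally show ?thesis unfolding flag_dim_def b_def[symmetric] by simp
qed

subsection \<open>The real structure\<close>

text \<open>Roots take integer values on coroots, so a combination of coroots is conjugated by
  conjugating its coefficients. The induction also carries membership in \<open>h\<close>, where
  alone the roots are linear.\<close>

lemma real_structure_exists:
  assumes "x \<in> h"
  shows "\<exists>y\<in>h. \<forall>\<alpha>\<in>roots h. \<alpha> y = cnj (\<alpha> x)"
proof -
  have "x \<in> cspan (coroot h ` roots h)" using coroots_span assms by blast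
  then have "x \<in> h \<and> (\<exists>y\<in>h. \<forall>\<alpha>\<in>roots h. \<alpha> y = cnj (\<alpha> x))"
  proof (induction rule: complex_vector.span_induct_alt)
    case base
    have "\<alpha> 0 = cnj (\<alpha> 0)" if "\<alpha> \<in> roots h" for \<alpha>
      using dual_linear(3)[OF rootsD(1)[OF that]] by simp
    then show ?case using subspace_h_simps(5) by blast
  next
    case (step c z u)
    then obtain \<beta> y where \<beta>: "\<beta> \<in> roots h" "z = coroot h \<beta>" and y: "y \<in> h" "\<forall>\<alpha>\<in>roots h. \<alpha> y = cnj (\<alpha> u)"
      by blast
    have z: "z \<in> h" using \<beta> coroot_in_h by simp
    show ?case
    proof (intro conjI bexI[of _ "cnj c *\<^sub>C z + y"] ballI)
      fix \<alpha> assume \<alpha>: "\<alpha> \<in> roots h"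
      obtain n :: int where "\<alpha> z = of_int n" using root_coroot_int[OF \<beta>(1) \<alpha>] \<beta>(2) by auto
      then show "\<alpha> (cnj c *\<^sub>C z + y) = cnj (\<alpha> (c *\<^sub>C z + u))"
        using y \<alpha> z step dual_linear[OF rootsD(1)[OF \<alpha>]] by (simp add: subspace_h_simps)
    qed (use z y step in \<open>auto simp: subspace_h_simps\<close>)
  qed
  then show ?thesis by blast
qed

definition conj_h :: "'g \<Rightarrow> 'g"
  where "conj_h x = (SOME y. y \<in> h \<and> (\<forall>\<alpha>\<in>roots h. \<alpha> y = cnj (\<alpha> x)))"

lemma conj_h:
  assumes "x \<in> h"
  shows conj_h_in: "conj_h x \<in> h" and root_conj_h: "\<alpha> \<in> roots h \<Longrightarrow> \<alpha> (conj_h x) = cnj (\<alpha> x)"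
proof -
  have "\<exists>y. y \<in> h \<and> (\<forall>\<alpha>\<in>roots h. \<alpha> y = cnj (\<alpha> x))" using real_structure_exists[OF assms] by blast
  from someI_ex[OF this] show "conj_h x \<in> h" "\<alpha> \<in> roots h \<Longrightarrow> \<alpha> (conj_h x) = cnj (\<alpha> x)"
    unfolding conj_h_def by blast+
qed

lemma conj_h_simps:
  assumes "x \<in> h" "y \<in> h"
  shows "conj_h (x + y) = conj_h x + conj_h y" "conj_h (c *\<^sub>C x) = cnj c *\<^sub>C conj_h x"
    "conj_h (conj_h x) = x"
proof -
  note c = conj_h_in[OF assms(1)] conj_h_in[OF assms(2)]
  have 1: "\<alpha> (conj_h (x + y)) = \<alpha> (conj_h x + conj_h y)"
    "\<alpha> (conj_h (c *\<^sub>C x)) = \<alpha> (cnj c *\<^sub>C conj_h x)" "\<alpha> (conj_h (conj_h x)) = \<alpha> x"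
    if "\<alpha> \<in> roots h" for \<alpha>
    using assms c root_conj_h[OF _ that] dual_linear[OF rootsD(1)[OF that]] subspace_h_simps by simp_all
  show "conj_h (x + y) = conj_h x + conj_h y"
    by (rule roots_separate_eq[OF _ _ 1(1)]) (use assms c conj_h_in subspace_h_simps in auto)
  show "conj_h (c *\<^sub>C x) = cnj c *\<^sub>C conj_h x"
    by (rule roots_separate_eq[OF _ _ 1(2)]) (use assms c conj_h_in subspace_h_simps in auto)
  show "conj_h (conj_h x) = x"
    by (rule roots_separate_eq[OF _ _ 1(3)]) (use assms c conj_h_in in auto)
qed

lemma conj_h_coroot:
  assumes "\<alpha> \<in> roots h"
  shows "conj_h (coroot h \<alpha>) = coroot h \<alpha>"
proof (rule roots_separate_eq)
  fix \<beta> assume \<beta>: "\<beta> \<in> roots h"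
  obtain n :: int where "\<beta> (coroot h \<alpha>) = of_int n" by (rule root_coroot_int[OF assms \<beta>])
  then show "\<beta> (conj_h (coroot h \<alpha>)) = \<beta> (coroot h \<alpha>)"
    using root_conj_h[OF coroot_in_h[OF assms] \<beta>] by simp
qed (simp_all add: conj_h_in coroot_in_h assms)

text \<open>The identity outside \<open>dual h\<close> makes this an involution that commutes with
  the Weyl group on all functions.\<close>

definition conj_dual :: "('g \<Rightarrow> complex) \<Rightarrow> 'g \<Rightarrow> complex"
  where "conj_dual l = (if l \<in> dual h then (\<lambda>x. if x \<in> h then cnj (l (conj_h x)) else 0) else l)"

lemma conj_dual_dual: "l \<in> dual h \<Longrightarrow> conj_dual l \<in> dual h"
  unfolding conj_dual_def
  by (auto simp: dual_def conj_h_simps conj_h_in subspace_h_simps)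

lemma conj_dual_eval: "l \<in> dual h \<Longrightarrow> x \<in> h \<Longrightarrow> conj_dual l x = cnj (l (conj_h x))"
  by (simp add: conj_dual_def)

lemma conj_dual_involution: "conj_dual (conj_dual l) = l"
proof (cases "l \<in> dual h")
  case True
  then show ?thesis
    by (intro dual_eqI[of _ h]) (auto simp: conj_dual_dual conj_dual_eval conj_h_in conj_h_simps)
qed (simp add: conj_dual_def)

lemma conj_dual_reflection:
  assumes "\<alpha> \<in> roots h"
  shows "conj_dual (root_reflection h \<alpha> l) = root_reflection h \<alpha> (conj_dual l)"
proof (cases "l \<in> dual h")
  case True
  then show ?thesis
  proof (intro dual_eqI[of _ h])
    fix x assume x: "x \<in> h"
    show "conj_dual (root_reflection h \<alpha> l) x = root_reflection h \<alpha> (conj_dual l) x"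
      using True x assms root_reflection_dual[OF assms True]
      by (simp add: conj_dual_eval root_reflection_apply conj_dual_dual root_conj_h conj_h_coroot coroot_in_h)
  qed (use assms True in \<open>auto intro: conj_dual_dual root_reflection_dual\<close>)
qed (simp add: conj_dual_def root_reflection_def)

lemma conj_dual_weyl: "w \<in> weyl_group h \<Longrightarrow> conj_dual (w l) = w (conj_dual l)"
  by (induction rule: weyl_group.induct) (auto simp: conj_dual_reflection)

lemma regular_dual: "l \<in> regular h \<Longrightarrow> l \<in> dual h"
  by (simp add: regular_def)

lemma regular_conj_dual:
  assumes "l \<in> regular h"
  shows "conj_dual l \<in> regular h"
proof -
  have "w = id" if w: "w \<in> weyl_group h" "w (conj_dual l) = conj_dual l" for w
  proof -
    have "w l = l" using conj_dual_weyl[OF w(1), of l] w(2) conj_dual_involution by metis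
    then show ?thesis using assms w by (simp add: regular_def)
  qed
  then show ?thesis using assms conj_dual_dual by (simp add: regular_def)
qed

lemma regular_weyl:
  assumes "l \<in> regular h" "w \<in> weyl_group h"
  shows "w l \<in> regular h"
proof -
  have "v = id" if v: "v \<in> weyl_group h" "v (w l) = w l" for v
  proof -
    have "(inv w \<circ> v \<circ> w) l = l" using v assms by simp
    moreover have "inv w \<circ> v \<circ> w \<in> weyl_group h" using v assms weyl_inv weyl_comp by blast
    ultimately have "inv w \<circ> v \<circ> w = id" using assms by (simp add: regular_def)
    then have "w \<circ> (inv w \<circ> v \<circ> w) \<circ> inv w = id" using assms by simp
    then show ?thesis using assms by (simp add: fun_eq_iff)
  qed
  then show ?thesis using assms weyl_dual by (simp add: regular_def)
qed

text \<open>Otherwise the reflection fixes \<open>l\<close> and is the identity by regularity,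
  although it sends \<alpha> to its negative.\<close>

lemma regular_coroot_nonzero:
  assumes "l \<in> regular h" "\<alpha> \<in> roots h"
  shows "l (coroot h \<alpha>) \<noteq> 0"
proof
  assume "l (coroot h \<alpha>) = 0"
  then have "root_reflection h \<alpha> l = l" using assms by (simp add: root_reflection_apply regular_dual)
  then have "root_reflection h \<alpha> = id" using assms weyl_reflection by (simp add: regular_def)
  then have "root_reflection h \<alpha> \<alpha> = \<alpha>" by simp
  then have "\<alpha> - 2 *\<^sub>C \<alpha> = \<alpha>" using assms rootsD(1) root_coroot by (simp add: root_reflection_apply)
  then show False using assms rootsD(2) by (simp add: complex_vector.scale_eq_0_iff)
qed

end


section \<open>Polynomial functions\<close>

context cartan_pair
begin

definition monomial :: "'g list \<Rightarrow> ('g \<Rightarrow> complex) \<Rightarrow> complex"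
  where "monomial xs = (\<lambda>l. if l \<in> dual h then prod_list (map l xs) else 0)"

abbreviation linear_form :: "'g \<Rightarrow> ('g \<Rightarrow> complex) \<Rightarrow> complex"
  where "linear_form x \<equiv> monomial [x]"

lemma linear_form_eval: "l \<in> dual h \<Longrightarrow> linear_form x l = l x"
  by (simp add: monomial_def)

lemma monomial_Cons: "monomial (x # xs) = linear_form x * monomial xs"
  by (auto simp: monomial_def)

lemma monomial_Nil_eval: "l \<in> dual h \<Longrightarrow> monomial [] l = 1"
  by (simp add: monomial_def)

lemma sym_power_monomial: "sym_power h d = cspan {monomial xs |xs. set xs \<subseteq> h \<and> length xs = d}"
  by (simp add: sym_power_def monomial_def)

lemma subspace_sym_power: "csubspace (sym_power h d)"
  by (simp add: sym_power_def)

lemmas sym_power_simps = complex_vector.subspace_0[OF subspace_sym_power]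
  complex_vector.subspace_add[OF subspace_sym_power] complex_vector.subspace_diff[OF subspace_sym_power]
  complex_vector.subspace_scale[OF subspace_sym_power] complex_vector.subspace_sum[OF subspace_sym_power]

lemma monomial_in: "set xs \<subseteq> h \<Longrightarrow> length xs = d \<Longrightarrow> monomial xs \<in> sym_power h d"
  unfolding sym_power_monomial by (blast intro: complex_vector.span_base)

lemma linear_form_in: "x \<in> h \<Longrightarrow> linear_form x \<in> sym_power h 1"
  by (rule monomial_in) auto

lemma sym_power_outside: "f \<in> sym_power h d \<Longrightarrow> l \<notin> dual h \<Longrightarrow> f l = 0"
  unfolding sym_power_monomial
  by (induction rule: complex_vector.span_induct_alt) (auto simp: monomial_def)

lemma prod_list_map_scale: "prod_list (map (c *\<^sub>C l) xs) = c ^ length xs * prod_list (map l xs)" for l :: "'g \<Rightarrow> complex"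
  by (induction xs) (simp_all add: algebra_simps)

lemma sym_power_homogeneous: "f \<in> sym_power h d \<Longrightarrow> l \<in> dual h \<Longrightarrow> f (c *\<^sub>C l) = c ^ d * f l"
  unfolding sym_power_monomial
  by (induction rule: complex_vector.span_induct_alt)
    (auto simp: monomial_def prod_list_map_scale subspace_dual_simps algebra_simps)

lemma span_image_closed:
  assumes "f \<in> cspan A" "\<And>a. a \<in> A \<Longrightarrow> F a \<in> B" "csubspace B" "F 0 = 0"
    "\<And>c a b. F (c *\<^sub>C a + b) = c *\<^sub>C F a + F b"
  shows "F f \<in> B"
  using assms(1)
proof (induction rule: complex_vector.span_induct_alt)
  case base
  show ?case using assms by (simp add: complex_vector.subspace_0)
next
  case (step c x y)
  then show ?case using assms by (simp add: complex_vector.subspace_add complex_vector.subspace_scale)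
qed

lemma comp_linear:
  fixes a b :: "('g \<Rightarrow> complex) \<Rightarrow> complex"
  shows "0 \<circ> T = (0 :: ('g \<Rightarrow> complex) \<Rightarrow> complex)" "(c *\<^sub>C a + b) \<circ> T = c *\<^sub>C (a \<circ> T) + (b \<circ> T)"
  by (simp_all add: fun_eq_iff)

lemma mult_linear:
  fixes a b g :: "('g \<Rightarrow> complex) \<Rightarrow> complex"
  shows "0 * g = 0" "(c *\<^sub>C a + b) * g = c *\<^sub>C (a * g) + b * g"
    "g * 0 = 0" "g * (c *\<^sub>C a + b) = c *\<^sub>C (g * a) + g * b"
  by (simp_all add: fun_eq_iff algebra_simps)

lemma sym_power_mult:
  assumes "f \<in> sym_power h d" "g \<in> sym_power h e"
  shows "f * g \<in> sym_power h (d + e)"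
  using assms(1) unfolding sym_power_monomial[of d]
proof (rule span_image_closed[where F = "\<lambda>f. f * g"])
  fix m assume "m \<in> {monomial xs |xs. set xs \<subseteq> h \<and> length xs = d}"
  then obtain xs where xs: "m = monomial xs" "set xs \<subseteq> h" "length xs = d" by blast
  show "m * g \<in> sym_power h (d + e)"
    using assms(2) unfolding sym_power_monomial[of e]
  proof (rule span_image_closed[where F = "\<lambda>g. m * g"])
    fix m' assume "m' \<in> {monomial xs |xs. set xs \<subseteq> h \<and> length xs = e}"
    then obtain ys where ys: "m' = monomial ys" "set ys \<subseteq> h" "length ys = e" by blast
    have "m * m' = monomial (xs @ ys)" by (auto simp: xs ys monomial_def)
    also have "\<dots> \<in> sym_power h (d + e)" using xs ys by (intro monomial_in) auto
    finally show "m * m' \<in> sym_power h (d + e)" .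
  qed (simp_all add: mult_linear subspace_sym_power)
qed (simp_all add: mult_linear subspace_sym_power)

lemma linear_form_mult: "x \<in> h \<Longrightarrow> f \<in> sym_power h d \<Longrightarrow> linear_form x * f \<in> sym_power h (Suc d)"
  using sym_power_mult[OF linear_form_in] by (metis plus_1_eq_Suc)

text \<open>Precomposition with such a \<open>T\<close> sends monomials to monomials. The notion
  covers the Weyl group as well as the projections onto reflection hyperplanes, which are not
  invertible.\<close>

definition transposed :: "(('g \<Rightarrow> complex) \<Rightarrow> 'g \<Rightarrow> complex) \<Rightarrow> ('g \<Rightarrow> 'g) \<Rightarrow> bool"
  where "transposed T t \<longleftrightarrow> (\<forall>l. l \<notin> dual h \<longrightarrow> T l = l) \<and> (\<forall>l\<in>dual h. T l \<in> dual h) \<and>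
    (\<forall>x\<in>h. t x \<in> h) \<and> (\<forall>x\<in>h. \<forall>l\<in>dual h. T l x = l (t x))"

lemma weyl_transposed:
  assumes "w \<in> weyl_group h"
  shows "\<exists>t. transposed w t"
proof -
  obtain t where "\<And>x. x \<in> h \<Longrightarrow> t x \<in> h" "\<And>x l. x \<in> h \<Longrightarrow> l \<in> dual h \<Longrightarrow> w l x = l (t x)"
    using weyl_transpose[OF assms] by blast
  then have "transposed w t" using weyl_dual[OF assms] weyl_outside[OF assms] by (simp add: transposed_def)
  then show ?thesis by blast
qed

lemma monomial_transposed:
  assumes "transposed T t" "set xs \<subseteq> h"
  shows "monomial xs \<circ> T = monomial (map t xs)"
proof
  fix l
  show "(monomial xs \<circ> T) l = monomial (map t xs) l"
  proof (cases "l \<in> dual h")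
    case True
    then have "prod_list (map (T l) xs) = prod_list (map l (map t xs))"
      using assms by (intro arg_cong[of _ _ prod_list]) (auto simp: transposed_def)
    then show ?thesis using True assms by (simp add: monomial_def transposed_def)
  qed (use assms in \<open>simp add: monomial_def transposed_def\<close>)
qed

lemma sym_power_transposed:
  assumes "transposed T t" "f \<in> sym_power h d"
  shows "f \<circ> T \<in> sym_power h d"
  using assms(2) unfolding sym_power_monomial[of d]
proof (rule span_image_closed[where F = "\<lambda>f. f \<circ> T"])
  fix m assume "m \<in> {monomial xs |xs. set xs \<subseteq> h \<and> length xs = d}"
  then obtain xs where xs: "m = monomial xs" "set xs \<subseteq> h" "length xs = d" by blast
  show "m \<circ> T \<in> cspan {monomial xs |xs. set xs \<subseteq> h \<and> length xs = d}"
    unfolding xs(1) monomial_transposed[OF assms(1) xs(2)] sym_power_monomial[symmetric]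
    using assms(1) xs by (intro monomial_in) (auto simp: transposed_def)
qed (simp_all add: comp_linear)

lemma sym_power_weyl: "w \<in> weyl_group h \<Longrightarrow> f \<in> sym_power h d \<Longrightarrow> f \<circ> w \<in> sym_power h d"
  using sym_power_transposed weyl_transposed by blast

text \<open>For \<open>c = 1\<close> the map below is a reflection, for \<open>c = 1/2\<close> the projection onto its hyperplane.\<close>

definition shear :: "complex \<Rightarrow> ('g \<Rightarrow> complex) \<Rightarrow> ('g \<Rightarrow> complex) \<Rightarrow> 'g \<Rightarrow> complex"
  where "shear c \<alpha> l = (if l \<in> dual h then l - (c * l (coroot h \<alpha>)) *\<^sub>C \<alpha> else l)"

lemma shear_1: "shear 1 \<alpha> = root_reflection h \<alpha>"
  by (auto simp: shear_def root_reflection_def)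

lemma shear_transposed:
  assumes "\<alpha> \<in> roots h"
  shows "transposed (shear c \<alpha>) (\<lambda>x. x - (c * \<alpha> x) *\<^sub>C coroot h \<alpha>)"
  unfolding transposed_def
proof (intro conjI allI impI ballI)
  fix x l assume x: "x \<in> h" and l: "l \<in> dual h"
  show "shear c \<alpha> l x = l (x - (c * \<alpha> x) *\<^sub>C coroot h \<alpha>)"
    using x l coroot_in_h[OF assms] by (simp add: shear_def dual_linear subspace_h_simps)
qed (use assms rootsD(1) coroot_in_h in \<open>auto simp: shear_def subspace_dual_simps subspace_h_simps\<close>)

text \<open>The polynomials of degree \<open>d - 1\<close>, with zero for \<open>d = 0\<close>,
  where the truncated subtraction would give the constants.\<close>

primrec sym_pred :: "nat \<Rightarrow> (('g \<Rightarrow> complex) \<Rightarrow> complex) set"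
  where "sym_pred 0 = {0}" | "sym_pred (Suc d) = sym_power h d"

lemma subspace_sym_pred: "csubspace (sym_pred d)"
  by (cases d) (simp_all add: subspace_sym_power)

lemma linear_form_sym_pred: "x \<in> h \<Longrightarrow> g \<in> sym_pred d \<Longrightarrow> linear_form x * g \<in> sym_power h d"
  using linear_form_mult by (cases d) (auto simp: sym_power_simps)

text \<open>The operator \<open>f - (f \<circ> shear c \<alpha>)\<close> is a twisted derivation,
  and on the linear form of \<open>x\<close> it gives \<open>c * \<alpha> x\<close> times the linear
  form of the coroot. The product rule carries divisibility to monomials.\<close>

lemma divided_difference:
  assumes "\<alpha> \<in> roots h" "f \<in> sym_power h d"
  shows "\<exists>g\<in>sym_pred d. f - (f \<circ> shear c \<alpha>) = linear_form (coroot h \<alpha>) * g"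
  using assms(2) unfolding sym_power_monomial
proof (induction rule: complex_vector.span_induct_alt)
  case base
  have "0 - (0 \<circ> shear c \<alpha>) = linear_form (coroot h \<alpha>) * 0" by (simp add: comp_linear)
  then show ?case using complex_vector.subspace_0[OF subspace_sym_pred] by (intro bexI[of _ 0])
next
  case (step a m f)
  let ?T = "shear c \<alpha>" and ?H = "linear_form (coroot h \<alpha>)"
  have "\<exists>g\<in>sym_pred (length xs). monomial xs - (monomial xs \<circ> ?T) = ?H * g" if "set xs \<subseteq> h" for xs
    using that
  proof (induction xs)
    case Nil
    have "monomial [] - (monomial [] \<circ> ?T) = 0"
      unfolding monomial_transposed[OF shear_transposed[OF assms(1)], of "[]", simplified] by simp
    then have "monomial [] - (monomial [] \<circ> ?T) = ?H * 0" by simp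
    then show ?case by (intro bexI[of _ 0]) (assumption, simp)
  next
    case (Cons x xs)
    have "\<exists>g\<in>sym_pred (length xs). monomial xs - (monomial xs \<circ> ?T) = ?H * g"
      by (rule Cons.IH) (use Cons.prems in auto)
    then obtain g where g: "g \<in> sym_pred (length xs)" "monomial xs - (monomial xs \<circ> ?T) = ?H * g" by blast
    have x: "x \<in> h" using Cons by simp
    have mT: "monomial xs \<circ> ?T \<in> sym_power h (length xs)"
      using Cons.prems by (intro sym_power_transposed[OF shear_transposed[OF assms(1)]] monomial_in) auto
    let ?g = "linear_form x * g + (c * \<alpha> x) *\<^sub>C (monomial xs \<circ> ?T)"
    have 1: "linear_form x - (linear_form x \<circ> ?T) = (c * \<alpha> x) *\<^sub>C ?H"
    proof
      fix l
      show "(linear_form x - (linear_form x \<circ> ?T)) l = ((c * \<alpha> x) *\<^sub>C ?H) l"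
      proof (cases "l \<in> dual h")
        case True
        then have "?T l \<in> dual h" using shear_transposed[OF assms(1)] by (simp add: transposed_def)
        then show ?thesis using True by (simp add: linear_form_eval) (simp add: shear_def)
      qed (simp add: monomial_def shear_def)
    qed
    have "monomial (x # xs) - (monomial (x # xs) \<circ> ?T) =
        linear_form x * (monomial xs - (monomial xs \<circ> ?T)) + (linear_form x - (linear_form x \<circ> ?T)) * (monomial xs \<circ> ?T)"
      unfolding monomial_Cons[of x xs] by (simp add: fun_eq_iff algebra_simps)
    also have "\<dots> = ?H * ?g" unfolding g 1 by (simp add: fun_eq_iff algebra_simps)
    finally have "monomial (x # xs) - (monomial (x # xs) \<circ> ?T) = ?H * ?g" .
    moreover have "?g \<in> sym_power h (length xs)"
      using linear_form_sym_pred[OF x g(1)] mT by (intro sym_power_simps(2,4))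
    then have "?g \<in> sym_pred (length (x # xs))" by simp
    ultimately show ?case by (intro bexI[of _ ?g])
  qed
  then obtain g where g: "g \<in> sym_pred d" "m - (m \<circ> ?T) = ?H * g" using step(1) by blast
  obtain g' where g': "g' \<in> sym_pred d" "f - (f \<circ> ?T) = ?H * g'" using step(2) by blast
  have "a *\<^sub>C m + f - ((a *\<^sub>C m + f) \<circ> ?T) = a *\<^sub>C (m - (m \<circ> ?T)) + (f - (f \<circ> ?T))"
    by (simp add: fun_eq_iff algebra_simps)
  also have "\<dots> = ?H * (a *\<^sub>C g + g')" unfolding g g' by (simp add: fun_eq_iff algebra_simps)
  finally have "a *\<^sub>C m + f - ((a *\<^sub>C m + f) \<circ> ?T) = ?H * (a *\<^sub>C g + g')" .
  moreover have "a *\<^sub>C g + g' \<in> sym_pred d"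
    using g g' complex_vector.subspace_add[OF subspace_sym_pred] complex_vector.subspace_scale[OF subspace_sym_pred]
    by blast
  ultimately show ?case by (intro bexI[of _ "a *\<^sub>C g + g'"])
qed

section \<open>Polynomials, the filtration by degree, and cancellation\<close>

definition polynomials :: "(('g \<Rightarrow> complex) \<Rightarrow> complex) set"
  where "polynomials = cspan (\<Union>d. sym_power h d)"

definition sym_below :: "nat \<Rightarrow> (('g \<Rightarrow> complex) \<Rightarrow> complex) set"
  where "sym_below n = cspan (\<Union>d\<in>{..<n}. sym_power h d)"

lemma subspace_polynomials: "csubspace polynomials"
  by (simp add: polynomials_def)

lemma subspace_sym_below: "csubspace (sym_below n)"
  by (simp add: sym_below_def)

lemma sym_power_polynomials: "f \<in> sym_power h d \<Longrightarrow> f \<in> polynomials"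
  unfolding polynomials_def by (blast intro: complex_vector.span_base)

lemma sym_power_below: "f \<in> sym_power h d \<Longrightarrow> d < n \<Longrightarrow> f \<in> sym_below n"
  unfolding sym_below_def by (blast intro: complex_vector.span_base)

lemma sym_below_mono: "n \<le> m \<Longrightarrow> sym_below n \<subseteq> sym_below m"
  unfolding sym_below_def by (rule complex_vector.span_mono) force

lemma sym_below_0: "sym_below 0 = {0}"
  by (simp add: sym_below_def)

lemma polynomials_mult:
  assumes "f \<in> polynomials" "g \<in> polynomials"
  shows "f * g \<in> polynomials"
  using assms(1) unfolding polynomials_def
proof (rule span_image_closed[where F = "\<lambda>f. f * g"])
  fix a assume a: "a \<in> (\<Union>d. sym_power h d)"
  show "a * g \<in> cspan (\<Union>d. sym_power h d)"
    using assms(2) unfolding polynomials_def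
  proof (rule span_image_closed[where F = "\<lambda>g. a * g"])
    fix b assume "b \<in> (\<Union>d. sym_power h d)"
    then show "a * b \<in> cspan (\<Union>d. sym_power h d)"
      using a sym_power_mult by (blast intro: complex_vector.span_base)
  qed (simp_all add: mult_linear)
qed (simp_all add: mult_linear)

lemma span_sym_power_weyl:
  assumes "w \<in> weyl_group h" "f \<in> cspan (\<Union>d\<in>D. sym_power h d)"
  shows "f \<circ> w \<in> cspan (\<Union>d\<in>D. sym_power h d)"
  using assms(2)
proof (rule span_image_closed[where F = "\<lambda>f. f \<circ> w"])
  fix a assume "a \<in> (\<Union>d\<in>D. sym_power h d)"
  then have "a \<circ> w \<in> (\<Union>d\<in>D. sym_power h d)" using sym_power_weyl[OF assms(1)] by blast
  then show "a \<circ> w \<in> cspan (\<Union>d\<in>D. sym_power h d)" by (rule complex_vector.span_base)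
qed (simp_all add: comp_linear)

lemma polynomials_weyl: "w \<in> weyl_group h \<Longrightarrow> f \<in> polynomials \<Longrightarrow> f \<circ> w \<in> polynomials"
  unfolding polynomials_def by (rule span_sym_power_weyl)

lemma sym_below_weyl: "w \<in> weyl_group h \<Longrightarrow> f \<in> sym_below n \<Longrightarrow> f \<circ> w \<in> sym_below n"
  unfolding sym_below_def by (rule span_sym_power_weyl)

lemma polynomials_outside: "f \<in> polynomials \<Longrightarrow> l \<notin> dual h \<Longrightarrow> f l = 0"
  unfolding polynomials_def
  by (induction rule: complex_vector.span_induct_alt) (auto simp: sym_power_outside)

lemma divided_difference_span:
  assumes "\<alpha> \<in> roots h" "f \<in> cspan (\<Union>d\<in>D. sym_power h d)" "csubspace B" "\<And>d. d \<in> D \<Longrightarrow> sym_pred d \<subseteq> B"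
  shows "\<exists>g\<in>B. f - (f \<circ> root_reflection h \<alpha>) = linear_form (coroot h \<alpha>) * g"
  using assms(2)
proof (induction rule: complex_vector.span_induct_alt)
  case base
  have "0 - (0 \<circ> root_reflection h \<alpha>) = linear_form (coroot h \<alpha>) * 0" by (simp add: comp_linear)
  then show ?case using complex_vector.subspace_0[OF assms(3)] by (intro bexI[of _ 0])
next
  case (step c m f)
  let ?T = "root_reflection h \<alpha>" and ?H = "linear_form (coroot h \<alpha>)"
  obtain g where g: "g \<in> B" "m - (m \<circ> ?T) = ?H * g"
    using step(1) divided_difference[OF assms(1), of m _ 1] assms(4) unfolding shear_1 by blast
  obtain g' where g': "g' \<in> B" "f - (f \<circ> ?T) = ?H * g'" using step(2) by blast
  have "c *\<^sub>C m + f - ((c *\<^sub>C m + f) \<circ> ?T) = c *\<^sub>C (m - (m \<circ> ?T)) + (f - (f \<circ> ?T))"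
    by (simp add: fun_eq_iff algebra_simps)
  also have "\<dots> = ?H * (c *\<^sub>C g + g')" unfolding g g' by (simp add: fun_eq_iff algebra_simps)
  finally have "c *\<^sub>C m + f - ((c *\<^sub>C m + f) \<circ> ?T) = ?H * (c *\<^sub>C g + g')" .
  moreover have "c *\<^sub>C g + g' \<in> B"
    using g g' complex_vector.subspace_add[OF assms(3)] complex_vector.subspace_scale[OF assms(3)] by blast
  ultimately show ?case by (intro bexI[of _ "c *\<^sub>C g + g'"])
qed

lemma divided_difference_polynomials:
  assumes "\<alpha> \<in> roots h" "f \<in> polynomials"
  shows "\<exists>g\<in>polynomials. f - (f \<circ> root_reflection h \<alpha>) = linear_form (coroot h \<alpha>) * g"
proof (rule divided_difference_span[OF assms(1) _ subspace_polynomials])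
  show "f \<in> cspan (\<Union>d\<in>UNIV. sym_power h d)" using assms(2) by (simp add: polynomials_def)
  show "sym_pred d \<subseteq> polynomials" for d
    using sym_power_polynomials complex_vector.subspace_0[OF subspace_polynomials] by (cases d) auto
qed

lemma divided_difference_below:
  assumes "\<alpha> \<in> roots h" "f \<in> sym_below (Suc n)"
  shows "\<exists>g\<in>sym_below n. f - (f \<circ> root_reflection h \<alpha>) = linear_form (coroot h \<alpha>) * g"
proof (rule divided_difference_span[OF assms(1) _ subspace_sym_below])
  show "f \<in> cspan (\<Union>d\<in>{..<Suc n}. sym_power h d)" using assms(2) by (simp add: sym_below_def)
  show "sym_pred d \<subseteq> sym_below n" if "d \<in> {..<Suc n}" for d
    using that sym_power_below complex_vector.subspace_0[OF subspace_sym_below] by (cases d) auto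
qed

lemma polynomials_on_lines:
  assumes "f \<in> polynomials" "l \<in> dual h" "m \<in> dual h"
  shows "\<exists>P. \<forall>t. f (l + t *\<^sub>C m) = poly P t"
  using assms(1) unfolding polynomials_def
proof (induction rule: complex_vector.span_induct_alt)
  case base
  show ?case by (rule exI[of _ 0]) simp
next
  case (step c g f)
  then obtain d where "g \<in> cspan {monomial xs |xs. set xs \<subseteq> h \<and> length xs = d}"
    unfolding sym_power_monomial by blast
  then have "\<exists>P. \<forall>t. g (l + t *\<^sub>C m) = poly P t"
  proof (induction rule: complex_vector.span_induct_alt)
    case base
    show ?case by (rule exI[of _ 0]) simp
  next
    case (step c u g)
    then obtain xs where xs: "u = monomial xs" by blast
    have "\<exists>P. \<forall>t. prod_list (map (l + t *\<^sub>C m) xs) = poly P t"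
    proof (induction xs)
      case Nil
      show ?case by (rule exI[of _ 1]) simp
    next
      case (Cons x xs)
      then obtain P where P: "\<And>t. prod_list (map (l + t *\<^sub>C m) xs) = poly P t" by blast
      show ?case
      proof (intro exI[of _ "[:l x, m x:] * P"] allI)
        fix t
        have "prod_list (map (l + t *\<^sub>C m) (x # xs)) = (l + t *\<^sub>C m) x * prod_list (map (l + t *\<^sub>C m) xs)"
          by (simp only: list.map prod_list.Cons)
        also have "\<dots> = (l x + t * m x) * poly P t"
          by (simp only: P plus_fun_apply scaleC_fun_apply scaleC_complex)
        also have "\<dots> = poly ([:l x, m x:] * P) t" by (simp add: algebra_simps)
        finally show "prod_list (map (l + t *\<^sub>C m) (x # xs)) = poly ([:l x, m x:] * P) t" .
      qed
    qed
    then obtain P where P: "\<And>t. prod_list (map (l + t *\<^sub>C m) xs) = poly P t" by blast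
    have uP: "u (l + t *\<^sub>C m) = poly P t" for t
    proof -
      have "l + t *\<^sub>C m \<in> dual h" using assms by (simp add: subspace_dual_simps)
      then show ?thesis by (simp only: xs monomial_def if_True P)
    qed
    obtain Q where Q: "\<And>t. g (l + t *\<^sub>C m) = poly Q t" using step(2) by blast
    have "(c *\<^sub>C u + g) (l + t *\<^sub>C m) = poly (smult c P + Q) t" for t
      by (simp only: plus_fun_apply scaleC_fun_apply scaleC_complex uP Q poly_add poly_smult)
    then show ?case by blast
  qed
  then obtain P where P: "\<And>t. g (l + t *\<^sub>C m) = poly P t" by blast
  obtain Q where Q: "\<And>t. f (l + t *\<^sub>C m) = poly Q t" using step(2) by blast
  have "(c *\<^sub>C g + f) (l + t *\<^sub>C m) = poly (smult c P + Q) t" for t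
    by (simp only: plus_fun_apply scaleC_fun_apply scaleC_complex P Q poly_add poly_smult)
  then show ?case by blast
qed

text \<open>Through any point there is a line in the direction of a root not vanishing on
  \<open>x\<close>. The linear form has one zero on it, so \<open>f\<close> restricts to a
  polynomial in one variable with infinitely many zeros.\<close>

lemma linear_form_cancel:
  assumes "x \<in> h" "x \<noteq> 0" "f \<in> polynomials" "linear_form x * f = 0"
  shows "f = 0"
proof
  fix l
  show "f l = 0 l"
  proof (cases "l \<in> dual h")
    case True
    obtain \<alpha> where \<alpha>: "\<alpha> \<in> roots h" "\<alpha> x \<noteq> 0" using roots_separate assms by blast
    then have d: "\<alpha> \<in> dual h" by (simp add: rootsD)
    obtain P where P: "\<And>t. f (l + t *\<^sub>C \<alpha>) = poly P t"
      using polynomials_on_lines[OF assms(3) True d] by blast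
    have "poly P t = 0" if "t \<noteq> - l x / \<alpha> x" for t
    proof -
      have "l + t *\<^sub>C \<alpha> \<in> dual h" using True d by (simp add: subspace_dual_simps)
      moreover have "(l + t *\<^sub>C \<alpha>) x \<noteq> 0" using that \<alpha> by (simp add: field_simps add_eq_0_iff)
      ultimately have "f (l + t *\<^sub>C \<alpha>) = 0"
        using fun_cong[OF assms(4), of "l + t *\<^sub>C \<alpha>"] by (simp add: linear_form_eval)
      then show ?thesis using P by simp
    qed
    then have "- {- l x / \<alpha> x} \<subseteq> {t. poly P t = 0}" by blast
    moreover have "infinite (- {- l x / \<alpha> x})" by (simp add: infinite_UNIV_char_0)
    ultimately have "P = 0" using poly_roots_finite finite_subset by blast
    then show ?thesis using P[of 0] by simp
  qed (use assms polynomials_outside in simp)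
qed

text \<open>Scaling the argument by \<open>c\<close> turns the sum into a polynomial in
  \<open>c\<close> that vanishes identically; its coefficients are the values of the
  components.\<close>

lemma homogeneous_components_unique:
  assumes "finite A" "\<And>k. k \<in> A \<Longrightarrow> u k \<in> sym_power h k" "sum u A = 0" "k \<in> A"
  shows "u k = 0"
proof
  fix l
  show "u k l = 0 l"
  proof (cases "l \<in> dual h")
    case True
    define P where "P = (\<Sum>k\<in>A. monom (u k l) k)"
    have "poly P c = 0" for c
    proof -
      have "poly P c = (\<Sum>k\<in>A. u k (c *\<^sub>C l))"
        unfolding P_def poly_sum poly_monom
        by (rule sum.cong[OF refl]) (use sym_power_homogeneous[OF assms(2) True] in \<open>simp add: mult.commute\<close>)
      also have "\<dots> = sum u A (c *\<^sub>C l)" by (simp add: sum_fun_apply)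
      finally show ?thesis using assms(3) by simp
    qed
    then have "P = 0" using poly_all_0_iff_0 by blast
    then have "coeff P k = 0" by simp
    then show ?thesis using assms(1,4) by (simp add: P_def coeff_sum)
  qed (use assms sym_power_outside in auto)
qed


section \<open>The coinvariant ideal\<close>

lemma sym_degree_even: "sym_degree h (2 * int d) = sym_power h d"
  by (simp add: sym_degree_def)

lemma sym_degree_cases:
  obtains d where "k = 2 * int d" "sym_degree h k = sym_power h d" | "sym_degree h k = {0}"
proof (cases "0 \<le> k \<and> even k")
  case True
  then have "k = 2 * int (nat (k div 2))" by auto
  then show thesis using that(1)[of "nat (k div 2)"] True by (simp add: sym_degree_def)
next
  case False
  then have "sym_degree h k = {0}" by (auto simp: sym_degree_def)
  then show thesis by (rule that(2))
qed

lemma span_sym_degree: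
  "cspan (\<Union>k\<in>K. sym_degree h k) = cspan (\<Union>d\<in>{d. 2 * int d \<in> K}. sym_power h d)"
proof (rule antisym)
  show "cspan (\<Union>k\<in>K. sym_degree h k) \<subseteq> cspan (\<Union>d\<in>{d. 2 * int d \<in> K}. sym_power h d)"
  proof (intro complex_vector.span_minimal complex_vector.subspace_span subsetI)
    fix f assume "f \<in> (\<Union>k\<in>K. sym_degree h k)"
    then obtain k where k: "k \<in> K" "f \<in> sym_degree h k" by blast
    show "f \<in> cspan (\<Union>d\<in>{d. 2 * int d \<in> K}. sym_power h d)"
    proof (cases rule: sym_degree_cases[of k])
      case (1 d)
      then show ?thesis using k by (intro complex_vector.span_base) auto
    next
      case 2
      then show ?thesis using k by (simp add: complex_vector.span_zero)
    qed
  qed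
  show "cspan (\<Union>d\<in>{d. 2 * int d \<in> K}. sym_power h d) \<subseteq> cspan (\<Union>k\<in>K. sym_degree h k)"
    using sym_degree_even by (intro complex_vector.span_mono) blast
qed

lemma sym_algebra_polynomials: "sym_algebra h = polynomials"
  using span_sym_degree[of UNIV] by (simp add: sym_algebra_def polynomials_def)

lemma positive_invariants_eq:
  "positive_invariants h = {f \<in> cspan (\<Union>d\<in>{0<..}. sym_power h d). \<forall>w\<in>weyl_group h. f \<circ> w = f}"
proof -
  have "{d. 2 * int d \<in> {0<..}} = {0<..}" by auto
  then show ?thesis unfolding positive_invariants_def span_sym_degree by simp
qed

lemma subspace_coinvariant_ideal: "csubspace (coinvariant_ideal h)"
  by (simp add: coinvariant_ideal_def)

lemmas coinvariant_ideal_simps = complex_vector.subspace_0[OF subspace_coinvariant_ideal]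
  complex_vector.subspace_add[OF subspace_coinvariant_ideal] complex_vector.subspace_diff[OF subspace_coinvariant_ideal]
  complex_vector.subspace_scale[OF subspace_coinvariant_ideal] complex_vector.subspace_sum[OF subspace_coinvariant_ideal]
  complex_vector.subspace_neg[OF subspace_coinvariant_ideal]

lemma positive_invariants_polynomials: "positive_invariants h \<subseteq> polynomials"
  unfolding positive_invariants_eq polynomials_def
  using complex_vector.span_mono[of "\<Union>d\<in>{0<..}. sym_power h d" "\<Union>d. sym_power h d"] by blast

lemma coinvariant_ideal_polynomials: "coinvariant_ideal h \<subseteq> polynomials"
  unfolding coinvariant_ideal_def sym_algebra_polynomials
  using polynomials_mult positive_invariants_polynomials
  by (intro complex_vector.span_minimal subspace_polynomials) blast

lemma coinvariant_ideal_mult: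
  assumes "g \<in> polynomials" "f \<in> coinvariant_ideal h"
  shows "g * f \<in> coinvariant_ideal h"
  using assms(2) unfolding coinvariant_ideal_def sym_algebra_polynomials
proof (rule span_image_closed[where F = "\<lambda>f. g * f"])
  fix a assume "a \<in> {g * f |g f. g \<in> polynomials \<and> f \<in> positive_invariants h}"
  then obtain g' f' where a: "a = g' * f'" "g' \<in> polynomials" "f' \<in> positive_invariants h" by blast
  have "g * a = (g * g') * f'" by (simp add: a mult.assoc)
  then show "g * a \<in> cspan {g * f |g f. g \<in> polynomials \<and> f \<in> positive_invariants h}"
    using a polynomials_mult[OF assms(1)] by (blast intro: complex_vector.span_base)
qed (simp_all add: mult_linear)

lemma positive_invariant_in_ideal:
  assumes "f \<in> sym_power h d" "d > 0" "\<And>w. w \<in> weyl_group h \<Longrightarrow> f \<circ> w = f"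
  shows "f \<in> coinvariant_ideal h"
proof -
  have "f \<in> positive_invariants h"
    unfolding positive_invariants_eq using assms by (blast intro: complex_vector.span_base)
  moreover have "monomial [] \<in> polynomials" by (rule sym_power_polynomials[OF monomial_in]) auto
  moreover have "f = monomial [] * f" using sym_power_outside[OF assms(1)] by (auto simp: monomial_def)
  ultimately show ?thesis
    unfolding coinvariant_ideal_def sym_algebra_polynomials by (blast intro: complex_vector.span_base)
qed

lemma coinvariant_ideal_weyl:
  assumes "w \<in> weyl_group h" "f \<in> coinvariant_ideal h"
  shows "f \<circ> w \<in> coinvariant_ideal h"
  using assms(2) unfolding coinvariant_ideal_def sym_algebra_polynomials
proof (rule span_image_closed[where F = "\<lambda>f. f \<circ> w"])
  fix a assume "a \<in> {g * f |g f. g \<in> polynomials \<and> f \<in> positive_invariants h}"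
  then obtain g f where a: "a = g * f" "g \<in> polynomials" "f \<in> positive_invariants h" by blast
  have "a \<circ> w = (g \<circ> w) * (f \<circ> w)" by (simp add: a fun_eq_iff)
  also have "f \<circ> w = f" using a assms(1) by (simp add: positive_invariants_def)
  finally show "a \<circ> w \<in> cspan {g * f |g f. g \<in> polynomials \<and> f \<in> positive_invariants h}"
    using a polynomials_weyl[OF assms(1)] by (blast intro: complex_vector.span_base)
qed (simp_all add: comp_linear)

text \<open>Telescoping along a word in the reflections; the ideal is stable under the
  group.\<close>

lemma difference_weyl_in_ideal:
  assumes "\<And>\<alpha>. \<alpha> \<in> roots h \<Longrightarrow> f - (f \<circ> root_reflection h \<alpha>) \<in> coinvariant_ideal h" "w \<in> weyl_group h"
  shows "f - (f \<circ> w) \<in> coinvariant_ideal h"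
  using assms(2)
proof (induction rule: weyl_group.induct)
  case id
  show "f - (f \<circ> id) \<in> coinvariant_ideal h" by (simp add: coinvariant_ideal_simps)
next
  case (reflection \<alpha> w)
  have "f - (f \<circ> (root_reflection h \<alpha> \<circ> w)) = (f - (f \<circ> w)) + ((f - (f \<circ> root_reflection h \<alpha>)) \<circ> w)"
    by (simp add: fun_eq_iff)
  then show "f - (f \<circ> (root_reflection h \<alpha> \<circ> w)) \<in> coinvariant_ideal h"
    using reflection assms(1) coinvariant_ideal_weyl by (simp only: coinvariant_ideal_simps(2))
qed

text \<open>Modulo the ideal, \<open>f\<close> equals its average over the Weyl group, and this
  average is an invariant of positive degree.\<close>

lemma in_ideal_by_differences:
  assumes "f \<in> sym_power h d" "d > 0"
    and "\<And>\<alpha>. \<alpha> \<in> roots h \<Longrightarrow> f - (f \<circ> root_reflection h \<alpha>) \<in> coinvariant_ideal h"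
  shows "f \<in> coinvariant_ideal h"
proof -
  let ?n = "of_nat (card (weyl_group h)) :: complex"
  define a where "a = (\<Sum>w\<in>weyl_group h. f \<circ> w)"
  have "a \<circ> v = a" if v: "v \<in> weyl_group h" for v
  proof -
    have "a \<circ> v = (\<Sum>w\<in>weyl_group h. f \<circ> (w \<circ> v))" by (simp add: a_def fun_eq_iff sum_fun_apply)
    then show ?thesis using sum_weyl_right[OF v, of "\<lambda>w. f \<circ> w"] by (simp add: a_def)
  qed
  moreover have "a \<in> sym_power h d"
    unfolding a_def using sym_power_weyl assms(1) by (intro sym_power_simps) auto
  ultimately have "a \<in> coinvariant_ideal h" using positive_invariant_in_ideal assms(2) by blast
  moreover have "(\<Sum>w\<in>weyl_group h. f - (f \<circ> w)) \<in> coinvariant_ideal h"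
    using difference_weyl_in_ideal[OF assms(3)] by (intro complex_vector.subspace_sum[OF subspace_coinvariant_ideal])
  moreover have "?n *\<^sub>C f = (\<Sum>w\<in>weyl_group h. f - (f \<circ> w)) + a"
    by (simp add: fun_eq_iff sum_subtractf a_def sum_fun_apply)
  ultimately have "?n *\<^sub>C f \<in> coinvariant_ideal h" by (simp add: coinvariant_ideal_simps)
  then have "inverse ?n *\<^sub>C (?n *\<^sub>C f) \<in> coinvariant_ideal h" by (rule coinvariant_ideal_simps)
  then show ?thesis using card_weyl_nonzero by simp
qed

text \<open>The divided differences \<open>g\<close> of \<open>f\<close> and \<open>r\<close> of
  \<open>q\<close> again agree on the orbit, one degree lower, so \<open>g\<close> lies in the ideal
  by induction. Hence \<open>f\<close> is invariant under reflections modulo the ideal, and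
  \<open>in_ideal_by_differences\<close> applies.\<close>

lemma leading_form_in_ideal:
  assumes "l \<in> regular h" "f \<in> sym_power h d" "q \<in> sym_below d"
    and "\<And>w. w \<in> weyl_group h \<Longrightarrow> f (w l) = q (w l)"
  shows "f \<in> coinvariant_ideal h"
  using assms(2-)
proof (induction d arbitrary: f q)
  \<comment> \<open>There is only the zero function below degree 0, so the constant \<open>f\<close>
    vanishes at \<open>l\<close>.\<close>
  case 0
  have l: "l \<in> dual h" using assms(1) by (rule regular_dual)
  have "{monomial xs |xs. set xs \<subseteq> h \<and> length xs = 0} = {monomial []}" by auto
  then obtain k where k: "f = k *\<^sub>C monomial []"
    using 0(1) unfolding sym_power_monomial by (auto simp: complex_vector.span_singleton)
  have "f l = k" using l by (simp add: k monomial_Nil_eval)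
  moreover have "f l = 0" using 0(3)[OF weyl_group.id] 0(2) by (simp add: sym_below_0)
  ultimately have "k = 0" by (rule trans[OF sym])
  then have "f = 0" by (simp add: k)
  then show "f \<in> coinvariant_ideal h" by (simp add: coinvariant_ideal_simps)
next
  case (Suc d)
  have "f - (f \<circ> root_reflection h \<alpha>) \<in> coinvariant_ideal h" if \<alpha>: "\<alpha> \<in> roots h" for \<alpha>
  proof -
    let ?s = "root_reflection h \<alpha>" and ?H = "linear_form (coroot h \<alpha>)"
    obtain g where g: "g \<in> sym_power h d" "f - (f \<circ> ?s) = ?H * g"
      using divided_difference[OF \<alpha> Suc.prems(1), of 1] unfolding shear_1 sym_pred.simps by blast
    obtain r where r: "r \<in> sym_below d" "q - (q \<circ> ?s) = ?H * r"
      using divided_difference_below[OF \<alpha> Suc.prems(2)] by blast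
    have "g (w l) = r (w l)" if w: "w \<in> weyl_group h" for w
    proof -
      \<comment> \<open>By regularity the coroot does not vanish at \<open>w l\<close> and can be
        cancelled from both divided differences.\<close>
      have wl: "w l \<in> regular h" by (rule regular_weyl[OF assms(1) w])
      have "(f - (f \<circ> ?s)) (w l) = (q - (q \<circ> ?s)) (w l)"
        using Suc.prems(3)[OF w] Suc.prems(3)[OF weyl_comp[OF weyl_reflection[OF \<alpha>] w]] by simp
      then have "w l (coroot h \<alpha>) * g (w l) = w l (coroot h \<alpha>) * r (w l)"
        unfolding g r using linear_form_eval[OF regular_dual[OF wl]] by simp
      then show ?thesis using regular_coroot_nonzero[OF wl \<alpha>] by simp
    qed
    then have "g \<in> coinvariant_ideal h" using Suc.IH g(1) r(1) by blast
    then show ?thesis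
      unfolding g using coroot_in_h[OF \<alpha>]
      by (intro coinvariant_ideal_mult sym_power_polynomials[OF linear_form_in])
  qed
  then show ?case using in_ideal_by_differences[OF Suc.prems(1)] by blast
qed

text \<open>An invariant is constant on the orbit. So a product of a form of degree \<open>j\<close>
  with an invariant form of degree \<open>k > 0\<close> agrees there with a scalar multiple of the
  first factor, of degree \<open>j < j + k\<close>.\<close>

lemma ideal_lower_on_orbit:
  assumes "l \<in> dual h" "f \<in> sym_power h d" "f \<in> coinvariant_ideal h"
  shows "\<exists>q\<in>sym_below d. \<forall>w\<in>weyl_group h. f (w l) = q (w l)"
proof -
  define L where "L k = {p \<in> sym_power h k. \<exists>q\<in>sym_below k. \<forall>w\<in>weyl_group h. p (w l) = q (w l)}" for k
  have L: "csubspace (L k)" for k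
  proof (rule complex_vector.subspaceI)
    have "0 \<in> sym_below k" by (rule complex_vector.subspace_0[OF subspace_sym_below])
    then show "0 \<in> L k" unfolding L_def using sym_power_simps(1) by blast
  next
    fix a b assume ab: "a \<in> L k" "b \<in> L k"
    then obtain p q where "p \<in> sym_below k" "\<forall>w\<in>weyl_group h. a (w l) = p (w l)"
      "q \<in> sym_below k" "\<forall>w\<in>weyl_group h. b (w l) = q (w l)" by (auto simp: L_def)
    then have "p + q \<in> sym_below k" "\<forall>w\<in>weyl_group h. (a + b) (w l) = (p + q) (w l)"
      using complex_vector.subspace_add[OF subspace_sym_below] by auto
    then show "a + b \<in> L k" using ab sym_power_simps(2) unfolding L_def by blast
  next
    fix c a assume a: "a \<in> L k"
    then obtain p where "p \<in> sym_below k" "\<forall>w\<in>weyl_group h. a (w l) = p (w l)" by (auto simp: L_def)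
    then have "c *\<^sub>C p \<in> sym_below k" "\<forall>w\<in>weyl_group h. (c *\<^sub>C a) (w l) = (c *\<^sub>C p) (w l)"
      using complex_vector.subspace_scale[OF subspace_sym_below] by auto
    then show "c *\<^sub>C a \<in> L k" using a sym_power_simps(4) unfolding L_def by blast
  qed
  have "{g * f |g f. g \<in> polynomials \<and> f \<in> positive_invariants h} \<subseteq> cspan (\<Union>k. L k)"
  proof clarify
    fix g f assume g: "g \<in> polynomials" and f: "f \<in> positive_invariants h"
    obtain A u where A: "finite A" "\<And>j. j \<in> A \<Longrightarrow> u j \<in> sym_power h j" "g = sum u A"
      using g subspace_sym_power unfolding polynomials_def
      by (rule span_UN_sum[where I = UNIV and V = "sym_power h"]) (rule that)
    have "f \<in> cspan (\<Union>d\<in>{0<..}. sym_power h d)" using f unfolding positive_invariants_eq by blast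
    then obtain B v where B: "finite B" "B \<subseteq> {0<..}" "\<And>k. k \<in> B \<Longrightarrow> v k \<in> sym_power h k" "f = sum v B"
      using subspace_sym_power by (rule span_UN_sum[where V = "sym_power h"]) (rule that)
    \<comment> \<open>The homogeneous components of an invariant are invariant, because the group
      preserves degrees and components are unique.\<close>
    have inv: "v k \<circ> w = v k" if k: "k \<in> B" and w: "w \<in> weyl_group h" for k w
    proof -
      have "(\<lambda>k. (v k \<circ> w) - v k) k = 0"
      proof (rule homogeneous_components_unique[OF B(1) _ _ k])
        show "(v k \<circ> w) - v k \<in> sym_power h k" if "k \<in> B" for k
          using B(3)[OF that] sym_power_weyl[OF w] by (intro sym_power_simps)
        have "(f \<circ> w) - f = 0" using f w by (simp add: positive_invariants_def)
        moreover have "f \<circ> w = (\<Sum>k\<in>B. v k \<circ> w)" by (simp add: B(4) fun_eq_iff sum_fun_apply)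
        ultimately show "(\<Sum>k\<in>B. (v k \<circ> w) - v k) = 0" by (simp add: sum_subtractf B(4))
      qed
      then show ?thesis by simp
    qed
    have "u j * v k \<in> L (j + k)" if j: "j \<in> A" and k: "k \<in> B" for j k
    proof -
      have "v k l *\<^sub>C u j \<in> sym_below (j + k)"
        using sym_power_below[OF A(2)[OF j]] B(2) k complex_vector.subspace_scale[OF subspace_sym_below] by force
      moreover have "(u j * v k) (w l) = (v k l *\<^sub>C u j) (w l)" if "w \<in> weyl_group h" for w
        using fun_cong[OF inv[OF k that], of l] by simp
      ultimately show ?thesis using sym_power_mult[OF A(2)[OF j] B(3)[OF k]] unfolding L_def by blast
    qed
    then have "(\<Sum>j\<in>A. \<Sum>k\<in>B. u j * v k) \<in> cspan (\<Union>k. L k)"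
      by (intro complex_vector.span_sum complex_vector.span_base) blast
    then show "g * f \<in> cspan (\<Union>k. L k)" by (simp add: A(3) B(4) sum_product)
  qed
  then have "coinvariant_ideal h \<subseteq> cspan (\<Union>k. L k)"
    unfolding coinvariant_ideal_def sym_algebra_polynomials by (rule complex_vector.span_minimal) simp
  then have "f \<in> cspan (\<Union>k. L k)" using assms(3) by blast
  then obtain A u where A: "finite A" "\<And>j. j \<in> A \<Longrightarrow> u j \<in> L j" "f = sum u A"
    using L by (rule span_UN_sum[where I = UNIV and V = L]) (rule that)
  \<comment> \<open>The differences between the components \<open>u\<close> and those of
    \<open>f\<close>, which is homogeneous of degree \<open>d\<close>. Uniqueness makes the
    component of degree \<open>d\<close> equal to \<open>f\<close>.\<close>
  define v where "v k = (if k \<in> A then u k else 0) - (if k = d then f else 0)" for k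
  have "v d = 0"
  proof (rule homogeneous_components_unique[of "insert d A"])
    show "v k \<in> sym_power h k" if "k \<in> insert d A" for k
      using assms(2) A(2) unfolding v_def L_def by (intro sym_power_simps(3)) (auto simp: sym_power_simps)
    have "sum v (insert d A) = (\<Sum>k\<in>insert d A. if k \<in> A then u k else 0) - (\<Sum>k\<in>insert d A. if k = d then f else 0)"
      unfolding sum_subtractf[symmetric] by (rule sum.cong[OF refl]) (rule v_def)
    also have "(\<Sum>k\<in>insert d A. if k \<in> A then u k else 0) = sum u A"
      using A(1) by (intro sum.mono_neutral_cong_right) auto
    also have "(\<Sum>k\<in>insert d A. if k = d then f else 0) = f"
      using A(1) by (subst sum.delta) auto
    also have "sum u A - f = 0" using A(3) by simp
    finally show "sum v (insert d A) = 0" .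
  qed (use A in auto)
  then have "f \<in> L d" using A(2)[of d] complex_vector.subspace_0[OF L] by (auto simp: v_def split: if_splits)
  then show ?thesis by (simp add: L_def)
qed

end


section \<open>The top degree of the coinvariant algebra\<close>

context cartan_pair
begin

section \<open>Interpolation on a regular orbit and a crude degree bound\<close>

lemma linear_form_mult_below:
  assumes "x \<in> h" "f \<in> sym_below n"
  shows "linear_form x * f \<in> sym_below (Suc n)"
  using assms(2) unfolding sym_below_def[of n]
proof (rule span_image_closed[where F = "\<lambda>f. linear_form x * f"])
  fix a assume "a \<in> (\<Union>d\<in>{..<n}. sym_power h d)"
  then show "linear_form x * a \<in> sym_below (Suc n)"
    using linear_form_mult[OF assms(1)] by (auto intro: sym_power_below)
qed (simp_all add: mult_linear subspace_sym_below)

text \<open>A Lagrange polynomial: for each \<open>w\<close> other than the identity, one affine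
  factor that is 0 at \<open>w l\<close> and 1 at \<open>l\<close>.\<close>

lemma separating_polynomial:
  assumes l: "l \<in> regular h"
  obtains n e where "e \<in> sym_below n" "e l = 1" "\<And>w. w \<in> weyl_group h \<Longrightarrow> w \<noteq> id \<Longrightarrow> e (w l) = 0"
proof -
  have ld: "l \<in> dual h" using l by (rule regular_dual)
  have "\<exists>n. \<exists>e\<in>sym_below n. e l = 1 \<and> (\<forall>w\<in>A. e (w l) = 0)" if "finite A" "A \<subseteq> weyl_group h - {id}" for A
    using that
  proof (induction A)
    case empty
    have "monomial [] \<in> sym_below 1" by (rule sym_power_below[OF monomial_in[where d = 0]]) auto
    then show ?case using monomial_Nil_eval[OF ld] by (intro exI[of _ 1] bexI[of _ "monomial []"]) auto
  next
    case (insert w A)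
    then obtain n e where e: "e \<in> sym_below n" "e l = 1" "\<forall>w\<in>A. e (w l) = 0" by auto
    have w: "w \<in> weyl_group h" "w \<noteq> id" using insert by auto
    then have "w l \<noteq> l" using l by (auto simp: regular_def)
    then obtain x where x: "x \<in> h" "w l x \<noteq> l x"
      using dual_eqI[OF weyl_dual[OF w(1) ld] ld] by blast
    define e' where "e' = inverse (l x - w l x) *\<^sub>C (linear_form x * e - w l x *\<^sub>C e)"
    have val: "e' m = inverse (l x - w l x) * (m x - w l x) * e m" if "m \<in> dual h" for m
      using that by (simp add: e'_def linear_form_eval algebra_simps)
    have "e' \<in> sym_below (Suc n)"
      unfolding e'_def
      using linear_form_mult_below[OF x(1) e(1)] e(1) sym_below_mono[of n "Suc n"]
      by (intro complex_vector.subspace_scale[OF subspace_sym_below] complex_vector.subspace_diff[OF subspace_sym_below]) auto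
    moreover have "e' l = 1" using val[OF ld] e(2) x(2) by simp
    moreover have "e' (v l) = 0" if "v \<in> insert w A" for v
    proof -
      have "v l \<in> dual h" using that insert.prems weyl_dual ld by blast
      then show ?thesis using val[of "v l"] e(3) that by auto
    qed
    ultimately show ?case by blast
  qed
  from this[of "weyl_group h - {id}"] obtain n e where
    e: "e \<in> sym_below n" "e l = 1" "\<forall>w\<in>weyl_group h - {id}. e (w l) = 0"
    using finite_weyl by blast
  show thesis by (rule that[OF e(1,2)]) (use e(3) in blast)
qed

text \<open>The translates of the separating polynomial are a Lagrange basis on the orbit. The
  degree bound \<open>n\<close> is independent of the prescribed values.\<close>

lemma orbit_interpolation:
  assumes "l \<in> regular h"
  obtains n where "\<And>v. \<exists>q\<in>sym_below n. \<forall>w\<in>weyl_group h. q (w l) = v w"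
proof -
  obtain n e where e: "e \<in> sym_below n" "e l = 1" "\<And>w. w \<in> weyl_group h \<Longrightarrow> w \<noteq> id \<Longrightarrow> e (w l) = 0"
    by (rule separating_polynomial[OF assms]) (rule that)
  have "\<exists>q\<in>sym_below n. \<forall>w\<in>weyl_group h. q (w l) = v w" for v
  proof -
    define q where "q = (\<Sum>u\<in>weyl_group h. v u *\<^sub>C (e \<circ> inv u))"
    have "q \<in> sym_below n"
      unfolding q_def
      by (intro complex_vector.subspace_sum[OF subspace_sym_below] complex_vector.subspace_scale[OF subspace_sym_below]
          sym_below_weyl weyl_inv e(1))
    moreover have "q (w l) = v w" if w: "w \<in> weyl_group h" for w
    proof -
      have *: "e (inv u (w l)) = (if u = w then 1 else 0)" if u: "u \<in> weyl_group h" for u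
      proof (cases "u = w")
        case True
        then show ?thesis using e(2) u by simp
      next
        case False
        have "inv u \<circ> w \<noteq> id"
        proof
          assume *: "inv u \<circ> w = id"
          have "w = u \<circ> (inv u \<circ> w)" using weyl_inv_apply(2)[OF u] by (simp add: fun_eq_iff)
          also have "\<dots> = u" unfolding * by simp
          finally show False using False by simp
        qed
        then show ?thesis using e(3)[OF weyl_comp[OF weyl_inv[OF u] w]] False by simp
      qed
      have "q (w l) = (\<Sum>u\<in>weyl_group h. v u * e (inv u (w l)))"
        by (simp add: q_def sum_fun_apply)
      also have "\<dots> = (\<Sum>u\<in>weyl_group h. if u = w then v u else 0)"
        by (rule sum.cong[OF refl]) (simp add: *)
      also have "\<dots> = v w" using w finite_weyl by simp
      finally show ?thesis .
    qed
    ultimately show ?thesis by blast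
  qed
  then show thesis by (rule that)
qed

text \<open>From degree \<open>n\<close> on, a form agrees on the orbit with an interpolating
  polynomial of lower degree. The bound guarantees that \<open>top_degree\<close> can speak of the
  largest degree not contained in the ideal.\<close>

lemma high_degree_in_ideal:
  assumes "l \<in> regular h"
  obtains n where "\<And>d. d \<ge> n \<Longrightarrow> sym_power h d \<subseteq> coinvariant_ideal h"
proof -
  obtain n where n: "\<And>v. \<exists>q\<in>sym_below n. \<forall>w\<in>weyl_group h. q (w l) = v w"
    by (rule orbit_interpolation[OF assms]) (rule that)
  have "f \<in> coinvariant_ideal h" if "d \<ge> n" "f \<in> sym_power h d" for d f
  proof -
    obtain q where q: "q \<in> sym_below n" "\<forall>w\<in>weyl_group h. q (w l) = f (w l)"
      using n[of "\<lambda>w. f (w l)"] by blast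
    then have "q \<in> sym_below d" using sym_below_mono[OF that(1)] by blast
    then show ?thesis using leading_form_in_ideal[OF assms that(2)] q(2) by simp
  qed
  then show thesis by (intro that) blast
qed

section \<open>Products of coroots and antisymmetric polynomials\<close>

lemma prod_fun_apply: "prod f A x = (\<Prod>a\<in>A. f a x)" for f :: "'i \<Rightarrow> 'b \<Rightarrow> complex"
  by (induction A rule: infinite_finite_induct) auto

lemma prod_comp: "prod f A \<circ> T = (\<Prod>a\<in>A. f a \<circ> T)" for f :: "'i \<Rightarrow> 'b \<Rightarrow> complex"
  by (rule ext) (simp add: prod_fun_apply)

lemma prod_linear_forms_mult:
  assumes "finite B" "\<And>b. b \<in> B \<Longrightarrow> x b \<in> h" "\<And>y f. y \<in> h \<Longrightarrow> f \<in> X \<Longrightarrow> linear_form y * f \<in> X" "f \<in> X"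
  shows "(\<Prod>b\<in>B. linear_form (x b)) * f \<in> X"
  using assms(1,2)
proof (induction B)
  case empty
  have "(\<Prod>b\<in>{}. linear_form (x b)) * f = f" by simp
  then show ?case using assms(4) by (simp only:)
next
  case (insert b B)
  have "(\<Prod>b\<in>insert b B. linear_form (x b)) * f = linear_form (x b) * ((\<Prod>b\<in>B. linear_form (x b)) * f)"
    using insert.hyps by (simp add: mult.assoc)
  then show ?case using insert assms(3)[of "x b"] by (simp only: insertI1 insertI2)
qed

lemma linear_form_mult_polynomials: "x \<in> h \<Longrightarrow> f \<in> polynomials \<Longrightarrow> linear_form x * f \<in> polynomials"
  by (rule polynomials_mult[OF sym_power_polynomials[OF linear_form_in]])

lemma prod_linear_forms_cancel:
  assumes "finite B" "\<And>b. b \<in> B \<Longrightarrow> x b \<in> h" "\<And>b. b \<in> B \<Longrightarrow> x b \<noteq> 0" "f \<in> polynomials"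
    "(\<Prod>b\<in>B. linear_form (x b)) * f = 0"
  shows "f = 0"
  using assms(1-3,5)
proof (induction B)
  case empty
  have "(\<Prod>b\<in>{}. linear_form (x b)) * f = f" by simp
  then show "f = 0" using empty(3) by (simp only:)
next
  case (insert b B)
  have "linear_form (x b) * ((\<Prod>b\<in>B. linear_form (x b)) * f) = (\<Prod>b\<in>insert b B. linear_form (x b)) * f"
    using insert.hyps by (simp add: mult.assoc)
  also have "\<dots> = 0" by (rule insert.prems(3))
  finally have zero: "linear_form (x b) * ((\<Prod>b\<in>B. linear_form (x b)) * f) = 0" .
  have "(\<Prod>b\<in>B. linear_form (x b)) * f \<in> polynomials"
    by (rule prod_linear_forms_mult[OF insert.hyps(1) _ linear_form_mult_polynomials assms(4)])
      (use insert.prems in auto)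
  then have "(\<Prod>b\<in>B. linear_form (x b)) * f = 0"
    by (rule linear_form_cancel[OF insert.prems(1)[OF insertI1] insert.prems(2)[OF insertI1] _ zero])
  then show "f = 0" using insert.IH insert.prems(1,2) by blast
qed

abbreviation hyperplane_projection :: "('g \<Rightarrow> complex) \<Rightarrow> ('g \<Rightarrow> complex) \<Rightarrow> 'g \<Rightarrow> complex"
  where "hyperplane_projection \<alpha> \<equiv> shear (1/2) \<alpha>"

lemma hyperplane_projection_coroot:
  "\<alpha> \<in> roots h \<Longrightarrow> l \<in> dual h \<Longrightarrow> hyperplane_projection \<alpha> l (coroot h \<alpha>) = 0"
  by (simp add: shear_def root_coroot)

lemma reflection_hyperplane_projection:
  assumes "\<alpha> \<in> roots h"
  shows "root_reflection h \<alpha> (hyperplane_projection \<alpha> l) = hyperplane_projection \<alpha> l"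
proof (cases "l \<in> dual h")
  case True
  then have "hyperplane_projection \<alpha> l \<in> dual h"
    using shear_transposed[OF assms] by (simp add: transposed_def)
  then show ?thesis
    using hyperplane_projection_coroot[OF assms True] by (simp add: root_reflection_apply)
qed (simp add: shear_def root_reflection_def)

lemma half_roots_coroot:
  assumes "\<alpha> \<in> half_roots" "\<beta> \<in> half_roots" "\<alpha> \<noteq> \<beta>"
  shows "coroot h \<beta> - c *\<^sub>C coroot h \<alpha> \<noteq> 0"
proof
  assume "coroot h \<beta> - c *\<^sub>C coroot h \<alpha> = 0"
  then have "coroot h \<beta> = c *\<^sub>C coroot h \<alpha>" by simp
  then have "\<alpha> = \<beta> \<or> \<alpha> = - \<beta>" using coroot_proportional half_roots_sub assms by blast
  then show False using assms half_roots_not by auto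
qed

lemma prod_coroots_projection:
  assumes "\<alpha> \<in> half_roots" "B \<subseteq> half_roots"
  shows "(\<Prod>\<beta>\<in>B. linear_form (coroot h \<beta>)) \<circ> hyperplane_projection \<alpha> =
    (\<Prod>\<beta>\<in>B. linear_form (coroot h \<beta> - (1/2 * \<alpha> (coroot h \<beta>)) *\<^sub>C coroot h \<alpha>))"
proof -
  have \<alpha>: "\<alpha> \<in> roots h" using assms half_roots_sub by blast
  have "linear_form (coroot h \<beta>) \<circ> hyperplane_projection \<alpha> =
      linear_form (coroot h \<beta> - (1/2 * \<alpha> (coroot h \<beta>)) *\<^sub>C coroot h \<alpha>)" if "\<beta> \<in> B" for \<beta>
    using that assms half_roots_sub coroot_in_h
    by (subst monomial_transposed[OF shear_transposed[OF \<alpha>]]) auto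
  then show ?thesis unfolding prod_comp by (rule prod.cong[OF refl])
qed

text \<open>Restricted to the hyperplane of \<alpha>, every factor remains a nonzero linear form,
  since none of the coroots in \<open>B\<close> is proportional to that of \<alpha>.\<close>

lemma prod_coroots_projection_cancel:
  assumes "\<alpha> \<in> half_roots" "B \<subseteq> half_roots" "\<alpha> \<notin> B" "f \<in> polynomials"
    "((\<Prod>\<beta>\<in>B. linear_form (coroot h \<beta>)) \<circ> hyperplane_projection \<alpha>) * f = 0"
  shows "f = 0"
proof (rule prod_linear_forms_cancel)
  show "finite B" using assms finite_half_roots finite_subset by blast
  show "(\<Prod>\<beta>\<in>B. linear_form (coroot h \<beta> - (1/2 * \<alpha> (coroot h \<beta>)) *\<^sub>C coroot h \<alpha>)) * f = 0"
    using assms(5) unfolding prod_coroots_projection[OF assms(1,2)] .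
  fix \<beta> assume \<beta>: "\<beta> \<in> B"
  then show "coroot h \<beta> - (1/2 * \<alpha> (coroot h \<beta>)) *\<^sub>C coroot h \<alpha> \<in> h"
    using assms half_roots_sub coroot_in_h by (intro subspace_h_simps) auto
  show "coroot h \<beta> - (1/2 * \<alpha> (coroot h \<beta>)) *\<^sub>C coroot h \<alpha> \<noteq> 0"
    using \<beta> assms by (intro half_roots_coroot) auto
qed (rule assms(4))

text \<open>An antisymmetric \<open>f\<close> vanishes on the hyperplane of \<alpha>. The factors
  already split off can be cancelled there, so the quotient \<open>q\<close> vanishes on it too, and
  its divided difference for the projection exhibits the next factor.\<close>

lemma antisymmetric_divisible:
  assumes f: "f \<in> sym_power h D" "\<And>\<alpha>. \<alpha> \<in> roots h \<Longrightarrow> f \<circ> root_reflection h \<alpha> = - f"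
    and D: "card half_roots \<le> D" and B: "B \<subseteq> half_roots"
  shows "\<exists>q\<in>sym_power h (D - card B). f = (\<Prod>\<beta>\<in>B. linear_form (coroot h \<beta>)) * q"
proof -
  have "finite B" using B finite_half_roots finite_subset by blast
  then show ?thesis using B
  proof (induction B)
    case empty
    have "f = (\<Prod>\<beta>\<in>{}. linear_form (coroot h \<beta>)) * f" by simp
    moreover have "f \<in> sym_power h (D - card {})" using f(1) by simp
    ultimately show ?case by blast
  next
    case (insert \<alpha> B)
    let ?P = "\<Prod>\<beta>\<in>B. linear_form (coroot h \<beta>)" and ?p = "hyperplane_projection \<alpha>"
    obtain q where q: "q \<in> sym_power h (D - card B)" "f = ?P * q" using insert by blast
    have \<alpha>: "\<alpha> \<in> half_roots" "\<alpha> \<in> roots h" using insert half_roots_sub by blast+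
    have "card (insert \<alpha> B) \<le> card half_roots"
      using insert.prems finite_half_roots by (intro card_mono)
    \<comment> \<open>The bound on \<open>D\<close> keeps the subtraction from being
      truncated.\<close>
    then have Suc: "D - card B = Suc (D - card (insert \<alpha> B))" using insert.hyps D by simp
    have "f (?p l) = 0" for l
    proof -
      have "f (?p l) = - f (?p l)"
        using fun_cong[OF f(2)[OF \<alpha>(2)], of "?p l"] reflection_hyperplane_projection[OF \<alpha>(2)] by simp
      then show ?thesis by simp
    qed
    then have "(?P \<circ> ?p) * (q \<circ> ?p) = 0" by (simp add: q(2) fun_eq_iff)
    then have "q \<circ> ?p = 0"
      using insert \<alpha>(1) sym_power_polynomials[OF sym_power_transposed[OF shear_transposed[OF \<alpha>(2)] q(1)]]
      by (intro prod_coroots_projection_cancel[of \<alpha> B "q \<circ> ?p"]) auto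
    moreover obtain g where g: "g \<in> sym_power h (D - card (insert \<alpha> B))"
      "q - (q \<circ> ?p) = linear_form (coroot h \<alpha>) * g"
      using divided_difference[OF \<alpha>(2), of q "D - card B" "1/2"] q(1) unfolding Suc sym_pred.simps by blast
    ultimately have "q = linear_form (coroot h \<alpha>) * g" by simp
    then have "f = (\<Prod>\<beta>\<in>insert \<alpha> B. linear_form (coroot h \<beta>)) * g"
      using q(2) insert.hyps by (simp add: mult_ac)
    then show ?case using g(1) by blast
  qed
qed

lemma linear_form_scale: "x \<in> h \<Longrightarrow> linear_form (c *\<^sub>C x) = c *\<^sub>C linear_form x"
  by (auto simp: monomial_def dual_linear)

lemma linear_form_reflection:
  assumes "\<alpha> \<in> roots h" "\<beta> \<in> roots h"
  shows "linear_form (coroot h \<beta>) \<circ> root_reflection h \<alpha> = linear_form (coroot h (root_reflection h \<alpha> \<beta>))"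
  using monomial_transposed[OF shear_transposed[OF assms(1), of 1], of "[coroot h \<beta>]"] coroot_in_h[OF assms(2)]
  unfolding shear_1 coroot_reflection[OF assms] by (simp add: coreflection_def)

text \<open>The reflection permutes the other half roots up to signs. These signs depend on the
  arbitrary choice of \<open>half_roots\<close> and are not counted: their product \<open>c\<close>
  is 1 because the product of the other coroots is nonzero at some point of the hyperplane, which
  the reflection fixes. The factor of \<alpha> alone changes sign.\<close>

lemma prod_coroots_reflection:
  assumes "\<alpha> \<in> half_roots"
  shows "(\<Prod>\<beta>\<in>half_roots. linear_form (coroot h \<beta>)) \<circ> root_reflection h \<alpha> =
    - (\<Prod>\<beta>\<in>half_roots. linear_form (coroot h \<beta>))"
proof -
  let ?s = "root_reflection h \<alpha>" and ?B = "half_roots - {\<alpha>}" and ?p = "hyperplane_projection \<alpha>"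
  let ?P = "\<Prod>\<beta>\<in>?B. linear_form (coroot h \<beta>)"
  have \<alpha>: "\<alpha> \<in> roots h" using assms half_roots_sub by blast
  define \<sigma> where "\<sigma> \<beta> = (if ?s \<beta> \<in> half_roots then ?s \<beta> else - ?s \<beta>)" for \<beta>
  define e :: "('g \<Rightarrow> complex) \<Rightarrow> complex" where "e \<beta> = (if ?s \<beta> \<in> half_roots then 1 else - 1)" for \<beta>
  have inv: "?s (?s \<beta>) = \<beta>" for \<beta> by (rule root_reflection_involution[OF \<alpha>])
  have neg: "?s (- \<beta>) = - ?s \<beta>" if "\<beta> \<in> roots h" for \<beta>
    using weyl_linear(2)[OF weyl_reflection[OF \<alpha>] rootsD(1)[OF that] rootsD(1)[OF that], of "- 1"] by simp
  have s\<alpha>: "?s \<alpha> = - \<alpha>"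
    using rootsD(1)[OF \<alpha>] root_coroot[OF \<alpha>] by (simp add: root_reflection_apply fun_eq_iff)
  have half: "\<sigma> \<beta> \<in> half_roots" if "\<beta> \<in> half_roots" for \<beta>
    using that half_roots_sub half_roots_or[OF root_reflection_root[OF \<alpha>]] unfolding \<sigma>_def by auto
  have eq: "\<beta> = \<gamma>" if "\<beta> \<in> half_roots" "\<gamma> \<in> half_roots" "?s \<beta> = ?s \<gamma> \<or> ?s \<beta> = - ?s \<gamma>" for \<beta> \<gamma>
  proof -
    have "\<gamma> \<in> roots h" using that half_roots_sub by blast
    then have "\<beta> = \<gamma> \<or> \<beta> = - \<gamma>" using that(3) inv neg by metis
    then show ?thesis using that half_roots_not by blast
  qed
  have "\<sigma> ` ?B \<subseteq> ?B"
  proof (rule image_subsetI)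
    fix \<beta> assume "\<beta> \<in> ?B"
    then have \<beta>: "\<beta> \<in> half_roots" "\<beta> \<noteq> \<alpha>" by auto
    have "\<sigma> \<beta> \<noteq> \<alpha>"
    proof
      assume "\<sigma> \<beta> = \<alpha>"
      then have "?s \<beta> = \<alpha> \<or> ?s \<beta> = - \<alpha>" unfolding \<sigma>_def by (metis minus_minus)
      then have "\<beta> = \<alpha>" using eq[OF \<beta>(1) assms] s\<alpha> by auto
      then show False using \<beta> by simp
    qed
    then show "\<sigma> \<beta> \<in> ?B" using half[OF \<beta>(1)] by simp
  qed
  moreover have inj: "inj_on \<sigma> ?B"
  proof (rule inj_onI)
    fix \<beta> \<gamma> assume "\<beta> \<in> ?B" "\<gamma> \<in> ?B" "\<sigma> \<beta> = \<sigma> \<gamma>"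
    then have "?s \<beta> = ?s \<gamma> \<or> ?s \<beta> = - ?s \<gamma>" unfolding \<sigma>_def by (metis minus_minus)
    then show "\<beta> = \<gamma>" using eq[of \<beta> \<gamma>] \<open>\<beta> \<in> ?B\<close> \<open>\<gamma> \<in> ?B\<close> by blast
  qed
  ultimately have \<sigma>B: "\<sigma> ` ?B = ?B" using finite_half_roots by (intro endo_inj_surj) auto
  have lin: "linear_form (coroot h \<beta>) \<circ> ?s = e \<beta> *\<^sub>C linear_form (coroot h (\<sigma> \<beta>))" if "\<beta> \<in> half_roots" for \<beta>
  proof -
    have \<beta>: "\<beta> \<in> roots h" using that half_roots_sub by blast
    have s\<beta>: "?s \<beta> \<in> roots h" by (rule root_reflection_root[OF \<alpha> \<beta>])
    have "linear_form (coroot h (?s \<beta>)) = e \<beta> *\<^sub>C linear_form (coroot h (\<sigma> \<beta>))"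
      using coroot_uminus[OF s\<beta>] linear_form_scale[OF coroot_in_h[OF s\<beta>], of "- 1"]
      by (simp add: e_def \<sigma>_def)
    then show ?thesis using linear_form_reflection[OF \<alpha> \<beta>] by simp
  qed
  define c where "c = (\<Prod>\<beta>\<in>?B. e \<beta>)"
  have Ps: "?P \<circ> ?s = c *\<^sub>C ?P"
  proof -
    have "?P \<circ> ?s = (\<Prod>\<beta>\<in>?B. e \<beta> *\<^sub>C linear_form (coroot h (\<sigma> \<beta>)))"
      unfolding prod_comp by (rule prod.cong[OF refl], rule lin) blast
    also have "\<dots> = c *\<^sub>C (\<Prod>\<beta>\<in>?B. linear_form (coroot h (\<sigma> \<beta>)))"
      by (rule ext) (simp add: prod_fun_apply prod.distrib c_def)
    also have "(\<Prod>\<beta>\<in>?B. linear_form (coroot h (\<sigma> \<beta>))) = ?P"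
      using prod.reindex[OF inj, of "\<lambda>\<beta>. linear_form (coroot h \<beta>)"] \<sigma>B by (simp add: o_def)
    finally show ?thesis .
  qed
  have "\<exists>l. (?P \<circ> ?p) l \<noteq> 0"
  proof (rule ccontr)
    assume "\<nexists>l. (?P \<circ> ?p) l \<noteq> 0"
    then have zero: "(?P \<circ> ?p) * monomial [] = 0" by (intro ext) auto
    have mem: "monomial [] \<in> polynomials" by (rule sym_power_polynomials[OF monomial_in[where d = 0]]) auto
    have "monomial [] = 0"
      by (rule prod_coroots_projection_cancel[OF assms _ _ mem zero]) auto
    then have "monomial [] 0 = 0" by (simp only: zero_fun_apply)
    then show False using monomial_Nil_eval[OF complex_vector.subspace_0[OF subspace_dual]] by simp
  qed
  then obtain l where l: "?P (?p l) \<noteq> 0" unfolding o_apply by blast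
  have "?P (?p l) = c * ?P (?p l)"
    using fun_cong[OF Ps, of "?p l"] reflection_hyperplane_projection[OF \<alpha>, of l] by simp
  then have "c = 1" using l by simp
  then have Ps: "?P \<circ> ?s = ?P" using Ps by (simp add: scaleC_one)
  have "- \<alpha> \<notin> half_roots" by (rule half_roots_not[OF assms])
  then have ls: "linear_form (coroot h \<alpha>) \<circ> ?s = - linear_form (coroot h \<alpha>)"
    using lin[OF assms] s\<alpha> by (simp add: e_def \<sigma>_def)
  have split: "(\<Prod>\<beta>\<in>half_roots. linear_form (coroot h \<beta>)) = linear_form (coroot h \<alpha>) * ?P"
    by (rule prod.remove[OF finite_half_roots assms])
  have "(linear_form (coroot h \<alpha>) * ?P) \<circ> ?s = (linear_form (coroot h \<alpha>) \<circ> ?s) * (?P \<circ> ?s)"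
    by (simp add: fun_eq_iff)
  then show ?thesis unfolding split ls Ps by (simp add: fun_eq_iff)
qed

text \<open>Invariant factors pass through the divided difference, so it acts on the polynomial
  coefficients only.\<close>

lemma divided_difference_ideal:
  assumes "\<alpha> \<in> roots h" "f \<in> coinvariant_ideal h"
  shows "\<exists>g\<in>coinvariant_ideal h. f - (f \<circ> root_reflection h \<alpha>) = linear_form (coroot h \<alpha>) * g"
  using assms(2) unfolding coinvariant_ideal_def sym_algebra_polynomials
proof (induction rule: complex_vector.span_induct_alt)
  case base
  have "0 - (0 \<circ> root_reflection h \<alpha>) = linear_form (coroot h \<alpha>) * 0" by (simp add: comp_linear)
  then show ?case using complex_vector.span_zero by (intro bexI[of _ 0])
next
  case (step c m f)
  let ?T = "root_reflection h \<alpha>" and ?H = "linear_form (coroot h \<alpha>)"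
  let ?I = "cspan {g * f |g f. g \<in> polynomials \<and> f \<in> positive_invariants h}"
  obtain a b where m: "m = a * b" "a \<in> polynomials" "b \<in> positive_invariants h" using step(1) by blast
  obtain a' where a': "a' \<in> polynomials" "a - (a \<circ> ?T) = ?H * a'"
    using divided_difference_polynomials[OF assms(1) m(2)] by blast
  have g: "a' * b \<in> ?I" using a' m by (blast intro: complex_vector.span_base)
  have "b \<circ> ?T = b" using m(3) weyl_reflection[OF assms(1)] by (simp add: positive_invariants_def)
  then have "m - (m \<circ> ?T) = (a - (a \<circ> ?T)) * b" by (simp add: m fun_eq_iff algebra_simps)
  also have "\<dots> = ?H * (a' * b)" unfolding a' by (rule mult.assoc)
  finally have gm: "m - (m \<circ> ?T) = ?H * (a' * b)" .
  obtain g' where g': "g' \<in> ?I" "f - (f \<circ> ?T) = ?H * g'" using step(2) by blast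
  have "c *\<^sub>C m + f - ((c *\<^sub>C m + f) \<circ> ?T) = c *\<^sub>C (m - (m \<circ> ?T)) + (f - (f \<circ> ?T))"
    by (simp add: fun_eq_iff algebra_simps)
  also have "\<dots> = ?H * (c *\<^sub>C (a' * b) + g')" unfolding gm g' by (simp add: fun_eq_iff algebra_simps)
  finally have "c *\<^sub>C m + f - ((c *\<^sub>C m + f) \<circ> ?T) = ?H * (c *\<^sub>C (a' * b) + g')" .
  moreover have "c *\<^sub>C (a' * b) + g' \<in> ?I"
    using g g' by (intro complex_vector.span_add complex_vector.span_scale)
  ultimately show ?case by (intro bexI[of _ "c *\<^sub>C (a' * b) + g'"])
qed

text \<open>In the top degree of the coinvariant algebra the Weyl group acts by the sign character, as
  multiplication by a coroot annihilates it; hence it is represented by an antisymmetric polynomial.\<close>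

lemma sign_in_top_degree:
  assumes "sym_power h (Suc D) \<subseteq> coinvariant_ideal h" "f \<in> sym_power h D" "\<alpha> \<in> roots h"
  shows "f + (f \<circ> root_reflection h \<alpha>) \<in> coinvariant_ideal h"
proof -
  let ?s = "root_reflection h \<alpha>" and ?H = "linear_form (coroot h \<alpha>)"
  have "?H * f \<in> coinvariant_ideal h"
    using linear_form_mult[OF coroot_in_h[OF assms(3)] assms(2)] assms(1) by blast
  then obtain g where g: "g \<in> coinvariant_ideal h" "?H * f - ((?H * f) \<circ> ?s) = ?H * g"
    using divided_difference_ideal[OF assms(3)] by blast
  have Hs: "?H \<circ> ?s = - ?H"
  proof
    fix l
    show "(?H \<circ> ?s) l = (- ?H) l"
    proof (cases "l \<in> dual h")
      case True
      then show ?thesis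
        using root_reflection_dual[OF assms(3) True] root_coroot[OF assms(3)]
        by (simp add: linear_form_eval) (simp add: root_reflection_apply)
    qed (simp add: monomial_def root_reflection_def)
  qed
  have "?H (?s l) = - ?H l" for l using fun_cong[OF Hs, of l] by simp
  \<comment> \<open>The coroot is itself antisymmetric, so the difference of the product
    \<open>?H * f\<close> is \<open>?H\<close> times a sum. Cancelling \<open>?H\<close> against the
    divided difference identifies this sum with an element of the ideal.\<close>
  then have "?H * (f + (f \<circ> ?s)) = ?H * f - ((?H * f) \<circ> ?s)"
    by (intro ext) (simp add: algebra_simps)
  then have zero: "?H * (f + (f \<circ> ?s) - g) = 0" using g(2) by (simp add: right_diff_distrib)
  have "f + (f \<circ> ?s) - g \<in> polynomials"
    using g(1) coinvariant_ideal_polynomials sym_power_polynomials[OF assms(2)]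
      sym_power_polynomials[OF sym_power_weyl[OF weyl_reflection[OF assms(3)] assms(2)]]
    by (intro complex_vector.subspace_add[OF subspace_polynomials] complex_vector.subspace_diff[OF subspace_polynomials]) auto
  then have "f + (f \<circ> ?s) - g = 0"
    by (rule linear_form_cancel[OF coroot_in_h[OF assms(3)] coroot_nonzero[OF assms(3)] _ zero])
  then show ?thesis using g(1) by simp
qed

lemma antisymmetric_in_ideal:
  assumes "f \<in> sym_power h D" "\<And>\<alpha>. \<alpha> \<in> roots h \<Longrightarrow> f \<circ> root_reflection h \<alpha> = - f" "card half_roots < D"
  shows "f \<in> coinvariant_ideal h"
proof -
  let ?P = "\<Prod>\<beta>\<in>half_roots. linear_form (coroot h \<beta>)"
  obtain q where q: "q \<in> sym_power h (D - card half_roots)" "f = ?P * q"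
    using antisymmetric_divisible[OF assms(1,2)] assms(3) by force
  have half: "q \<circ> root_reflection h \<alpha> = q" if \<alpha>: "\<alpha> \<in> half_roots" for \<alpha>
  proof -
    let ?s = "root_reflection h \<alpha>"
    have \<alpha>': "\<alpha> \<in> roots h" using \<alpha> half_roots_sub by blast
    have "(?P \<circ> ?s) * (q \<circ> ?s) = - (?P * q)"
      using assms(2)[OF \<alpha>'] unfolding q(2) by (simp add: fun_eq_iff)
    then have "?P * ((q \<circ> ?s) - q) = 0"
      unfolding prod_coroots_reflection[OF \<alpha>] by (simp add: right_diff_distrib)
    moreover have "(q \<circ> ?s) - q \<in> polynomials"
      using sym_power_polynomials[OF q(1)] sym_power_polynomials[OF sym_power_weyl[OF weyl_reflection[OF \<alpha>'] q(1)]]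
      by (intro complex_vector.subspace_diff[OF subspace_polynomials])
    ultimately have "(q \<circ> ?s) - q = 0"
      using half_roots_sub coroot_in_h coroot_nonzero
      by (intro prod_linear_forms_cancel[where x = "coroot h" and f = "(q \<circ> ?s) - q", OF finite_half_roots]) blast+
    then show ?thesis by simp
  qed
  have refl: "q \<circ> root_reflection h \<alpha> = q" if \<alpha>: "\<alpha> \<in> roots h" for \<alpha>
  proof -
    have "root_reflection h (- \<alpha>) = root_reflection h \<alpha>"
    proof
      fix l
      show "root_reflection h (- \<alpha>) l = root_reflection h \<alpha> l"
        using coroot_uminus[OF \<alpha>] dual_linear(5)[OF _ coroot_in_h[OF \<alpha>], of l]
        by (cases "l \<in> dual h") (simp_all add: root_reflection_def)
    qed
    then show ?thesis using half half_roots_or[OF \<alpha>] by metis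
  qed
  have "q \<circ> w = q" if "w \<in> weyl_group h" for w
    using that
  proof (induction rule: weyl_group.induct)
    case (reflection \<alpha> w)
    have "q \<circ> (root_reflection h \<alpha> \<circ> w) = (q \<circ> root_reflection h \<alpha>) \<circ> w" by (simp add: comp_assoc)
    then show "q \<circ> (root_reflection h \<alpha> \<circ> w) = q" using reflection refl by simp
  qed simp
  then have "q \<in> coinvariant_ideal h"
    using positive_invariant_in_ideal[OF q(1)] assms(3) by simp
  then show ?thesis
    unfolding q(2)
    using coinvariant_ideal_mult[OF sym_power_polynomials[OF linear_form_in]] half_roots_sub coroot_in_h
    by (intro prod_linear_forms_mult[OF finite_half_roots, where x = "coroot h"]) blast+
qed

text \<open>In the largest degree \<open>D\<close> not contained in the ideal, each \<open>w\<close>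
  acts on \<open>f\<close> modulo the ideal by a scalar \<open>e w\<close> of square 1, unique as
  \<open>f\<close> is not in the ideal. The alternating sum \<open>a\<close> formed with these
  scalars is exactly antisymmetric, hence in the ideal, and it is congruent to the order of the
  group times \<open>f\<close>.\<close>

lemma top_degree:
  assumes l: "l \<in> regular h" and "card half_roots < d"
  shows "sym_power h d \<subseteq> coinvariant_ideal h"
proof (rule ccontr)
  assume bad: "\<not> ?thesis"
  obtain n where n: "\<And>d. d \<ge> n \<Longrightarrow> sym_power h d \<subseteq> coinvariant_ideal h"
    by (rule high_degree_in_ideal[OF l]) (rule that)
  define D where "D = Max {d. \<not> sym_power h d \<subseteq> coinvariant_ideal h}"
  have "{d. \<not> sym_power h d \<subseteq> coinvariant_ideal h} \<subseteq> {..n}" using n linorder_linear by blast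
  then have fin: "finite {d. \<not> sym_power h d \<subseteq> coinvariant_ideal h}" using finite_subset by blast
  then have D: "\<not> sym_power h D \<subseteq> coinvariant_ideal h" "d \<le> D"
    using bad Max_in[OF fin] Max_ge[OF fin, of d] unfolding D_def by blast+
  have SD: "sym_power h (Suc D) \<subseteq> coinvariant_ideal h"
  proof (rule ccontr)
    assume "\<not> ?thesis"
    then have "Suc D \<le> D" using Max_ge[OF fin, of "Suc D"] unfolding D_def by blast
    then show False by simp
  qed
  obtain f where f: "f \<in> sym_power h D" "f \<notin> coinvariant_ideal h" using D(1) by blast
  note sign = sign_in_top_degree[OF SD f(1)]
  have "\<exists>e. e * e = 1 \<and> (f \<circ> w) - e *\<^sub>C f \<in> coinvariant_ideal h" if "w \<in> weyl_group h" for w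
    using that
  proof (induction rule: weyl_group.induct)
    case id
    have "(f \<circ> id) - 1 *\<^sub>C f = 0" by (simp add: scaleC_one)
    then have "1 * 1 = (1 :: complex) \<and> (f \<circ> id) - 1 *\<^sub>C f \<in> coinvariant_ideal h"
      using coinvariant_ideal_simps(1) by simp
    then show ?case by (rule exI)
  next
    case (reflection \<alpha> w)
    then obtain e where e: "e * e = 1" "(f \<circ> w) - e *\<^sub>C f \<in> coinvariant_ideal h" by blast
    let ?s = "root_reflection h \<alpha>"
    have "(f \<circ> (?s \<circ> w)) - (- e) *\<^sub>C f = ((f + (f \<circ> ?s)) \<circ> w) - ((f \<circ> w) - e *\<^sub>C f)"
      by (simp add: fun_eq_iff)
    also have "\<dots> \<in> coinvariant_ideal h"
      using coinvariant_ideal_weyl[OF reflection(2) sign[OF reflection(1)]] e(2)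
      by (rule coinvariant_ideal_simps(3))
    finally have "(- e) * (- e) = 1 \<and> (f \<circ> (?s \<circ> w)) - (- e) *\<^sub>C f \<in> coinvariant_ideal h" using e(1) by simp
    then show ?case by (rule exI)
  qed
  then obtain e where e: "\<And>w. w \<in> weyl_group h \<Longrightarrow> e w * e w = 1"
    "\<And>w. w \<in> weyl_group h \<Longrightarrow> (f \<circ> w) - e w *\<^sub>C f \<in> coinvariant_ideal h" by metis
  have unique: "a = b" if "g - a *\<^sub>C f \<in> coinvariant_ideal h" "g - b *\<^sub>C f \<in> coinvariant_ideal h" for g a b
  proof (rule ccontr)
    assume "a \<noteq> b"
    have "(b - a) *\<^sub>C f = (g - a *\<^sub>C f) - (g - b *\<^sub>C f)" by (simp add: fun_eq_iff algebra_simps)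
    then have "(b - a) *\<^sub>C f \<in> coinvariant_ideal h" using that coinvariant_ideal_simps(3) by metis
    then have "inverse (b - a) *\<^sub>C ((b - a) *\<^sub>C f) \<in> coinvariant_ideal h" by (rule coinvariant_ideal_simps(4))
    then show False using f(2) \<open>a \<noteq> b\<close> by simp
  qed
  \<comment> \<open>Uniqueness of the scalars turns the congruences into exact equations, so that
    \<open>a\<close> becomes antisymmetric as a polynomial and not only modulo the ideal.\<close>
  have es: "e (w \<circ> root_reflection h \<alpha>) = - e w" if \<alpha>: "\<alpha> \<in> roots h" and w: "w \<in> weyl_group h" for \<alpha> w
  proof (rule unique)
    let ?s = "root_reflection h \<alpha>"
    show "(f \<circ> (w \<circ> ?s)) - e (w \<circ> ?s) *\<^sub>C f \<in> coinvariant_ideal h"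
      by (rule e(2)[OF weyl_comp[OF w weyl_reflection[OF \<alpha>]]])
    have "(f \<circ> (w \<circ> ?s)) - (- e w) *\<^sub>C f = (((f \<circ> w) - e w *\<^sub>C f) \<circ> ?s) + e w *\<^sub>C (f + (f \<circ> ?s))"
      by (simp add: fun_eq_iff algebra_simps)
    also have "\<dots> \<in> coinvariant_ideal h"
      using coinvariant_ideal_weyl[OF weyl_reflection[OF \<alpha>] e(2)[OF w]] coinvariant_ideal_simps(4)[OF sign[OF \<alpha>]]
      by (rule coinvariant_ideal_simps(2))
    finally show "(f \<circ> (w \<circ> ?s)) - (- e w) *\<^sub>C f \<in> coinvariant_ideal h" .
  qed
  define a where "a = (\<Sum>w\<in>weyl_group h. e w *\<^sub>C (f \<circ> w))"
  have a: "a \<in> coinvariant_ideal h"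
  proof (rule antisymmetric_in_ideal)
    show "a \<in> sym_power h D"
      unfolding a_def using sym_power_weyl[OF _ f(1)]
      by (intro sym_power_simps(5) sym_power_simps(4))
    show "card half_roots < D" using assms(2) D(2) by simp
    fix \<alpha> assume \<alpha>: "\<alpha> \<in> roots h"
    let ?s = "root_reflection h \<alpha>"
    have "a \<circ> ?s = (\<Sum>w\<in>weyl_group h. e w *\<^sub>C (f \<circ> (w \<circ> ?s)))"
      by (rule ext) (simp add: a_def sum_fun_apply)
    also have "\<dots> = (\<Sum>w\<in>weyl_group h. - (e (w \<circ> ?s) *\<^sub>C (f \<circ> (w \<circ> ?s))))"
      by (rule sum.cong[OF refl]) (simp add: es[OF \<alpha>] del: o_apply)
    also have "\<dots> = (\<Sum>w\<in>weyl_group h. - (e w *\<^sub>C (f \<circ> w)))"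
      by (rule sum_weyl_right[OF weyl_reflection[OF \<alpha>], of "\<lambda>w. - (e w *\<^sub>C (f \<circ> w))"])
    also have "\<dots> = - a" unfolding a_def by (rule sum_negf)
    finally show "a \<circ> ?s = - a" .
  qed
  have b: "(\<Sum>w\<in>weyl_group h. e w *\<^sub>C ((f \<circ> w) - e w *\<^sub>C f)) \<in> coinvariant_ideal h"
    using e(2) by (intro coinvariant_ideal_simps(5) coinvariant_ideal_simps(4))
  have ab: "of_nat (card (weyl_group h)) *\<^sub>C f = a - (\<Sum>w\<in>weyl_group h. e w *\<^sub>C ((f \<circ> w) - e w *\<^sub>C f))"
  proof -
    have "e w *\<^sub>C ((f \<circ> w) - e w *\<^sub>C f) = e w *\<^sub>C (f \<circ> w) - f" if "w \<in> weyl_group h" for w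
      using e(1)[OF that] by (simp add: complex_vector.scale_right_diff_distrib scaleC_one)
    then have "(\<Sum>w\<in>weyl_group h. e w *\<^sub>C ((f \<circ> w) - e w *\<^sub>C f)) = (\<Sum>w\<in>weyl_group h. e w *\<^sub>C (f \<circ> w) - f)"
      by (rule sum.cong[OF refl])
    then show ?thesis
      unfolding a_def sum_subtractf by (intro ext) (simp add: sum_fun_apply)
  qed
  have "of_nat (card (weyl_group h)) *\<^sub>C f \<in> coinvariant_ideal h"
    unfolding ab using a b by (rule coinvariant_ideal_simps(3))
  then have "inverse (of_nat (card (weyl_group h))) *\<^sub>C (of_nat (card (weyl_group h)) *\<^sub>C f) \<in> coinvariant_ideal h"
    by (rule coinvariant_ideal_simps(4))
  then show False using f(2) card_weyl_nonzero by simp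
qed

end


section \<open>Semilinear algebra\<close>

text \<open>Lifts to \<open>U\<close> of a basis of the image under \<open>A\<close> are sent by
  \<open>B\<close> to a basis of the other image, because the kernels on \<open>U\<close> agree;
  coefficients are conjugated on the way.\<close>

lemma dim_semilinear_image:
  fixes A :: "'u::complex_vector \<Rightarrow> 'x::complex_vector" and B :: "'u \<Rightarrow> 'y::complex_vector"
  assumes U: "csubspace U" and A: "clinear A"
    and B: "\<And>u v. B (u + v) = B u + B v" "\<And>c u. B (c *\<^sub>C u) = cnj c *\<^sub>C B u"
    and ker: "\<And>u. u \<in> U \<Longrightarrow> A u = 0 \<longleftrightarrow> B u = 0"
  shows "cdim (A ` U) = cdim (B ` U)"
proof -
  note lin = complex_vector.linear_diff[OF A] complex_vector.linear_sum[OF A] complex_vector.linear_scale[OF A]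
  have B0: "B 0 = 0" using B(2)[of 0 0] by simp
  have Bsum: "B (sum f t) = (\<Sum>x\<in>t. B (f x))" for f :: "'x \<Rightarrow> 'u" and t
    by (induction t rule: infinite_finite_induct) (simp_all add: B B0)
  have Bdiff: "B (u - v) = B u - B v" for u v
    using B(1)[of "u - v" v] by simp
  obtain X where X: "X \<subseteq> A ` U" "complex_vector.independent X" "A ` U \<subseteq> cspan X" "card X = cdim (A ` U)"
    by (rule complex_vector.basis_exists)
  have "\<forall>x\<in>X. \<exists>u. u \<in> U \<and> A u = x" using X(1) by blast
  then obtain s where s: "\<And>x. x \<in> X \<Longrightarrow> s x \<in> U" "\<And>x. x \<in> X \<Longrightarrow> A (s x) = x" by metis
  have inj: "inj_on (\<lambda>x. B (s x)) X"
  proof (rule inj_onI)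
    fix x y assume *: "x \<in> X" "y \<in> X" "B (s x) = B (s y)"
    then have "A (s x - s y) = 0"
      using ker[of "s x - s y"] s complex_vector.subspace_diff[OF U] by (simp add: Bdiff)
    then show "x = y" using * s by (simp add: lin)
  qed
  have sumU: "(\<Sum>x\<in>t. c x *\<^sub>C s x) \<in> U" if "t \<subseteq> X" for c t
    using that s by (intro complex_vector.subspace_sum[OF U] complex_vector.subspace_scale[OF U]) auto
  have sumA: "A (\<Sum>x\<in>t. c x *\<^sub>C s x) = (\<Sum>x\<in>t. c x *\<^sub>C x)" if "t \<subseteq> X" for c t
  proof -
    have "A (\<Sum>x\<in>t. c x *\<^sub>C s x) = (\<Sum>x\<in>t. c x *\<^sub>C A (s x))" by (simp add: lin)
    also have "\<dots> = (\<Sum>x\<in>t. c x *\<^sub>C x)" using that s by (intro sum.cong) auto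
    finally show ?thesis .
  qed
  have sumB: "B (\<Sum>x\<in>t. c x *\<^sub>C s x) = (\<Sum>x\<in>t. cnj (c x) *\<^sub>C B (s x))" for c t
    by (simp add: Bsum B)
  have ind: "complex_vector.independent ((\<lambda>x. B (s x)) ` X)"
    unfolding complex_vector.independent_explicit_finite_subsets
  proof (intro allI impI ballI)
    fix t' u v assume t': "t' \<subseteq> (\<lambda>x. B (s x)) ` X" "finite t'" "(\<Sum>v\<in>t'. u v *\<^sub>C v) = 0" "v \<in> t'"
    obtain t where t: "t \<subseteq> X" "finite t" "t' = (\<lambda>x. B (s x)) ` t"
      using finite_subset_image[OF t'(2,1)] by blast
    have injt: "inj_on (\<lambda>x. B (s x)) t" using inj t(1) by (rule inj_on_subset)
    have "(\<Sum>x\<in>t. u (B (s x)) *\<^sub>C B (s x)) = 0"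
      using t'(3) unfolding t(3) sum.reindex[OF injt] by (simp add: o_def)
    then have "B (\<Sum>x\<in>t. cnj (u (B (s x))) *\<^sub>C s x) = 0"
      unfolding sumB by (simp only: complex_cnj_cnj)
    then have "(\<Sum>x\<in>t. cnj (u (B (s x))) *\<^sub>C x) = 0"
      using ker[OF sumU[OF t(1)]] sumA[OF t(1)] by simp
    moreover obtain x where x: "x \<in> t" "v = B (s x)" using t' t by blast
    ultimately have "cnj (u (B (s x))) = 0"
      using complex_vector.independentD[OF X(2) t(2,1), of "\<lambda>x. cnj (u (B (s x)))" x] by blast
    then show "u v = 0" using x by simp
  qed
  have "B ` U \<subseteq> cspan ((\<lambda>x. B (s x)) ` X)"
  proof clarify
    fix u assume u: "u \<in> U"
    then have "A u \<in> cspan X" using X(3) by blast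
    then obtain t r where t: "finite t" "t \<subseteq> X" "A u = (\<Sum>x\<in>t. r x *\<^sub>C x)"
      unfolding complex_vector.span_explicit by blast
    have "A (u - (\<Sum>x\<in>t. r x *\<^sub>C s x)) = 0" unfolding lin(1) sumA[OF t(2)] t(3) by simp
    then have "B (u - (\<Sum>x\<in>t. r x *\<^sub>C s x)) = 0"
      using ker[OF complex_vector.subspace_diff[OF U u sumU[OF t(2)]]] by blast
    then have "B u = (\<Sum>x\<in>t. cnj (r x) *\<^sub>C B (s x))" unfolding Bdiff sumB by simp
    also have "\<dots> \<in> cspan ((\<lambda>x. B (s x)) ` X)"
      using t(2) by (intro complex_vector.span_sum complex_vector.span_scale complex_vector.span_base) blast
    finally show "B u \<in> cspan ((\<lambda>x. B (s x)) ` X)" .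
  qed
  moreover have "(\<lambda>x. B (s x)) ` X \<subseteq> B ` U" using s by blast
  ultimately have "cdim (B ` U) = card ((\<lambda>x. B (s x)) ` X)"
    using ind by (intro complex_vector.basis_card_eq_dim[symmetric])
  then show ?thesis using card_image[OF inj] X(4) by simp
qed

lemma span_image_semilinear:
  fixes F :: "'u::complex_vector \<Rightarrow> 'x::complex_vector"
  assumes "f \<in> cspan A" "\<And>a. a \<in> A \<Longrightarrow> F a \<in> B" "csubspace B" "F 0 = 0"
    "\<And>c a b. F (c *\<^sub>C a + b) = \<sigma> c *\<^sub>C F a + F b"
  shows "F f \<in> B"
  using assms(1)
proof (induction rule: complex_vector.span_induct_alt)
  case base
  show ?case using assms by (simp add: complex_vector.subspace_0)
next
  case (step c x y)
  then show ?case using assms by (simp add: complex_vector.subspace_add complex_vector.subspace_scale)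
qed

lemma coset_rep_eq_0_iff:
  assumes "csubspace B"
  shows "coset_rep B x = 0 \<longleftrightarrow> x \<in> B"
  using coset_rep(2,3)[OF assms, of x] by auto

lemma coset_rep_eqI:
  assumes "csubspace B" "x - y \<in> B"
  shows "coset_rep B x = coset_rep B y"
  using coset_rep(2)[OF assms] complex_vector.linear_diff[OF coset_rep(1)[OF assms(1)]] by simp

lemma quotient_space_self: "csubspace B \<Longrightarrow> quotient_space B B = {0}"
  unfolding quotient_space_def using coset_rep(2)[of B] complex_vector.subspace_0[of B] by force


section \<open>Equivariant polynomial maps\<close>

locale weyl_representation = cartan_pair h for h :: "'g::complex_lie_algebra set" +
  fixes \<rho> :: "(('g \<Rightarrow> complex) \<Rightarrow> 'g \<Rightarrow> complex) \<Rightarrow> 'v::complex_vector \<Rightarrow> 'v"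
  assumes irreducible: "irreducible_representation h \<rho>"
begin

section \<open>Finite dimension and an invariant Hermitian form\<close>

lemma rho_linear: "w \<in> weyl_group h \<Longrightarrow> clinear (\<rho> w)"
  and rho_id [simp]: "\<rho> id v = v"
  and rho_comp: "w \<in> weyl_group h \<Longrightarrow> w' \<in> weyl_group h \<Longrightarrow> \<rho> (w \<circ> w') v = \<rho> w (\<rho> w' v)"
  using irreducible by (auto simp: irreducible_representation_def representation_def)

lemmas rho_add = complex_vector.linear_add[OF rho_linear]
lemmas rho_scale = complex_vector.linear_scale[OF rho_linear]
lemmas rho_sum = complex_vector.linear_sum[OF rho_linear]
lemmas rho_0 = complex_vector.linear_0[OF rho_linear]

lemma rho_inv:
  assumes "w \<in> weyl_group h"
  shows "\<rho> (inv w) (\<rho> w v) = v" "\<rho> w (\<rho> (inv w) v) = v"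
  using rho_comp[OF assms weyl_inv[OF assms], of v] rho_comp[OF weyl_inv[OF assms] assms, of v] assms by simp_all

text \<open>The span of the finite orbit of a nonzero vector is invariant, so irreducibility makes
  it the whole space.\<close>

lemma finite_dim_representation:
  obtains B :: "'v set" where "finite B" "complex_vector.independent B" "cspan B = UNIV"
proof -
  obtain v :: 'v where v: "v \<noteq> 0" using irreducible unfolding irreducible_representation_def by blast
  let ?O = "(\<lambda>w. \<rho> w v) ` weyl_group h"
  have "\<rho> u ` cspan ?O \<subseteq> cspan ?O" if u: "u \<in> weyl_group h" for u
  proof (rule image_subsetI)
    fix x assume "x \<in> cspan ?O"
    then show "\<rho> u x \<in> cspan ?O"
    proof (rule span_image_semilinear[where \<sigma> = "\<lambda>c. c"])
      fix a assume "a \<in> ?O"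
      then obtain w where "w \<in> weyl_group h" "a = \<rho> w v" by blast
      then have "\<rho> u a \<in> ?O" using rho_comp[OF u, of w v] weyl_comp[OF u] by (metis imageI)
      then show "\<rho> u a \<in> cspan ?O" by (rule complex_vector.span_base)
    qed (simp_all add: rho_0[OF u] rho_add[OF u] rho_scale[OF u])
  qed
  then have "cspan ?O = {0} \<or> cspan ?O = UNIV"
    using irreducible complex_vector.subspace_span unfolding irreducible_representation_def by blast
  moreover have "\<rho> id v \<in> cspan ?O" using weyl_group.id by (intro complex_vector.span_base) blast
  ultimately have "cspan ?O = UNIV" using v by auto
  moreover have "finite ?O" using finite_weyl by blast
  ultimately obtain C :: "'v set" where "finite C" "cspan C = UNIV" "complex_vector.independent C"
    using finite_UNIV_basis by blast
  then show thesis by (intro that)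
qed

definition basis :: "'v set"
  where "basis = (SOME B. finite B \<and> complex_vector.independent B \<and> cspan B = UNIV)"

lemma basis: "finite basis" "complex_vector.independent basis" "cspan basis = UNIV"
proof -
  have "\<exists>B :: 'v set. finite B \<and> complex_vector.independent B \<and> cspan B = UNIV"
    by (rule finite_dim_representation) blast
  from someI_ex[OF this] show "finite basis" "complex_vector.independent basis" "cspan basis = UNIV"
    unfolding basis_def by blast+
qed

definition coord :: "'v \<Rightarrow> 'v \<Rightarrow> complex"
  where "coord b v = complex_vector.representation basis v b"

lemma coord_add: "coord b (u + v) = coord b u + coord b v"
  unfolding coord_def using complex_vector.representation_add[OF basis(2), of v u] basis(3) by simp

lemma coord_scale: "coord b (c *\<^sub>C v) = c * coord b v"
  unfolding coord_def using complex_vector.representation_scale[OF basis(2), of v c] basis(3) by simp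

lemma coord_sum: "(\<Sum>b\<in>basis. coord b v *\<^sub>C b) = v"
  unfolding coord_def using complex_vector.sum_representation_eq[OF basis(2), of v basis] basis by simp

lemma coord_unique:
  assumes "(\<Sum>b\<in>basis. c b *\<^sub>C b) = (\<Sum>b\<in>basis. d b *\<^sub>C b)" "b \<in> basis"
  shows "c b = d b"
proof -
  have "(\<Sum>b\<in>basis. (c b - d b) *\<^sub>C b) = 0"
    using assms(1) by (simp add: complex_vector.scale_left_diff_distrib sum_subtractf)
  then have "c b - d b = 0"
    using complex_vector.independentD[OF basis(2,1) order_refl, of "\<lambda>b. c b - d b"] assms(2) by blast
  then show ?thesis by simp
qed

text \<open>The standard Hermitian form in the coordinates of \<open>basis\<close>, averaged over
  the group; linear in the first argument and antilinear in the second.\<close>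

definition form :: "'v \<Rightarrow> 'v \<Rightarrow> complex"
  where "form u v = (\<Sum>w\<in>weyl_group h. \<Sum>b\<in>basis. coord b (\<rho> w u) * cnj (coord b (\<rho> w v)))"

lemma form_add_left: "form (u + v) x = form u x + form v x"
  unfolding form_def sum.distrib[symmetric]
  by (intro sum.cong refl) (simp add: rho_add coord_add algebra_simps)

lemma form_scale_left: "form (c *\<^sub>C u) x = c * form u x"
  unfolding form_def sum_distrib_left
  by (intro sum.cong refl) (simp add: rho_scale coord_scale algebra_simps)

lemma form_cnj: "form u v = cnj (form v u)"
  unfolding form_def by (simp add: mult.commute)

lemma form_add_right: "form x (u + v) = form x u + form x v"
  using form_cnj[of x] form_add_left by simp

lemma form_scale_right: "form x (c *\<^sub>C u) = cnj c * form x u"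
  using form_cnj[of x] form_scale_left by simp

lemma form_0 [simp]: "form x 0 = 0" "form 0 x = 0"
  using form_scale_right[of x 0 0] form_scale_left[of 0 0 x] by simp_all

lemma form_sum_left: "form (sum f A) x = (\<Sum>a\<in>A. form (f a) x)"
  by (induction A rule: infinite_finite_induct) (simp_all add: form_add_left)

lemma form_sum_right: "form x (sum f A) = (\<Sum>a\<in>A. form x (f a))"
  by (induction A rule: infinite_finite_induct) (simp_all add: form_add_right)

lemma form_rho:
  assumes w: "w \<in> weyl_group h"
  shows "form (\<rho> w u) (\<rho> w v) = form u v"
proof -
  have "form (\<rho> w u) (\<rho> w v) =
      (\<Sum>x\<in>weyl_group h. \<Sum>b\<in>basis. coord b (\<rho> (x \<circ> w) u) * cnj (coord b (\<rho> (x \<circ> w) v)))"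
    unfolding form_def using w by (intro sum.cong refl) (simp add: rho_comp)
  also have "\<dots> = form u v"
    unfolding form_def
    by (rule sum_weyl_right[OF w, of "\<lambda>x. \<Sum>b\<in>basis. coord b (\<rho> x u) * cnj (coord b (\<rho> x v))"])
  finally show ?thesis .
qed

lemma form_definite:
  assumes "form v v = 0"
  shows "v = 0"
proof -
  have "form v v = of_real (\<Sum>w\<in>weyl_group h. \<Sum>b\<in>basis. (cmod (coord b (\<rho> w v)))\<^sup>2)"
    unfolding form_def by (simp only: of_real_sum complex_norm_square)
  then have "complex_of_real (\<Sum>w\<in>weyl_group h. \<Sum>b\<in>basis. (cmod (coord b (\<rho> w v)))\<^sup>2) = 0"
    using assms by (rule trans[OF sym])
  then have "(\<Sum>w\<in>weyl_group h. \<Sum>b\<in>basis. (cmod (coord b (\<rho> w v)))\<^sup>2) = 0"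
    by (simp only: of_real_eq_0_iff)
  then have "\<forall>w\<in>weyl_group h. (\<Sum>b\<in>basis. (cmod (coord b (\<rho> w v)))\<^sup>2) = 0"
    by (subst (asm) sum_nonneg_eq_0_iff[OF finite_weyl]) (auto intro: sum_nonneg)
  then have "(\<Sum>b\<in>basis. (cmod (coord b (\<rho> id v)))\<^sup>2) = 0" using weyl_group.id by blast
  then have "\<forall>b\<in>basis. (cmod (coord b v))\<^sup>2 = 0"
    by (subst (asm) sum_nonneg_eq_0_iff[OF basis(1)]) auto
  then have "(\<Sum>b\<in>basis. coord b v *\<^sub>C b) = 0" by (intro sum.neutral) simp
  then show ?thesis unfolding coord_sum .
qed

lemma form_eqI:
  assumes "\<And>u. form u v = form u v'"
  shows "v = v'"
proof -
  have "form (v - v') (v + (- 1) *\<^sub>C v') = 0"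
    unfolding form_add_right form_scale_right using assms by simp
  then show ?thesis using form_definite[of "v - v'"] by simp
qed

lemma form_eqI_basis:
  assumes "\<And>b. b \<in> basis \<Longrightarrow> form b v = form b v'"
  shows "v = v'"
proof (rule form_eqI)
  fix u
  have "form (\<Sum>b\<in>basis. coord b u *\<^sub>C b) v = form (\<Sum>b\<in>basis. coord b u *\<^sub>C b) v'"
    unfolding form_sum_left form_scale_left using assms by simp
  then show "form u v = form u v'" unfolding coord_sum .
qed

text \<open>The map \<open>L\<close> that records the products with the basis vectors is injective
  by definiteness, hence surjective by dimension; the dual basis is the preimage of the
  basis.\<close>

lemma dual_basis:
  obtains d where "\<And>b b'. b \<in> basis \<Longrightarrow> b' \<in> basis \<Longrightarrow> form b' (d b) = (if b = b' then 1 else 0)"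
proof -
  interpret fd: finite_dimensional_vector_space "scaleC :: complex \<Rightarrow> 'v \<Rightarrow> 'v" basis
    by unfold_locales (use basis in auto)
  define L where "L v = (\<Sum>b\<in>basis. form v b *\<^sub>C b)" for v
  have L: "clinear L"
    by (rule clinearI)
      (simp_all add: L_def form_add_left form_scale_left scaleC_add_left sum.distrib complex_vector.scale_sum_right)
  have "inj L"
  proof (rule injI)
    fix u v assume "L u = L v"
    then have "(\<Sum>b\<in>basis. form u b *\<^sub>C b) = (\<Sum>b\<in>basis. form v b *\<^sub>C b)" by (simp only: L_def)
    then have "form u b = form v b" if "b \<in> basis" for b using coord_unique that by blast
    then have "form b u = form b v" if "b \<in> basis" for b using that form_cnj[of b u] form_cnj[of b v] by simp
    then show "u = v" by (rule form_eqI_basis)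
  qed
  then have surj: "surj L" using fd.linear_inj_imp_surj[OF L] by blast
  define d where "d b = inv L b" for b
  have Ld: "L (d b) = b" for b unfolding d_def by (rule surj_f_inv_f[OF surj])
  have "form b' (d b) = (if b = b' then 1 else 0)" if "b \<in> basis" "b' \<in> basis" for b b'
  proof -
    have "(\<Sum>b'\<in>basis. (if b = b' then 1 else 0) *\<^sub>C b') = (\<Sum>b'\<in>basis. if b = b' then b' else 0)"
      by (rule sum.cong[OF refl]) (simp add: scaleC_one)
    also have "\<dots> = b" using that basis(1) by (simp add: sum.delta')
    finally have "(\<Sum>b'\<in>basis. form (d b) b' *\<^sub>C b') = (\<Sum>b'\<in>basis. (if b = b' then 1 else 0) *\<^sub>C b')"
      using Ld[of b] by (simp add: L_def)
    then have "form (d b) b' = (if b = b' then 1 else 0)"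
      using coord_unique[of "form (d b)" "\<lambda>b'. if b = b' then 1 else 0"] that(2) by blast
    then show ?thesis using form_cnj[of b' "d b"] by simp
  qed
  then show thesis by (rule that)
qed

text \<open>Here \<open>h\<close> has degree one, so the degrees are half of those in the canonical filtration.\<close>

definition poly_maps :: "nat set \<Rightarrow> (('g \<Rightarrow> complex) \<Rightarrow> 'v) set"
  where "poly_maps D = cspan {(\<lambda>l. p l *\<^sub>C v) |p v k. k \<in> D \<and> p \<in> sym_power h k}"

definition equivariant :: "nat set \<Rightarrow> (('g \<Rightarrow> complex) \<Rightarrow> 'v) set"
  where "equivariant D = {f \<in> poly_maps D. \<forall>w\<in>weyl_group h. \<forall>l\<in>dual h. f (w l) = \<rho> w (f l)}"

lemma equivariant_maps_eq: "equivariant_maps h \<rho> n = equivariant {d. 2 * int d \<le> n}"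
proof -
  let ?A = "{(\<lambda>l. p l *\<^sub>C v) |p v k. k \<le> n \<and> p \<in> sym_degree h k} :: (('g \<Rightarrow> complex) \<Rightarrow> 'v) set"
  have "?A \<subseteq> poly_maps {d. 2 * int d \<le> n}"
  proof clarify
    fix p v k assume k: "k \<le> n" "p \<in> sym_degree h k"
    show "(\<lambda>l. p l *\<^sub>C v) \<in> poly_maps {d. 2 * int d \<le> n}"
    proof (cases rule: sym_degree_cases[of k])
      case (1 d)
      then show ?thesis unfolding poly_maps_def using k by (intro complex_vector.span_base) blast
    next
      case 2
      then have eq: "(\<lambda>l. p l *\<^sub>C v) = 0" using k by (simp add: fun_eq_iff)
      show ?thesis unfolding eq poly_maps_def by (rule complex_vector.span_zero)
    qed
  qed
  then have "cspan ?A \<subseteq> poly_maps {d. 2 * int d \<le> n}"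
    unfolding poly_maps_def by (rule complex_vector.span_minimal) simp
  moreover have "poly_maps {d. 2 * int d \<le> n} \<subseteq> cspan ?A"
    unfolding poly_maps_def
  proof (intro complex_vector.span_mono subsetI)
    fix f :: "('g \<Rightarrow> complex) \<Rightarrow> 'v"
    assume "f \<in> {(\<lambda>l. p l *\<^sub>C v) |p v k. k \<in> {d. 2 * int d \<le> n} \<and> p \<in> sym_power h k}"
    then obtain p v k where f: "f = (\<lambda>l. p l *\<^sub>C v)" "2 * int k \<le> n" "p \<in> sym_power h k" by blast
    then have p: "p \<in> sym_degree h (2 * int k)" by (simp add: sym_degree_even)
    show "f \<in> ?A" unfolding f(1) mem_Collect_eq by (intro exI conjI) (rule refl, rule f(2), rule p)
  qed
  ultimately have "cspan ?A = poly_maps {d. 2 * int d \<le> n}" by (rule antisym)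
  then show ?thesis by (simp only: equivariant_maps_def equivariant_def)
qed

lemma subspace_poly_maps: "csubspace (poly_maps D)"
  by (simp add: poly_maps_def)

lemma subspace_equivariant: "csubspace (equivariant D)"
proof (rule complex_vector.subspaceI)
  show "0 \<in> equivariant D"
    using complex_vector.subspace_0[OF subspace_poly_maps] by (simp add: equivariant_def rho_0)
  show "f + g \<in> equivariant D" if "f \<in> equivariant D" "g \<in> equivariant D" for f g
    using that complex_vector.subspace_add[OF subspace_poly_maps] by (simp add: equivariant_def rho_add)
  show "c *\<^sub>C f \<in> equivariant D" if "f \<in> equivariant D" for c f
    using that complex_vector.subspace_scale[OF subspace_poly_maps] by (simp add: equivariant_def rho_scale)
qed

lemma equivariant_mono: "D \<subseteq> D' \<Longrightarrow> equivariant D \<subseteq> equivariant D'"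
  using complex_vector.span_mono[of "{(\<lambda>l. p l *\<^sub>C v) |p v k. k \<in> D \<and> p \<in> sym_power h k}"
      "{(\<lambda>l. p l *\<^sub>C v) |p v k. k \<in> D' \<and> p \<in> sym_power h k}"]
  unfolding equivariant_def poly_maps_def by blast

lemma equivariantD:
  "f \<in> equivariant D \<Longrightarrow> w \<in> weyl_group h \<Longrightarrow> l \<in> dual h \<Longrightarrow> f (w l) = \<rho> w (f l)"
  by (simp add: equivariant_def)

lemma tensor_poly_maps:
  assumes "p \<in> cspan (\<Union>d\<in>D. sym_power h d)"
  shows "(\<lambda>l. p l *\<^sub>C v) \<in> poly_maps D"
  using assms
proof (rule span_image_semilinear[where F = "\<lambda>p l. p l *\<^sub>C v" and \<sigma> = "\<lambda>c. c"])
  show "(\<lambda>l. a l *\<^sub>C v) \<in> poly_maps D" if "a \<in> (\<Union>d\<in>D. sym_power h d)" for a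
    unfolding poly_maps_def using that by (intro complex_vector.span_base) blast
qed (simp_all add: subspace_poly_maps fun_eq_iff scaleC_add_left)

lemma poly_maps_translate:
  assumes "f \<in> poly_maps D" "w \<in> weyl_group h" "u \<in> weyl_group h"
  shows "(\<lambda>l. \<rho> u (f (w l))) \<in> poly_maps D"
  using assms(1) unfolding poly_maps_def
proof (rule span_image_semilinear[where F = "\<lambda>f l. \<rho> u (f (w l))" and \<sigma> = "\<lambda>c. c"])
  fix a :: "('g \<Rightarrow> complex) \<Rightarrow> 'v" assume "a \<in> {(\<lambda>l. p l *\<^sub>C v) |p v k. k \<in> D \<and> p \<in> sym_power h k}"
  then obtain p v k where a: "a = (\<lambda>l. p l *\<^sub>C v)" "k \<in> D" "p \<in> sym_power h k" by blast
  have "(\<lambda>l. \<rho> u (a (w l))) = (\<lambda>l. (p \<circ> w) l *\<^sub>C \<rho> u v)"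
    using rho_scale[OF assms(3)] by (simp add: a fun_eq_iff)
  moreover have "p \<circ> w \<in> sym_power h k" by (rule sym_power_weyl[OF assms(2) a(3)])
  ultimately have "(\<lambda>l. \<rho> u (a (w l))) \<in> {(\<lambda>l. p l *\<^sub>C v) |p v k. k \<in> D \<and> p \<in> sym_power h k}"
    using a(2) by blast
  then show "(\<lambda>l. \<rho> u (a (w l))) \<in> cspan {(\<lambda>l. p l *\<^sub>C v) |p v k. k \<in> D \<and> p \<in> sym_power h k}"
    by (rule complex_vector.span_base)
qed (simp_all add: fun_eq_iff rho_0[OF assms(3)] rho_add[OF assms(3)] rho_scale[OF assms(3)])

text \<open>The Reynolds operator for the action of the group on maps into the
  representation.\<close>

definition average :: "(('g \<Rightarrow> complex) \<Rightarrow> 'v) \<Rightarrow> ('g \<Rightarrow> complex) \<Rightarrow> 'v"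
  where "average f l = inverse (of_nat (card (weyl_group h))) *\<^sub>C (\<Sum>w\<in>weyl_group h. \<rho> (inv w) (f (w l)))"

lemma average_equivariant:
  assumes "f \<in> poly_maps D"
  shows "average f \<in> equivariant D"
proof -
  have "average f = inverse (of_nat (card (weyl_group h))) *\<^sub>C (\<Sum>w\<in>weyl_group h. (\<lambda>l. \<rho> (inv w) (f (w l))))"
    by (simp add: fun_eq_iff average_def sum_fun_apply)
  moreover have "(\<Sum>w\<in>weyl_group h. (\<lambda>l. \<rho> (inv w) (f (w l)))) \<in> poly_maps D"
    using poly_maps_translate[OF assms _ weyl_inv]
    by (intro complex_vector.subspace_sum[OF subspace_poly_maps])
  ultimately have "average f \<in> poly_maps D"
    using complex_vector.subspace_scale[OF subspace_poly_maps] by simp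
  moreover have "average f (u l) = \<rho> u (average f l)" if u: "u \<in> weyl_group h" for u l
  proof -
    have "\<rho> (inv w) (f (w (u l))) = \<rho> u (\<rho> (inv (w \<circ> u)) (f ((w \<circ> u) l)))" if w: "w \<in> weyl_group h" for w
    proof -
      have "inv (w \<circ> u) = inv u \<circ> inv w" using weyl_bij u w by (intro o_inv_distrib)
      then show ?thesis using rho_comp[OF weyl_inv[OF u] weyl_inv[OF w]] rho_inv(2)[OF u] by simp
    qed
    then have "(\<Sum>w\<in>weyl_group h. \<rho> (inv w) (f (w (u l)))) =
        (\<Sum>w\<in>weyl_group h. \<rho> u (\<rho> (inv (w \<circ> u)) (f ((w \<circ> u) l))))"
      by (rule sum.cong[OF refl])
    also have "\<dots> = (\<Sum>w\<in>weyl_group h. \<rho> u (\<rho> (inv w) (f (w l))))"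
      by (rule sum_weyl_right[OF u, of "\<lambda>w. \<rho> u (\<rho> (inv w) (f (w l)))"])
    finally show ?thesis by (simp add: average_def rho_scale[OF u] rho_sum[OF u])
  qed
  ultimately show ?thesis by (simp add: equivariant_def)
qed

text \<open>Only the values on the orbit of \<open>l\<close> enter. So a polynomial map that is
  equivariant just on this orbit can be replaced by an equivariant one with the same value at
  \<open>l\<close>.\<close>

lemma average_eq:
  assumes "\<And>w. w \<in> weyl_group h \<Longrightarrow> f (w l) = \<rho> w v"
  shows "average f l = v"
proof -
  have "(\<Sum>w\<in>weyl_group h. \<rho> (inv w) (f (w l))) = (\<Sum>w\<in>weyl_group h. v)"
    using assms rho_inv(1) by (intro sum.cong) auto
  then show ?thesis
    using card_weyl_nonzero by (simp add: average_def complex_vector.sum_constant_scale)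
qed

text \<open>Conjugating the argument makes the pairing polynomial, as the form is antilinear in \<open>f\<close>.\<close>

definition pairing :: "(('g \<Rightarrow> complex) \<Rightarrow> 'v) \<Rightarrow> 'v \<Rightarrow> ('g \<Rightarrow> complex) \<Rightarrow> complex"
  where "pairing f v = (\<lambda>l. form v (f (conj_dual l)))"

lemma pairing_linear:
  "pairing (f + g) v = pairing f v + pairing g v" "pairing (c *\<^sub>C f) v = cnj c *\<^sub>C pairing f v"
  "pairing f (u + v) = pairing f u + pairing f v" "pairing f (c *\<^sub>C v) = c *\<^sub>C pairing f v"
  by (simp_all add: pairing_def fun_eq_iff form_add_right form_scale_right form_add_left form_scale_left)

lemma conj_sym_power:
  assumes "p \<in> sym_power h d"
  shows "(\<lambda>l. cnj (p (conj_dual l))) \<in> sym_power h d"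
  using assms unfolding sym_power_monomial[of d]
proof (rule span_image_semilinear[where F = "\<lambda>p l. cnj (p (conj_dual l))" and \<sigma> = cnj])
  fix m assume "m \<in> {monomial xs |xs. set xs \<subseteq> h \<and> length xs = d}"
  then obtain xs where xs: "m = monomial xs" "set xs \<subseteq> h" "length xs = d" by blast
  have cnj_prod: "cnj (prod_list (map (conj_dual l) ys)) = prod_list (map l (map conj_h ys))"
    if "set ys \<subseteq> h" "l \<in> dual h" for l ys
    using that(1) by (induction ys) (simp_all add: conj_dual_eval[OF that(2)])
  have "(\<lambda>l. cnj (m (conj_dual l))) = monomial (map conj_h xs)"
  proof
    fix l
    show "cnj (m (conj_dual l)) = monomial (map conj_h xs) l"
    proof (cases "l \<in> dual h")
      case True
      then show ?thesis
        using cnj_prod[OF xs(2) True] conj_dual_dual[OF True] by (simp add: xs(1) monomial_def del: map_map)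
    next
      case False
      then have "conj_dual l = l" by (simp add: conj_dual_def)
      then show ?thesis using False by (simp add: xs(1) monomial_def)
    qed
  qed
  moreover have "monomial (map conj_h xs) \<in> sym_power h d"
    using xs conj_h_in by (intro monomial_in) auto
  ultimately show "(\<lambda>l. cnj (m (conj_dual l))) \<in> cspan {monomial xs |xs. set xs \<subseteq> h \<and> length xs = d}"
    unfolding sym_power_monomial by simp
qed (simp_all add: fun_eq_iff)

lemma conj_span_sym_power:
  assumes "p \<in> cspan (\<Union>d\<in>D. sym_power h d)"
  shows "(\<lambda>l. cnj (p (conj_dual l))) \<in> cspan (\<Union>d\<in>D. sym_power h d)"
  using assms
proof (rule span_image_semilinear[where F = "\<lambda>p l. cnj (p (conj_dual l))" and \<sigma> = cnj])
  fix a assume "a \<in> (\<Union>d\<in>D. sym_power h d)"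
  then have "(\<lambda>l. cnj (a (conj_dual l))) \<in> (\<Union>d\<in>D. sym_power h d)" using conj_sym_power by blast
  then show "(\<lambda>l. cnj (a (conj_dual l))) \<in> cspan (\<Union>d\<in>D. sym_power h d)" by (rule complex_vector.span_base)
qed (simp_all add: fun_eq_iff)

lemma pairing_polynomial:
  assumes "f \<in> poly_maps D"
  shows "pairing f v \<in> cspan (\<Union>d\<in>D. sym_power h d)"
  using assms unfolding poly_maps_def
proof (rule span_image_semilinear[where F = "\<lambda>f. pairing f v" and \<sigma> = cnj])
  fix a :: "('g \<Rightarrow> complex) \<Rightarrow> 'v" assume "a \<in> {(\<lambda>l. p l *\<^sub>C u) |p u k. k \<in> D \<and> p \<in> sym_power h k}"
  then obtain p u k where a: "a = (\<lambda>l. p l *\<^sub>C u)" "k \<in> D" "p \<in> sym_power h k" by blast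
  have eq: "pairing a v = form v u *\<^sub>C (\<lambda>l. cnj (p (conj_dual l)))"
    by (simp add: a pairing_def fun_eq_iff form_scale_right)
  have "(\<lambda>l. cnj (p (conj_dual l))) \<in> cspan (\<Union>d\<in>D. sym_power h d)"
    using conj_sym_power[OF a(3)] a(2) by (intro complex_vector.span_base) blast
  then show "pairing a v \<in> cspan (\<Union>d\<in>D. sym_power h d)"
    unfolding eq by (rule complex_vector.span_scale)
qed (simp_all add: pairing_def fun_eq_iff form_add_right form_scale_right)

lemma pairing_homogeneous:
  assumes "f \<in> equivariant {d}"
  shows "pairing f v \<in> sym_power h d"
proof -
  have "cspan (\<Union>d\<in>{d}. sym_power h d) = sym_power h d" using subspace_sym_power[of d] by simp
  moreover have "pairing f v \<in> cspan (\<Union>d\<in>{d}. sym_power h d)"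
    by (rule pairing_polynomial) (use assms in \<open>simp add: equivariant_def\<close>)
  ultimately show ?thesis by (simp only:)
qed

lemma pairing_below: "f \<in> equivariant {..<d} \<Longrightarrow> pairing f v \<in> sym_below d"
  using pairing_polynomial[of f "{..<d}" v] by (simp add: equivariant_def sym_below_def)

lemma equivariant_outside:
  assumes "f \<in> equivariant D" "l \<notin> dual h"
  shows "f l = 0"
proof -
  have "f \<in> cspan {(\<lambda>l. p l *\<^sub>C v) |p v k. k \<in> D \<and> p \<in> sym_power h k}"
    using assms(1) by (simp add: equivariant_def poly_maps_def)
  then show ?thesis
    by (induction rule: complex_vector.span_induct_alt) (use assms(2) sym_power_outside in auto)
qed

lemma pairing_rho:
  assumes "f \<in> equivariant D" "w \<in> weyl_group h"
  shows "pairing f (\<rho> w v) = pairing f v \<circ> inv w"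
proof
  fix l
  show "pairing f (\<rho> w v) l = (pairing f v \<circ> inv w) l"
  proof (cases "l \<in> dual h")
    case True
    note iw = weyl_inv[OF assms(2)]
    have "f (conj_dual (inv w l)) = \<rho> (inv w) (f (conj_dual l))"
      using equivariantD[OF assms(1) iw conj_dual_dual[OF True]] conj_dual_weyl[OF iw] by simp
    then have "form v (f (conj_dual (inv w l))) = form (\<rho> w v) (f (conj_dual l))"
      using form_rho[OF assms(2), of v "\<rho> (inv w) (f (conj_dual l))"] rho_inv(2)[OF assms(2)] by simp
    then show ?thesis by (simp add: pairing_def)
  next
    case False
    then show ?thesis
      using weyl_outside[OF weyl_inv[OF assms(2)] False] equivariant_outside[OF assms(1) False]
      by (simp add: pairing_def conj_dual_def)
  qed
qed

text \<open>The conjugated \<open>q b\<close> are taken as coefficients of the dual basis; the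
  conjugation in \<open>pairing\<close> undoes this.\<close>

lemma map_from_pairings:
  assumes "\<And>b. b \<in> basis \<Longrightarrow> q b \<in> cspan (\<Union>d\<in>D. sym_power h d)"
  obtains f where "f \<in> poly_maps D" "\<And>b. b \<in> basis \<Longrightarrow> pairing f b = q b"
proof -
  obtain d where d: "\<And>b b'. b \<in> basis \<Longrightarrow> b' \<in> basis \<Longrightarrow> form b' (d b) = (if b = b' then 1 else 0)"
    by (rule dual_basis) (rule that)
  define f where "f = (\<Sum>b\<in>basis. (\<lambda>l. cnj (q b (conj_dual l)) *\<^sub>C d b))"
  have "f \<in> poly_maps D"
    unfolding f_def using assms
    by (intro complex_vector.subspace_sum[OF subspace_poly_maps] tensor_poly_maps conj_span_sym_power)
  moreover have "pairing f b' = q b'" if b': "b' \<in> basis" for b'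
  proof
    fix l
    have "pairing f b' l = (\<Sum>b\<in>basis. q b l * form b' (d b))"
      by (simp add: pairing_def f_def sum_fun_apply form_sum_right form_scale_right conj_dual_involution)
    also have "\<dots> = (\<Sum>b\<in>basis. if b = b' then q b l else 0)"
      by (rule sum.cong[OF refl]) (simp add: d b')
    also have "\<dots> = q b' l" using b' basis(1) by simp
    finally show "pairing f b' l = q b' l" .
  qed
  ultimately show thesis by (rule that)
qed

end


section \<open>The canonical filtration\<close>

context weyl_representation
begin

definition value_space :: "('g \<Rightarrow> complex) \<Rightarrow> nat set \<Rightarrow> 'v set"
  where "value_space l D = (\<lambda>f. f l) ` equivariant D"

lemma canonical_filtration_eq:
  "canonical_filtration h \<rho> l m = value_space l {d. 2 * int d \<le> m + 2 * int (flag_dim h)}"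
  unfolding canonical_filtration_def equivariant_maps_eq value_space_def by blast

lemma subspace_value_space: "csubspace (value_space l D)"
proof -
  have "clinear (\<lambda>f :: ('g \<Rightarrow> complex) \<Rightarrow> 'v. f l)" by (rule clinearI) simp_all
  then show ?thesis
    unfolding value_space_def by (rule complex_vector.linear_subspace_image[OF _ subspace_equivariant])
qed

lemma value_space_mono: "D \<subseteq> D' \<Longrightarrow> value_space l D \<subseteq> value_space l D'"
  unfolding value_space_def using equivariant_mono by (intro image_mono)

lemma value_space_empty: "value_space l {} = {0}"
proof -
  have "poly_maps {} = {0}" by (simp add: poly_maps_def)
  then have "value_space l {} \<subseteq> {0}" by (auto simp: value_space_def equivariant_def)
  then show ?thesis using complex_vector.subspace_0[OF subspace_value_space] by blast
qed

lemma average_value_space: "f \<in> poly_maps D \<Longrightarrow> average f l \<in> value_space l D"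
  unfolding value_space_def using average_equivariant by blast

text \<open>Take the map \<open>q l *\<^sub>C v\<close> with \<open>q\<close> equal to 1 at
  \<open>l\<close> and 0 on the rest of the orbit. In its average at \<open>l\<close> only the
  identity contributes, which gives \<open>v\<close> up to the order of the group.\<close>

lemma value_space_UNIV:
  assumes "l \<in> regular h"
  obtains n where "value_space l {..<n} = UNIV"
proof -
  obtain n where n: "\<And>v. \<exists>q\<in>sym_below n. \<forall>w\<in>weyl_group h. q (w l) = v w"
    by (rule orbit_interpolation[OF assms]) (rule that)
  obtain q where q: "q \<in> sym_below n" "\<forall>w\<in>weyl_group h. q (w l) = (if w = id then 1 else 0)"
    using n[of "\<lambda>w. if w = id then 1 else 0"] by blast
  have "v \<in> value_space l {..<n}" for v
  proof -
    let ?n = "of_nat (card (weyl_group h)) :: complex"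
    let ?f = "\<lambda>l. q l *\<^sub>C v"
    have "(\<Sum>w\<in>weyl_group h. \<rho> (inv w) (?f (w l))) = (\<Sum>w\<in>weyl_group h. if w = id then v else 0)"
      using q(2) by (intro sum.cong) (auto simp: rho_0[OF weyl_inv] scaleC_one)
    also have "\<dots> = v" using finite_weyl weyl_group.id[of h] by (simp add: sum.delta)
    finally have "average ?f l = inverse ?n *\<^sub>C v" by (simp add: average_def)
    moreover have "average ?f l \<in> value_space l {..<n}"
      using q(1) unfolding sym_below_def by (intro average_value_space tensor_poly_maps)
    ultimately have "inverse ?n *\<^sub>C v \<in> value_space l {..<n}" by simp
    then have "?n *\<^sub>C (inverse ?n *\<^sub>C v) \<in> value_space l {..<n}"
      by (rule complex_vector.subspace_scale[OF subspace_value_space])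
    then show ?thesis using card_weyl_nonzero by simp
  qed
  then show thesis by (intro that[of n]) blast
qed

section \<open>Comparison of the graded pieces with homomorphisms into the cohomology\<close>

definition cohomology_hom :: "(('g \<Rightarrow> complex) \<Rightarrow> 'v) \<Rightarrow> 'v \<Rightarrow> ('g \<Rightarrow> complex) \<Rightarrow> complex"
  where "cohomology_hom f v = coset_rep (coinvariant_ideal h) (pairing f v)"

lemmas ideal_rep = coset_rep[OF subspace_coinvariant_ideal]
lemmas ideal_rep_add = complex_vector.linear_add[OF ideal_rep(1)]
lemmas ideal_rep_scale = complex_vector.linear_scale[OF ideal_rep(1)]

lemma cohomology_hom_linear: "clinear (cohomology_hom f)"
  by (rule clinearI) (simp_all only: cohomology_hom_def pairing_linear ideal_rep_add ideal_rep_scale)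

lemma cohomology_hom_in:
  assumes "f \<in> equivariant {d}"
  shows "cohomology_hom f \<in> weyl_hom h \<rho> (2 * int d)"
  unfolding weyl_hom_def
proof (intro CollectI conjI ballI allI cohomology_hom_linear)
  show "range (cohomology_hom f) \<subseteq> flag_cohomology h (2 * int d)"
    unfolding flag_cohomology_def quotient_space_def sym_degree_even cohomology_hom_def
    using pairing_homogeneous[OF assms] by blast
  fix w v assume w: "w \<in> weyl_group h"
  let ?p = "pairing f v"
  have "(?p - coset_rep (coinvariant_ideal h) ?p) \<circ> inv w \<in> coinvariant_ideal h"
    by (rule coinvariant_ideal_weyl[OF weyl_inv[OF w] ideal_rep(3)])
  moreover have "(?p - coset_rep (coinvariant_ideal h) ?p) \<circ> inv w =
      (?p \<circ> inv w) - (coset_rep (coinvariant_ideal h) ?p \<circ> inv w)"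
    by (simp add: fun_eq_iff)
  ultimately have "(?p \<circ> inv w) - (coset_rep (coinvariant_ideal h) ?p \<circ> inv w) \<in> coinvariant_ideal h"
    by (simp only:)
  then show "cohomology_hom f (\<rho> w v) = flag_cohomology_action h w (cohomology_hom f v)"
    unfolding cohomology_hom_def flag_cohomology_action_def pairing_rho[OF assms w]
    by (rule coset_rep_eqI[OF subspace_coinvariant_ideal])
qed

lemma clinear_eq_basis:
  assumes "clinear F" "clinear G" "\<And>b. b \<in> basis \<Longrightarrow> F b = G b"
  shows "F v = G v"
proof -
  have "F (\<Sum>b\<in>basis. coord b v *\<^sub>C b) = G (\<Sum>b\<in>basis. coord b v *\<^sub>C b)"
    unfolding complex_vector.linear_sum[OF assms(1)] complex_vector.linear_sum[OF assms(2)]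
      complex_vector.linear_scale[OF assms(1)] complex_vector.linear_scale[OF assms(2)]
    using assms(3) by (intro sum.cong) auto
  then show ?thesis unfolding coord_sum .
qed

lemma pairing_average:
  "pairing (average f) v =
    inverse (of_nat (card (weyl_group h))) *\<^sub>C (\<Sum>w\<in>weyl_group h. pairing f (\<rho> w v) \<circ> w)"
proof
  fix l
  have "form v (\<rho> (inv w) (f (w (conj_dual l)))) = (pairing f (\<rho> w v) \<circ> w) l"
    if w: "w \<in> weyl_group h" for w
    using form_rho[OF w, of v "\<rho> (inv w) (f (w (conj_dual l)))"] rho_inv(2)[OF w] conj_dual_weyl[OF w]
    by (simp add: pairing_def)
  then have "(\<Sum>w\<in>weyl_group h. form v (\<rho> (inv w) (f (w (conj_dual l))))) =
      (\<Sum>w\<in>weyl_group h. (pairing f (\<rho> w v) \<circ> w) l)"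
    by (rule sum.cong[OF refl])
  then show "pairing (average f) v l =
      (inverse (of_nat (card (weyl_group h))) *\<^sub>C (\<Sum>w\<in>weyl_group h. pairing f (\<rho> w v) \<circ> w)) l"
    by (simp add: pairing_def average_def form_scale_right form_sum_right sum_fun_apply)
qed

text \<open>Lifting the values of \<phi> on a basis to polynomials gives a map \<open>f0\<close>
  whose pairings represent \<phi>. As \<phi> is equivariant modulo the ideal, averaging
  \<open>f0\<close> changes the pairings by elements of the ideal only.\<close>

lemma cohomology_hom_surj:
  assumes "\<phi> \<in> weyl_hom h \<rho> (2 * int d)"
  shows "\<phi> \<in> cohomology_hom ` equivariant {d}"
proof -
  let ?I = "coinvariant_ideal h" and ?r = "coset_rep (coinvariant_ideal h)"
  have \<phi>: "clinear \<phi>" "range \<phi> \<subseteq> ?r ` sym_power h d"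
    "\<And>w v. w \<in> weyl_group h \<Longrightarrow> \<phi> (\<rho> w v) = ?r (\<phi> v \<circ> inv w)"
    using assms
    unfolding weyl_hom_def flag_cohomology_def quotient_space_def sym_degree_even flag_cohomology_action_def
    by blast+
  have "\<forall>b. \<exists>p. p \<in> sym_power h d \<and> \<phi> b = ?r p" using \<phi>(2) by blast
  then obtain p where p: "\<And>b. p b \<in> sym_power h d" "\<And>b. \<phi> b = ?r (p b)" by metis
  have "p b \<in> cspan (\<Union>d\<in>{d}. sym_power h d)" for b
    using p(1)[of b] by (intro complex_vector.span_base) blast
  then obtain f0 where f0: "f0 \<in> poly_maps {d}" "\<And>b. b \<in> basis \<Longrightarrow> pairing f0 b = p b"
    using map_from_pairings[of p "{d}"] by metis
  have rep: "?r (pairing f0 v) = \<phi> v" for v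
    unfolding cohomology_hom_def[symmetric]
    by (rule clinear_eq_basis[OF cohomology_hom_linear \<phi>(1)]) (simp add: cohomology_hom_def f0(2) p(2))
  have diff: "pairing f0 v - \<phi> v \<in> ?I" for v
    using ideal_rep(3)[of "pairing f0 v"] unfolding rep .
  define f where "f = average f0"
  have f: "f \<in> equivariant {d}" unfolding f_def by (rule average_equivariant[OF f0(1)])
  have "pairing f v - \<phi> v \<in> ?I" for v
  proof -
    have *: "(pairing f0 (\<rho> w v) \<circ> w) - \<phi> v \<in> ?I" if w: "w \<in> weyl_group h" for w
    proof -
      have "(\<phi> v \<circ> inv w) - \<phi> (\<rho> w v) \<in> ?I"
        using ideal_rep(3)[of "\<phi> v \<circ> inv w"] unfolding \<phi>(3)[OF w] .
      then have "(pairing f0 (\<rho> w v) - \<phi> (\<rho> w v)) - ((\<phi> v \<circ> inv w) - \<phi> (\<rho> w v)) \<in> ?I"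
        by (rule coinvariant_ideal_simps(3)[OF diff])
      then have "((pairing f0 (\<rho> w v) - \<phi> (\<rho> w v)) - ((\<phi> v \<circ> inv w) - \<phi> (\<rho> w v))) \<circ> w \<in> ?I"
        by (rule coinvariant_ideal_weyl[OF w])
      moreover have "((pairing f0 (\<rho> w v) - \<phi> (\<rho> w v)) - ((\<phi> v \<circ> inv w) - \<phi> (\<rho> w v))) \<circ> w =
          (pairing f0 (\<rho> w v) \<circ> w) - \<phi> v"
        using weyl_inv_apply(1)[OF w] by (intro ext) simp
      ultimately show ?thesis by (simp only:)
    qed
    let ?n = "of_nat (card (weyl_group h)) :: complex"
    have "pairing f v - \<phi> v = inverse ?n *\<^sub>C (\<Sum>w\<in>weyl_group h. (pairing f0 (\<rho> w v) \<circ> w) - \<phi> v)"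
      unfolding f_def pairing_average sum_subtractf
      using card_weyl_nonzero by (intro ext) (simp add: sum_fun_apply field_simps)
    also have "\<dots> \<in> ?I"
      by (intro coinvariant_ideal_simps(4) coinvariant_ideal_simps(5) *)
    finally show ?thesis .
  qed
  then have "?r (pairing f v) = ?r (\<phi> v)" for v by (rule coset_rep_eqI[OF subspace_coinvariant_ideal])
  \<comment> \<open>The values of \<phi> are already chosen representatives, and choosing a
    representative again does not change them.\<close>
  moreover have "?r (\<phi> v) = \<phi> v" for v
    using coset_rep_eqI[OF subspace_coinvariant_ideal diff[of v]] rep[of v] by simp
  ultimately have "cohomology_hom f = \<phi>" by (intro ext[of "cohomology_hom f"]) (simp only: cohomology_hom_def)
  then show ?thesis using f by blast
qed

lemma pairing_orbit:
  assumes "w \<in> weyl_group h"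
  shows "pairing f v (w (conj_dual l)) = form v (f (w l))"
  using conj_dual_weyl[OF assms, of "conj_dual l"] by (simp add: pairing_def conj_dual_involution)

text \<open>The pairings of \<open>f\<close> on the orbit of \<open>conj_dual l\<close> are the
  products with the values of \<open>f\<close> on the orbit of \<open>l\<close>. Forward, a
  lower-degree map with the same value at \<open>l\<close> makes the leading forms lie in the ideal.
  Backward, the lower-degree polynomials for the basis vectors assemble to a map whose average has
  the value \<open>f l\<close>.\<close>

lemma kernels_agree:
  assumes l: "l \<in> regular h" and f: "f \<in> equivariant {d}"
  shows "f l \<in> value_space l {..<d} \<longleftrightarrow> (\<forall>v. pairing f v \<in> coinvariant_ideal h)"
proof
  have ld: "l \<in> dual h" using l by (rule regular_dual)
  assume "f l \<in> value_space l {..<d}"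
  then obtain g where g: "g \<in> equivariant {..<d}" "f l = g l" unfolding value_space_def by blast
  have "pairing f v \<in> coinvariant_ideal h" for v
  proof (rule leading_form_in_ideal[OF regular_conj_dual[OF l] pairing_homogeneous[OF f] pairing_below[OF g(1)]])
    fix w assume w: "w \<in> weyl_group h"
    show "pairing f v (w (conj_dual l)) = pairing g v (w (conj_dual l))"
      unfolding pairing_orbit[OF w] equivariantD[OF f w ld] equivariantD[OF g(1) w ld] g(2) ..
  qed
  then show "\<forall>v. pairing f v \<in> coinvariant_ideal h" by blast
next
  have ld: "l \<in> dual h" using l by (rule regular_dual)
  assume *: "\<forall>v. pairing f v \<in> coinvariant_ideal h"
  have "\<exists>q\<in>sym_below d. \<forall>w\<in>weyl_group h. pairing f b (w (conj_dual l)) = q (w (conj_dual l))" for b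
    using * by (intro ideal_lower_on_orbit[OF conj_dual_dual[OF ld] pairing_homogeneous[OF f]]) blast
  then obtain q where q: "\<And>b. q b \<in> sym_below d"
    "\<And>b w. w \<in> weyl_group h \<Longrightarrow> pairing f b (w (conj_dual l)) = q b (w (conj_dual l))" by metis
  obtain g where g: "g \<in> poly_maps {..<d}" "\<And>b. b \<in> basis \<Longrightarrow> pairing g b = q b"
    using map_from_pairings[of q "{..<d}"] q(1) unfolding sym_below_def by metis
  have "g (w l) = \<rho> w (f l)" if w: "w \<in> weyl_group h" for w
    unfolding equivariantD[OF f w ld, symmetric]
  proof (rule form_eqI_basis)
    fix b assume "b \<in> basis"
    then show "form b (g (w l)) = form b (f (w l))"
      using q(2)[OF w, of b] g(2) unfolding pairing_orbit[OF w, symmetric] by simp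
  qed
  then have "average g l = f l" by (rule average_eq)
  then show "f l \<in> value_space l {..<d}" using average_value_space[OF g(1), of l] by simp
qed

text \<open>A splitting of \<open>f\<close> into a part of degree \<open>d\<close> and a lower part
  comes from the span and need not be equivariant; averaging the two parts repairs this without
  changing their sum at \<open>l\<close>.\<close>

lemma quotient_value_space:
  assumes "l \<in> dual h"
  shows "quotient_space (value_space l {..<Suc d}) (value_space l {..<d}) =
    (\<lambda>f. coset_rep (value_space l {..<d}) (f l)) ` equivariant {d}"
proof -
  let ?V = "value_space l {..<d}"
  have "coset_rep ?V (f l) \<in> (\<lambda>f. coset_rep ?V (f l)) ` equivariant {d}" if f: "f \<in> equivariant {..<Suc d}" for f
  proof -
    let ?A = "\<lambda>D. {(\<lambda>l. p l *\<^sub>C v) |p v k. k \<in> D \<and> p \<in> sym_power h k} :: (('g \<Rightarrow> complex) \<Rightarrow> 'v) set"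
    have "?A {..<Suc d} = ?A {d} \<union> ?A {..<d}" by (auto simp: less_Suc_eq)
    then have "f \<in> cspan (?A {d} \<union> ?A {..<d})" using f by (simp only: equivariant_def poly_maps_def mem_Collect_eq)
    then obtain t g where tg: "f = t + g" "t \<in> poly_maps {d}" "g \<in> poly_maps {..<d}"
      unfolding complex_vector.span_Un poly_maps_def by blast
    have "f l = average f l"
      using average_eq[of f l "f l"] equivariantD[OF f _ assms] by simp
    also have "\<dots> = average t l + average g l"
      by (simp add: average_def tg(1) rho_add[OF weyl_inv] sum.distrib scaleC_add_right)
    finally have "f l - average t l \<in> ?V" using average_value_space[OF tg(3)] by simp
    then have "coset_rep ?V (f l) = coset_rep ?V (average t l)"
      by (rule coset_rep_eqI[OF subspace_value_space])
    then show ?thesis using average_equivariant[OF tg(2)] by blast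
  qed
  moreover have "equivariant {d} \<subseteq> equivariant {..<Suc d}" by (rule equivariant_mono) simp
  ultimately show ?thesis unfolding quotient_space_def value_space_def[of l "{..<Suc d}"] by blast
qed

text \<open>Both sides are images of the equivariant maps of degree \<open>d\<close>, one under a
  linear and one under an antilinear map with the same kernel.\<close>

lemma graded_dimension:
  assumes l: "l \<in> regular h"
  shows "cdim (quotient_space (value_space l {..<Suc d}) (value_space l {..<d})) = cdim (weyl_hom h \<rho> (2 * int d))"
proof -
  let ?V = "value_space l {..<d}"
  note r = coset_rep[OF subspace_value_space[of l "{..<d}"]]
  have "weyl_hom h \<rho> (2 * int d) = cohomology_hom ` equivariant {d}"
    using cohomology_hom_in cohomology_hom_surj by blast
  moreover have "cdim ((\<lambda>f. coset_rep ?V (f l)) ` equivariant {d}) = cdim (cohomology_hom ` equivariant {d})"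
  proof (rule dim_semilinear_image[OF subspace_equivariant])
    show "clinear (\<lambda>f. coset_rep ?V (f l))"
      by (rule clinearI) (simp_all add: complex_vector.linear_add[OF r(1)] complex_vector.linear_scale[OF r(1)])
    show "cohomology_hom (u + v) = cohomology_hom u + cohomology_hom v" for u v
      by (rule ext) (simp only: cohomology_hom_def pairing_linear ideal_rep_add plus_fun_apply)
    show "cohomology_hom (c *\<^sub>C u) = cnj c *\<^sub>C cohomology_hom u" for c u
      by (rule ext) (simp only: cohomology_hom_def pairing_linear ideal_rep_scale scaleC_fun_apply)
    fix f assume f: "f \<in> equivariant {d}"
    have "cohomology_hom f = 0 \<longleftrightarrow> (\<forall>v. pairing f v \<in> coinvariant_ideal h)"
      unfolding coset_rep_eq_0_iff[OF subspace_coinvariant_ideal, symmetric] cohomology_hom_def[symmetric]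
      by (metis ext zero_fun_apply)
    then show "coset_rep ?V (f l) = 0 \<longleftrightarrow> cohomology_hom f = 0"
      using kernels_agree[OF l f] coset_rep_eq_0_iff[OF subspace_value_space] by blast
  qed
  ultimately show ?thesis using quotient_value_space[OF regular_dual[OF l]] by simp
qed

lemma weyl_hom_above:
  assumes "l \<in> regular h" "flag_dim h < d"
  shows "cdim (weyl_hom h \<rho> (2 * int d)) = 0"
proof -
  have "sym_power h d \<subseteq> coinvariant_ideal h"
    using top_degree[OF assms(1)] card_half_roots_le_flag_dim assms(2) by simp
  then have "flag_cohomology h (2 * int d) \<subseteq> {0}"
    unfolding flag_cohomology_def quotient_space_def sym_degree_even using ideal_rep(2) by blast
  then have "\<phi> v = 0" if "\<phi> \<in> weyl_hom h \<rho> (2 * int d)" for \<phi> v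
    using that unfolding weyl_hom_def by blast
  then have "weyl_hom h \<rho> (2 * int d) \<subseteq> {0}" by (auto simp: fun_eq_iff)
  then have "weyl_hom h \<rho> (2 * int d) \<subseteq> cspan {}" by simp
  then have "cdim (weyl_hom h \<rho> (2 * int d)) \<le> card ({} :: ('v \<Rightarrow> ('g \<Rightarrow> complex) \<Rightarrow> complex) set)"
    by (rule complex_vector.dim_le_card) simp
  then show ?thesis by simp
qed

section \<open>The filtration and its Hilbert series\<close>

lemma canonical_filtration_is_filtration:
  assumes "l \<in> regular h"
  shows "is_filtration (canonical_filtration h \<rho> l)"
  unfolding is_filtration_def
proof (intro conjI allI)
  show "csubspace (canonical_filtration h \<rho> l m)" for m
    unfolding canonical_filtration_eq by (rule subspace_value_space)
  show "mono (canonical_filtration h \<rho> l)"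
    unfolding canonical_filtration_eq[abs_def] by (intro monoI value_space_mono) auto
  obtain n where n: "value_space l {..<n} = UNIV" by (rule value_space_UNIV[OF assms])
  have "{..<n} \<subseteq> {d. 2 * int d \<le> 2 * int n + 2 * int (flag_dim h)}" by auto
  then have "canonical_filtration h \<rho> l (2 * int n) = UNIV"
    using value_space_mono[of "{..<n}" _ l] n unfolding canonical_filtration_eq by blast
  then show "(\<Union>m. canonical_filtration h \<rho> l m) = UNIV" by blast
  have "{d. 2 * int d \<le> (- 2 * int (flag_dim h) - 1) + 2 * int (flag_dim h)} = {}" by auto
  then have "canonical_filtration h \<rho> l (- 2 * int (flag_dim h) - 1) = {0}"
    unfolding canonical_filtration_eq by (simp only: value_space_empty)
  then have "(\<Inter>m. canonical_filtration h \<rho> l m) \<subseteq> {0}" by blast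
  moreover have "0 \<in> canonical_filtration h \<rho> l m" for m
    unfolding canonical_filtration_eq by (rule complex_vector.subspace_0[OF subspace_value_space])
  ultimately show "(\<Inter>m. canonical_filtration h \<rho> l m) = {0}" by blast
qed

lemma coeff_kostka_polynomial:
  "coeff (kostka_polynomial h \<rho>) i =
    (if i \<le> flag_dim h then int (cdim (weyl_hom h \<rho> (2 * int (flag_dim h) - 2 * int i))) else 0)"
proof -
  let ?c = "\<lambda>i. int (cdim (weyl_hom h \<rho> (2 * int (flag_dim h) - 2 * int i)))"
  have "coeff (kostka_polynomial h \<rho>) i = (\<Sum>j\<le>flag_dim h. if j = i then ?c j else 0)"
    unfolding kostka_polynomial_def coeff_sum by (intro sum.cong) auto
  then show ?thesis by (simp add: sum.delta)
qed

end

lemma at_y_inv_squared_nth: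
  "fls_nth (at_y_inv_squared K) m = (if m \<le> 0 \<and> even m then coeff K (nat (- m div 2)) else 0)"
proof -
  define q where "q = map_poly (fls_const :: int \<Rightarrow> int fls) K"
  have q: "coeff q i = fls_const (coeff K i)" for i
    unfolding q_def by (rule coeff_map_poly) simp
  have "at_y_inv_squared K = (\<Sum>i\<le>degree q. fls_const (coeff K i) * fls_X_inv ^ (2 * i))"
    unfolding at_y_inv_squared_def q_def[symmetric] poly_altdef q by (simp add: power_mult)
  then have sum: "fls_nth (at_y_inv_squared K) m = (\<Sum>i\<le>degree q. if m = - 2 * int i then coeff K i else 0)"
    by (simp add: fls_nth_sum if_distrib cong: if_cong)
  show ?thesis
  proof (cases "m \<le> 0 \<and> even m")
    case True
    define j where "j = nat (- m div 2)"
    have j: "m = - 2 * int j" using True by (auto simp: j_def)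
    have "fls_nth (at_y_inv_squared K) m = (\<Sum>i\<le>degree q. if i = j then coeff K i else 0)"
      unfolding sum using j by (intro sum.cong) auto
    also have "\<dots> = (if j \<le> degree q then coeff K j else 0)" by (simp add: sum.delta)
    also have "\<dots> = coeff K j"
      using coeff_eq_0[of q j] q[of j] by (auto simp: not_le)
    finally show ?thesis using True by (simp add: j_def)
  next
    case False
    then have "m \<noteq> - 2 * int i" for i by auto
    then have "fls_nth (at_y_inv_squared K) m = 0" unfolding sum by (intro sum.neutral) auto
    then show ?thesis by (simp only: if_not_P[OF False])
  qed
qed

lemma (in weyl_representation) canonical_filtration_hilbert_series:
  assumes l: "l \<in> regular h"
  shows "graded_has_hilbert_series (canonical_filtration h \<rho> l) (at_y_inv_squared (kostka_polynomial h \<rho>))"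
  unfolding graded_has_hilbert_series_def
proof
  fix m
  let ?N = "int (flag_dim h)"
  let ?D = "\<lambda>m. {d. 2 * int d \<le> m + 2 * ?N}"
  let ?lhs = "fls_nth (at_y_inv_squared (kostka_polynomial h \<rho>)) m"
  let ?dim = "cdim (quotient_space (value_space l (?D m)) (value_space l (?D (m - 1))))"
  have trivial: "?dim = 0" if "?D m = ?D (m - 1)"
  proof -
    have "cdim ({0} :: 'v set) \<le> card ({} :: 'v set)"
      by (rule complex_vector.dim_le_card) simp_all
    then show ?thesis unfolding that quotient_space_self[OF subspace_value_space] by simp
  qed
  have "?lhs = int ?dim"
  proof (cases "even m \<and> 0 \<le> m + 2 * ?N")
    case False
    \<comment> \<open>An odd index admits no new degree, as polynomials have even degrees; below
      \<open>- 2 * ?N\<close> both index sets are empty.\<close>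
    have "?D m = ?D (m - 1)" using False by (auto elim: oddE) presburger+
    moreover have "?lhs = 0"
    proof (cases "m \<le> 0 \<and> even m")
      case True
      then have "m = - 2 * int (nat (- m div 2))" by auto
      moreover have "m + 2 * ?N < 0" using True False by auto
      ultimately have "\<not> nat (- m div 2) \<le> flag_dim h" by linarith
      then show ?thesis unfolding at_y_inv_squared_nth coeff_kostka_polynomial by simp
    next
      case False
      show ?thesis unfolding at_y_inv_squared_nth if_not_P[OF False] by (rule refl)
    qed
    ultimately show ?thesis using trivial by simp
  next
    case True
    \<comment> \<open>The one polynomial degree that is new at index \<open>m\<close>.\<close>
    define d where "d = nat ((m + 2 * ?N) div 2)"
    have d: "m + 2 * ?N = 2 * int d" using True by (auto simp: d_def)
    have "?D m = {..<Suc d}" "?D (m - 1) = {..<d}" using d by auto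
    then have dim: "?dim = cdim (weyl_hom h \<rho> (2 * int d))" using graded_dimension[OF l] by simp
    show ?thesis
    proof (cases "m \<le> 0")
      case neg: True
      define i where "i = nat (- m div 2)"
      have i: "m = - 2 * int i" using True neg by (auto simp: i_def)
      then have "2 * ?N - 2 * int i = 2 * int d" "i \<le> flag_dim h" using d by auto
      then have "?lhs = int (cdim (weyl_hom h \<rho> (2 * int d)))"
        using True neg unfolding at_y_inv_squared_nth coeff_kostka_polynomial i_def[symmetric] by simp
      then show ?thesis using dim by simp
    next
      case False
      \<comment> \<open>A positive index belongs to a degree above the dimension of the flag
        variety, where the coinvariants vanish.\<close>
      then have "?lhs = 0" by (simp add: at_y_inv_squared_nth)
      moreover have "flag_dim h < d" using d False by simp
      ultimately show ?thesis using dim weyl_hom_above[OF l] by simp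
    qed
  qed
  then show "?lhs = int (cdim (quotient_space (canonical_filtration h \<rho> l m) (canonical_filtration h \<rho> l (m - 1))))"
    unfolding canonical_filtration_eq .
qed

theorem corollary1p4:
  fixes h :: "'g::complex_lie_algebra set"
    and l :: "'g \<Rightarrow> complex"
    and \<rho> :: "(('g \<Rightarrow> complex) \<Rightarrow> 'g \<Rightarrow> complex) \<Rightarrow> 'v::complex_vector \<Rightarrow> 'v"
  assumes "semisimple TYPE('g)"
    and "cartan_subalgebra h"
    and "l \<in> regular h"
    and "irreducible_representation h \<rho>"
  shows "is_filtration (canonical_filtration h \<rho> l) \<and>
    graded_has_hilbert_series (canonical_filtration h \<rho> l)
      (at_y_inv_squared (kostka_polynomial h \<rho>))"
proof -
  interpret weyl_representation h \<rho> by unfold_locales (fact assms)+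
  show ?thesis
    using canonical_filtration_is_filtration canonical_filtration_hilbert_series assms(3) by blast
qed


end
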